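(* Let $M$ be a smooth, closed, orientable 2-manifold with volume form $\mu$ and Poisson structure $\pi$. Let $\mathcal{C}(\pi,\mu)$ be the set of functions $f\in C^\infty(M)$ satisfying $\{f,g\}_\pi=0$, where $g=\iota_\pi\mu$ and $\{\cdot,\cdot\}_\pi$ is the Poisson bracket defined by $\pi$. Then the map $$f\mapsto-\pi^\sharp\big(f\,dg+d(fg)\big)$$ sends $\mathcal{C}(\pi,\mu)$ surjectively onto the set of Poisson vector fields arising from the bracket $\{\cdot,\cdot\}_\mu$.
   Context: $A^p(M)$: $p$-vector fields; $\Omega^p(M)$: $p$-forms; $[\cdot,\cdot]$ is the Schouten-Nijenhuis bracket, with sign fixed by $\iota_{[P,Q]}=[[\iota_P,d],\iota_Q]$ (graded commutators), where $\iota_Y\iota_X=\iota_{X\wedge Y}$; $\mathcal{P}(M)=\{X\in A^2(M)\mid[X,X]=0\}$; $\{f,g\}_\pi=\pi(df,dg)$; $\pi^\sharp(\alpha)=\pi(\alpha,\cdot)$. Pairing: $(\beta,X)_\mu=\int_M(\iota_X\beta)\mu$; $\delta_{\pi,\mu}$ is the adjoint of $X\mapsto[\pi,X]$: $(\beta,[\pi,X])_\mu=(\delta_{\pi,\mu}\beta,X)_\mu$. Admissible functions: $\mathcal{A}$ is the space of functions $F:A^2(M)\to\mathbb{R}$, $F(\pi)=\int_Mf(j_r\pi)\mu$, $f:J_r(\Lambda^2TM)\to\mathbb{R}$ smooth, $r\ge0$ finite; $\mathcal{A}_0$ is the subspace vanishing on $\mathcal{P}(M)$; primitive admissible functions are elements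 of $\mathcal{A}/\mathcal{A}_0$, and admissible functions are elements of the commutative algebra they generate. $\beta_{F,\pi}\in\Omega^2(M)$ is defined by $\frac{dF}{dt}|_{t=0}=(\beta_{F,\pi},\dot\pi)_\mu$ for families $\pi(t)\in A^2(M)$ through $\pi$ (extended by the chain rule). The bracket is $\{F,G\}_\mu=(\delta_{\pi,\mu}\beta_{F,\pi}\wedge\delta_{\pi,\mu}\beta_{G,\pi},\pi)_\mu$, and with $V_{F,\pi}=\pi^\sharp(\delta_{\pi,\mu}\beta_{F,\pi})$ the set of Poisson vector fields arising from $\{\cdot,\cdot\}_\mu$ is $\{V_{F,\pi}\mid F\text{ admissible},\ [V_{F,\pi},\pi]=0\}$. *)

theory Defs
  imports "HOL-Analysis.Analysis" "HOL-Library.Function_Algebras"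
begin

section \<open>Smooth functions of finitely or infinitely many real coordinates\<close>

definition partial :: "'i \<Rightarrow> (('i \<Rightarrow> real) \<Rightarrow> real) \<Rightarrow> ('i \<Rightarrow> real) \<Rightarrow> real" where
  "partial i F v = deriv (\<lambda>t. F (v(i := t))) (v i)"

text \<open>
  Smoothness on an open set: all iterated partial derivatives exist and are continuous (for the
  product topology). The index type may be infinite; this is needed for jets, whose order is not
  bounded in advance.
\<close>

definition smooth_fun :: "('i \<Rightarrow> real) set \<Rightarrow> (('i \<Rightarrow> real) \<Rightarrow> real) \<Rightarrow> bool" where
  "smooth_fun S F \<longleftrightarrow> open S \<and>
     (\<forall>ks. continuous_on S (foldr partial ks F) \<and>
           (\<forall>v\<in>S. \<forall>i. (\<lambda>t. foldr partial ks F (v(i := t))) differentiable (at (v i))))"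

definition smooth_vec :: "(real^'n) set \<Rightarrow> (real^'n \<Rightarrow> real) \<Rightarrow> bool" where
  "smooth_vec S h \<longleftrightarrow> smooth_fun {v. vec_lambda v \<in> S} (\<lambda>v. h (vec_lambda v))"

definition pd :: "'n::finite \<Rightarrow> (real^'n \<Rightarrow> real) \<Rightarrow> real^'n \<Rightarrow> real" where
  "pd i h u = partial i (\<lambda>v. h (vec_lambda v)) (vec_nth u)"


section \<open>Manifolds\<close>

type_synonym ('a, 'n) chart = "'a set \<times> ('a \<Rightarrow> real^'n)"

abbreviation dom_of :: "('a, 'n) chart \<Rightarrow> 'a set" where
  "dom_of c \<equiv> fst c"

abbreviation img_of :: "('a, 'n) chart \<Rightarrow> (real^'n) set" where
  "img_of c \<equiv> snd c ` fst c"

definition chart_inv :: "('a, 'n) chart \<Rightarrow> real^'n \<Rightarrow> 'a" where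
  "chart_inv c = inv_into (fst c) (snd c)"

definition smooth_atlas :: "('a::topological_space, 'n::finite) chart set \<Rightarrow> bool" where
  "smooth_atlas A \<longleftrightarrow>
     (\<Union>c\<in>A. dom_of c) = UNIV \<and>
     (\<forall>c\<in>A. open (dom_of c) \<and> open (img_of c) \<and>
            homeomorphism (dom_of c) (img_of c) (snd c) (chart_inv c)) \<and>
     (\<forall>c\<in>A. \<forall>d\<in>A. \<forall>i.
        smooth_vec (snd c ` (dom_of c \<inter> dom_of d)) (\<lambda>u. snd d (chart_inv c u) $ i))"

definition closed_manifold ::
    "('a::{t2_space, second_countable_topology}, 'n::finite) chart set \<Rightarrow> bool" where
  "closed_manifold A \<longleftrightarrow> smooth_atlas A \<and> compact (UNIV :: 'a set)"

text \<open>\<open>jac c d x i j\<close> is the derivative of the \<open>i\<close>-th coordinate of \<open>d\<close> along the \<open>j\<close>-th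
  coordinate of \<open>c\<close>.\<close>

definition jac ::
    "('a, 'n::finite) chart \<Rightarrow> ('a, 'n) chart \<Rightarrow> 'a \<Rightarrow> 'n \<Rightarrow> 'n \<Rightarrow> real" where
  "jac c d x i j = pd j (\<lambda>u. snd d (chart_inv c u) $ i) (snd c x)"

definition orientable :: "('a::topological_space, 'n::finite) chart set \<Rightarrow> bool" where
  "orientable A \<longleftrightarrow>
     (\<exists>B. smooth_atlas (A \<union> B) \<and> (\<Union>c\<in>B. dom_of c) = UNIV \<and>
        (\<forall>c\<in>B. \<forall>d\<in>B. \<forall>x\<in>dom_of c \<inter> dom_of d. det (\<chi> i j. jac c d x i j) > 0))"

definition smooth_functions :: "('a, 'n::finite) chart set \<Rightarrow> ('a \<Rightarrow> real) set" where
  "smooth_functions A = {f. \<forall>c\<in>A. smooth_vec (img_of c) (\<lambda>u. f (chart_inv c u))}"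


section \<open>Multivector fields and differential forms\<close>

text \<open>
  A tensor field is the family of its components: \<open>P c x [i1, ..., ip]\<close> is the component at the
  point \<open>x\<close> with respect to the chart \<open>c\<close>. Components are \<open>0\<close> where this makes no sense, so that
  equality of tensor fields is equality of functions. Normalisation: \<open>X \<and> Y\<close> has components
  \<open>X i * Y j - X j * Y i\<close>, likewise for forms.
\<close>

type_synonym ('a, 'n) tensor = "('a, 'n) chart \<Rightarrow> 'a \<Rightarrow> 'n list \<Rightarrow> real"

definition smooth_alternating :: "('a, 'n::finite) chart set \<Rightarrow> nat \<Rightarrow> ('a, 'n) tensor \<Rightarrow> bool" where
  "smooth_alternating A p P \<longleftrightarrow>
     (\<forall>c x I. P c x I \<noteq> 0 \<longrightarrow> c \<in> A \<and> x \<in> dom_of c \<and> length I = p) \<and>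
     (\<forall>c x I k l. k < l \<and> l < length I \<longrightarrow> P c x (I[k := I ! l, l := I ! k]) = - P c x I) \<and>
     (\<forall>c\<in>A. \<forall>I. smooth_vec (img_of c) (\<lambda>u. P c (chart_inv c u) I))"

definition multivec :: "('a, 'n::finite) chart set \<Rightarrow> nat \<Rightarrow> ('a, 'n) tensor set" where
  "multivec A p = {P. smooth_alternating A p P \<and>
     (\<forall>c\<in>A. \<forall>d\<in>A. \<forall>x\<in>dom_of c \<inter> dom_of d. \<forall>J. length J = p \<longrightarrow>
        P d x J = (\<Sum>I | length I = p. (\<Prod>k<p. jac c d x (J ! k) (I ! k)) * P c x I))}"

definition diff_forms :: "('a, 'n::finite) chart set \<Rightarrow> nat \<Rightarrow> ('a, 'n) tensor set" where
  "diff_forms A p = {\<omega>. smooth_alternating A p \<omega> \<and>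
     (\<forall>c\<in>A. \<forall>d\<in>A. \<forall>x\<in>dom_of c \<inter> dom_of d. \<forall>J. length J = p \<longrightarrow>
        \<omega> d x J = (\<Sum>I | length I = p. (\<Prod>k<p. jac d c x (I ! k) (J ! k)) * \<omega> c x I))}"

definition of_fun :: "('a, 'n::finite) chart set \<Rightarrow> ('a \<Rightarrow> real) \<Rightarrow> ('a, 'n) tensor" where
  "of_fun A f = (\<lambda>c x I. if c \<in> A \<and> x \<in> dom_of c \<and> I = [] then f x else 0)"

text \<open>The component of a 0-form does not depend on the chart.\<close>

definition to_fun :: "('a, 'n::finite) chart set \<Rightarrow> ('a, 'n) tensor \<Rightarrow> 'a \<Rightarrow> real" where
  "to_fun A \<omega> x = \<omega> (SOME c. c \<in> A \<and> x \<in> dom_of c) x []"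

definition fscale :: "('a \<Rightarrow> real) \<Rightarrow> ('a, 'n) tensor \<Rightarrow> ('a, 'n) tensor" where
  "fscale f \<omega> = (\<lambda>c x I. f x * \<omega> c x I)"

definition ext_d :: "('a, 'n::finite) chart set \<Rightarrow> ('a, 'n) tensor \<Rightarrow> ('a, 'n) tensor" where
  "ext_d A \<omega> = (\<lambda>c x I. if c \<in> A \<and> x \<in> dom_of c
     then (\<Sum>k<length I. (-1) ^ k *
            pd (I ! k) (\<lambda>u. \<omega> c (chart_inv c u) (take k I @ drop (Suc k) I)) (snd c x))
     else 0)"

text \<open>Contraction with a \<open>p\<close>-vector field, \<open>\<iota>(X1 \<and> ... \<and> Xp) \<omega> = \<omega>(X1, ..., Xp, ...)\<close>; this is the
  convention \<open>\<iota>(Y) \<circ> \<iota>(X) = \<iota>(X \<and> Y)\<close>.\<close>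

definition iota ::
    "nat \<Rightarrow> ('a, 'n::finite) tensor \<Rightarrow> ('a, 'n) tensor \<Rightarrow> ('a, 'n) tensor" where
  "iota p P \<omega> = (\<lambda>c x J. (\<Sum>I | length I = p. P c x I * \<omega> c x (I @ J)) / fact p)"

text \<open>Graded commutator of operators whose degrees have the parities of \<open>a\<close> and \<open>b\<close>.\<close>

definition gcomm :: "nat \<Rightarrow> nat \<Rightarrow> (('a, 'n) tensor \<Rightarrow> ('a, 'n) tensor) \<Rightarrow>
    (('a, 'n) tensor \<Rightarrow> ('a, 'n) tensor) \<Rightarrow> ('a, 'n) tensor \<Rightarrow> ('a, 'n) tensor" where
  "gcomm a b S T \<omega> = (\<lambda>c x I. S (T \<omega>) c x I - (-1) ^ (a * b) * T (S \<omega>) c x I)"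

definition schouten :: "('a, 'n::finite) chart set \<Rightarrow> nat \<Rightarrow> nat \<Rightarrow>
    ('a, 'n) tensor \<Rightarrow> ('a, 'n) tensor \<Rightarrow> ('a, 'n) tensor" where
  "schouten A p q P Q = (THE R. R \<in> multivec A (p + q - 1) \<and>
     (\<forall>k. \<forall>\<omega>\<in>diff_forms A k. iota (p + q - 1) R \<omega> =
        gcomm (p + 1) q (gcomm p 1 (iota p P) (ext_d A)) (iota q Q) \<omega>))"


section \<open>Poisson structures\<close>

definition poisson_structures :: "('a, 'n::finite) chart set \<Rightarrow> ('a, 'n) tensor set" where
  "poisson_structures A = {X \<in> multivec A 2. schouten A 2 2 X X = 0}"

definition poisson_bracket :: "('a, 'n::finite) chart set \<Rightarrow> ('a, 'n) tensor \<Rightarrow>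
    ('a \<Rightarrow> real) \<Rightarrow> ('a \<Rightarrow> real) \<Rightarrow> 'a \<Rightarrow> real" where
  "poisson_bracket A \<pi> f g = to_fun A (\<lambda>c x I. if I = []
     then (\<Sum>i\<in>UNIV. \<Sum>j\<in>UNIV.
             \<pi> c x [i, j] * ext_d A (of_fun A f) c x [i] * ext_d A (of_fun A g) c x [j])
     else 0)"

definition sharp :: "('a, 'n::finite) tensor \<Rightarrow> ('a, 'n) tensor \<Rightarrow> ('a, 'n) tensor" where
  "sharp \<pi> \<alpha> = (\<lambda>c x J. case J of [j] \<Rightarrow> (\<Sum>i\<in>UNIV. \<pi> c x [i, j] * \<alpha> c x [i]) | _ \<Rightarrow> 0)"


section \<open>Volume forms, integration and the pairing\<close>

definition volume_form :: "('a, 'n::finite) chart set \<Rightarrow> ('a, 'n) tensor \<Rightarrow> bool" where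
  "volume_form A \<mu> \<longleftrightarrow> \<mu> \<in> diff_forms A CARD('n) \<and>
     (\<forall>c\<in>A. \<forall>x\<in>dom_of c. \<exists>I. \<mu> c x I \<noteq> 0)"

definition top_index :: "'n::finite list" where
  "top_index = (SOME I. distinct I \<and> set I = UNIV)"

definition partition_of_unity :: "('a::topological_space, 'n::finite) chart set \<Rightarrow>
    ('a, 'n::finite) chart set \<Rightarrow> (('a, 'n) chart \<Rightarrow> 'a \<Rightarrow> real) \<Rightarrow> bool" where
  "partition_of_unity A C \<rho> \<longleftrightarrow> finite C \<and> C \<subseteq> A \<and>
     (\<forall>c\<in>C. \<rho> c \<in> smooth_functions A \<and> (\<forall>x. 0 \<le> \<rho> c x) \<and> closure {x. \<rho> c x \<noteq> 0} \<subseteq> dom_of c) \<and>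
     (\<forall>x. (\<Sum>c\<in>C. \<rho> c x) = 1)"

text \<open>
  Integral of a top-degree form \<open>\<omega>\<close> over the manifold oriented by the volume form \<open>\<mu>\<close>. The factor
  \<open>sgn\<close> compares the orientation of the chart (ordered by \<open>top_index\<close>) with that of \<open>\<mu>\<close>; the product
  does not depend on the choice of \<open>top_index\<close>.
\<close>

definition integral_form :: "('a::topological_space, 'n::finite) chart set \<Rightarrow>
    ('a, 'n) tensor \<Rightarrow> ('a, 'n) tensor \<Rightarrow> real" where
  "integral_form A \<mu> \<omega> = (THE s. \<forall>C \<rho>. partition_of_unity A C \<rho> \<longrightarrow>
     s = (\<Sum>c\<in>C. LINT u:img_of c|lborel.
            \<rho> c (chart_inv c u) *
            (sgn (\<mu> c (chart_inv c u) top_index) * \<omega> c (chart_inv c u) top_index)))"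

definition pairing :: "('a::topological_space, 'n::finite) chart set \<Rightarrow> ('a, 'n) tensor \<Rightarrow>
    nat \<Rightarrow> ('a, 'n) tensor \<Rightarrow> ('a, 'n) tensor \<Rightarrow> real" where
  "pairing A \<mu> p \<beta> X = integral_form A \<mu> (fscale (to_fun A (iota p X \<beta>)) \<mu>)"

text \<open>The operator \<open>\<delta>\<close> from \<open>(p+1)\<close>-forms to \<open>p\<close>-forms, adjoint to \<open>X \<mapsto> [\<pi>, X]\<close>.\<close>

definition codiff :: "('a::topological_space, 'n::finite) chart set \<Rightarrow> ('a, 'n) tensor \<Rightarrow>
    ('a, 'n) tensor \<Rightarrow> nat \<Rightarrow> ('a, 'n) tensor \<Rightarrow> ('a, 'n) tensor" where
  "codiff A \<mu> \<pi> p \<beta> = (THE \<gamma>. \<gamma> \<in> diff_forms A p \<and>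
     (\<forall>X\<in>multivec A p.
        pairing A \<mu> (p + 1) \<beta> (schouten A 2 p \<pi> X) = pairing A \<mu> p \<gamma> X))"


section \<open>Admissible functions\<close>

text \<open>
  Coordinates of the \<open>r\<close>-jet of a bivector field: the point and all iterated partial derivatives of
  order at most \<open>r\<close> of all components; the remaining coordinates are \<open>0\<close>. These coordinates are
  redundant (partial derivatives commute, components are antisymmetric): over a chart they embed the
  jet bundle as a product with a linear subspace of a coordinate space, so a function on jets is
  smooth iff it extends to a smooth function of all the coordinates.
\<close>

definition jet_coords :: "nat \<Rightarrow> ('a, 'n::finite) chart \<Rightarrow> ('a, 'n) tensor \<Rightarrow> 'a \<Rightarrow>
    'n + 'n list \<times> 'n list \<Rightarrow> real" where
  "jet_coords r c \<pi> x = (\<lambda>k. case k of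
       Inl i \<Rightarrow> snd c x $ i
     | Inr (I, K) \<Rightarrow>
         if length K \<le> r then foldr pd K (\<lambda>u. \<pi> c (chart_inv c u) I) (snd c x) else 0)"

text \<open>A jet is a point together with the class of all global sections with the same derivatives
  there; every jet of a local section is of this form.\<close>

type_synonym ('a, 'n) jet = "'a \<times> ('a, 'n) tensor set"

definition jet :: "('a, 'n::finite) chart set \<Rightarrow> nat \<Rightarrow> ('a, 'n) tensor \<Rightarrow> 'a \<Rightarrow> ('a, 'n) jet" where
  "jet A r \<pi> x = (x, {\<sigma> \<in> multivec A 2.
     \<forall>c\<in>A. x \<in> dom_of c \<longrightarrow> jet_coords r c \<sigma> x = jet_coords r c \<pi> x})"

definition smooth_on_jets :: "('a, 'n::finite) chart set \<Rightarrow> nat \<Rightarrow> (('a, 'n) jet \<Rightarrow> real) \<Rightarrow> bool" where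
  "smooth_on_jets A r f \<longleftrightarrow>
     (\<forall>c\<in>A. \<exists>F. smooth_fun {v. (\<chi> i. v (Inl i)) \<in> img_of c} F \<and>
        (\<forall>x\<in>dom_of c. \<forall>\<pi>\<in>multivec A 2. f (jet A r \<pi> x) = F (jet_coords r c \<pi> x)))"

definition local_functionals :: "('a::topological_space, 'n::finite) chart set \<Rightarrow>
    ('a, 'n) tensor \<Rightarrow> (('a, 'n) tensor \<Rightarrow> real) set" where
  "local_functionals A \<mu> = {F. \<exists>r f. smooth_on_jets A r f \<and>
     (\<forall>\<pi>\<in>multivec A 2. F \<pi> = integral_form A \<mu> (fscale (\<lambda>x. f (jet A r \<pi> x)) \<mu>))}"

inductive_set functional_algebra :: "('a::topological_space, 'n::finite) chart set \<Rightarrow>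
    ('a, 'n) tensor \<Rightarrow> (('a, 'n) tensor \<Rightarrow> real) set"
  for A :: "('a, 'n::finite) chart set" and \<mu> :: "('a, 'n) tensor" where
  base: "F \<in> local_functionals A \<mu> \<Longrightarrow> F \<in> functional_algebra A \<mu>"
| scale: "F \<in> functional_algebra A \<mu> \<Longrightarrow> (\<lambda>\<pi>. s * F \<pi>) \<in> functional_algebra A \<mu>"
| add: "F \<in> functional_algebra A \<mu> \<Longrightarrow> G \<in> functional_algebra A \<mu> \<Longrightarrow>
    (\<lambda>\<pi>. F \<pi> + G \<pi>) \<in> functional_algebra A \<mu>"
| mult: "F \<in> functional_algebra A \<mu> \<Longrightarrow> G \<in> functional_algebra A \<mu> \<Longrightarrow>
    (\<lambda>\<pi>. F \<pi> * G \<pi>) \<in> functional_algebra A \<mu>"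

text \<open>Functionals are identified when they agree on all Poisson structures; a class is represented
  by the common restriction.\<close>

definition admissible :: "('a::topological_space, 'n::finite) chart set \<Rightarrow>
    ('a, 'n) tensor \<Rightarrow> (('a, 'n) tensor \<Rightarrow> real) set" where
  "admissible A \<mu> = (\<lambda>F. restrict F (poisson_structures A)) ` functional_algebra A \<mu>"

definition smooth_family :: "('a, 'n::finite) chart set \<Rightarrow> (real \<Rightarrow> ('a, 'n) tensor) \<Rightarrow> bool" where
  "smooth_family A \<Theta> \<longleftrightarrow> (\<forall>t. \<Theta> t \<in> multivec A 2) \<and>
     (\<forall>c\<in>A. \<forall>I. smooth_fun {v. (\<chi> i. v (Some i)) \<in> img_of c}
        (\<lambda>v. \<Theta> (v None) c (chart_inv c (\<chi> i. v (Some i))) I))"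

text \<open>\<open>gradient A \<mu> F \<pi> \<beta>\<close>: the 2-form \<open>\<beta>\<close> is the derivative of \<open>F\<close> at \<open>\<pi>\<close>.
  Stated directly for elements of the algebra, for which it amounts to the product rule.\<close>

definition gradient :: "('a::topological_space, 'n::finite) chart set \<Rightarrow> ('a, 'n) tensor \<Rightarrow>
    (('a, 'n) tensor \<Rightarrow> real) \<Rightarrow> ('a, 'n) tensor \<Rightarrow> ('a, 'n) tensor \<Rightarrow> bool" where
  "gradient A \<mu> F \<pi> \<beta> \<longleftrightarrow> \<beta> \<in> diff_forms A 2 \<and>
     (\<forall>\<Theta>. smooth_family A \<Theta> \<and> \<Theta> 0 = \<pi> \<longrightarrow>
        ((\<lambda>t. F (\<Theta> t)) has_real_derivative
           pairing A \<mu> 2 \<beta> (\<lambda>c x I. deriv (\<lambda>t. \<Theta> t c x I) 0)) (at 0))"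

definition arising_poisson_fields :: "('a::topological_space, 'n::finite) chart set \<Rightarrow>
    ('a, 'n) tensor \<Rightarrow> ('a, 'n) tensor \<Rightarrow> ('a, 'n) tensor set" where
  "arising_poisson_fields A \<mu> \<pi> = {V. \<exists>\<Phi>\<in>admissible A \<mu>. \<exists>F\<in>functional_algebra A \<mu>. \<exists>\<beta>.
     restrict F (poisson_structures A) = \<Phi> \<and> gradient A \<mu> F \<pi> \<beta> \<and>
     V = sharp \<pi> (codiff A \<mu> \<pi> 1 \<beta>) \<and> schouten A 1 2 V \<pi> = 0}"

definition casimir_set :: "('a, 'n::finite) chart set \<Rightarrow> ('a, 'n) tensor \<Rightarrow>
    ('a, 'n) tensor \<Rightarrow> ('a \<Rightarrow> real) set" where
  "casimir_set A \<pi> \<mu> =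
     {f \<in> smooth_functions A. \<forall>x. poisson_bracket A \<pi> f (to_fun A (iota 2 \<pi> \<mu>)) x = 0}"

end

theory Submission
  imports Defs
begin

text \<open>
  Every 2-form is \<open>f \<mu>\<close> for a function \<open>f\<close>, and it is the gradient of the functional sending \<open>\<pi>\<close>
  to the integral of \<open>f g \<mu>\<close>, where \<open>g\<close> is the contraction of \<open>\<mu>\<close> with \<open>\<pi>\<close>. The contraction of \<open>\<mu>\<close>
  with \<open>[\<pi>, X]\<close> is \<open>g div X - X g\<close>, and integrating by parts gives \<open>\<delta> (f \<mu>) = - (f dg + d (f g))\<close>. The
  contraction of \<open>\<mu>\<close> with the resulting vector field \<open>V\<close> is the exact form \<open>d (f g\<^sup>2)\<close>, so \<open>div V = 0\<close>
  and the contraction of \<open>\<mu>\<close> with \<open>[V, \<pi>]\<close> is \<open>V g = - g {f, g}\<close>. Since \<open>{f, g}\<close> vanishes wherever \<open>g\<close>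
  does, \<open>V\<close> is a Poisson vector field if and only if \<open>{f, g} = 0\<close>.
\<close>

section \<open>Calculus for functions of families of real coordinates\<close>

text \<open>The operations \<open>integral_form\<close>, \<open>schouten\<close> and
  \<open>codiff\<close> are definite descriptions, so every computation with them rests on existence
  and uniqueness. For the integral this means partitions of unity and independence of the partition,
  which comes from change of variables; the orientation sign turns the component of
  \<open>\<mu>\<close> into its absolute value, so that all integration is against a positive
  density. For the bracket, contraction with the nowhere vanishing form \<open>\<mu>\<close>
  determines a bivector field. For the codifferential, uniqueness is nondegeneracy of the pairing,
  tested on vector fields supported in one chart. Contraction with \<open>\<mu>\<close> also turns
  bivector fields into functions, which is what reduces brackets to divergences and directional
  derivatives. Smoothness is a condition on iterated partial derivatives over an index set that may
  be infinite, because functions on jets are included; product rule, chain rule and symmetry of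
  second derivatives are therefore established for functions of families of coordinates.\<close>

primrec C_k :: "nat \<Rightarrow> ('i \<Rightarrow> real) set \<Rightarrow> (('i \<Rightarrow> real) \<Rightarrow> real) \<Rightarrow> bool" where
  "C_k 0 S F \<longleftrightarrow> continuous_on S F"
| "C_k (Suc n) S F \<longleftrightarrow> continuous_on S F \<and>
     (\<forall>v\<in>S. \<forall>i. (\<lambda>t. F (v(i := t))) differentiable (at (v i))) \<and> (\<forall>i. C_k n S (partial i F))"

lemma C_k_continuous: "C_k n S F \<Longrightarrow> continuous_on S F"
  by (cases n) auto

lemma C_k_Suc: "C_k (Suc n) S F \<Longrightarrow> C_k n S F"
  by (induction n arbitrary: F) (auto intro: C_k_continuous)

lemma C_k_subset: "C_k n S F \<Longrightarrow> T \<subseteq> S \<Longrightarrow> C_k n T F"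
  by (induction n arbitrary: F) (auto intro: continuous_on_subset)

text \<open>\<open>C_k\<close> peels off the innermost derivative, and in
  \<open>foldr partial\<close> that one stands last; hence the lists \<open>ks @ [i]\<close>. The
  gain is induction on the order: derivatives of products, inverses and compositions are built from
  functions of one order less.\<close>

lemma smooth_fun_iff: "smooth_fun S F \<longleftrightarrow> open S \<and> (\<forall>n. C_k n S F)"
proof (intro iffI conjI allI)
  fix n
  assume *: "smooth_fun S F"
  then show "open S" by (simp add: smooth_fun_def)
  show "C_k n S F"
    using *
  proof (induction n arbitrary: F)
    case 0
    from "0"[unfolded smooth_fun_def, THEN conjunct2, rule_format, of "[]"] show ?case by simp
  next
    case (Suc n)
    have "smooth_fun S (partial i F)" for i
      unfolding smooth_fun_def
    proof (intro conjI allI)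
      show "open S" using Suc.prems by (simp add: smooth_fun_def)
      fix ks
      from Suc.prems[unfolded smooth_fun_def, THEN conjunct2, rule_format, of "ks @ [i]"]
      show "continuous_on S (foldr partial ks (partial i F))"
        "\<forall>v\<in>S. \<forall>j. (\<lambda>t. foldr partial ks (partial i F) (v(j := t))) differentiable at (v j)"
        by auto
    qed
    then show ?case
      using Suc.prems[unfolded smooth_fun_def, THEN conjunct2, rule_format, of "[]"] Suc.IH by auto
  qed
next
  assume *: "open S \<and> (\<forall>n. C_k n S F)"
  have "\<forall>n. C_k n S (foldr partial ks F)" for ks
    using * by (induction ks) (auto intro: C_k.simps(2)[THEN iffD1, THEN conjunct2, THEN conjunct2, rule_format])
  then have "C_k (Suc 0) S (foldr partial ks F)" for ks by blast
  then show "smooth_fun S F" using * by (auto simp: smooth_fun_def)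
qed

section \<open>Locality of partial derivatives in the product topology\<close>

lemma tendsto_fun_componentwise:
  fixes f :: "'x \<Rightarrow> 'i \<Rightarrow> 'b::topological_space"
  assumes "\<And>i. ((\<lambda>x. f x i) \<longlongrightarrow> l i) G"
  shows "(f \<longlongrightarrow> l) G"
proof -
  have "limitin (product_topology (\<lambda>i. euclidean) UNIV) f l G"
    using assms by (simp add: limitin_componentwise)
  then show ?thesis by (simp add: euclidean_product_topology)
qed

lemma continuous_on_open_tendsto_nhds:
  assumes "open S" "continuous_on S G" "v \<in> S"
  shows "(G \<longlongrightarrow> G v) (nhds v)"
proof -
  have "(G \<longlongrightarrow> G v) (at v)"
    using assms at_within_open[OF assms(3,1)] by (auto simp: continuous_on_def)
  then show ?thesis by (simp add: tendsto_at_iff_tendsto_nhds)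
qed

text \<open>Updating one coordinate is continuous for the product topology. This is what makes
  \<open>partial\<close> a local operation on open sets.\<close>

lemma eventually_line_in:
  assumes "open S" "(v :: 'i \<Rightarrow> real) \<in> S"
  shows "\<forall>\<^sub>F t in nhds (v i). v(i := t) \<in> S"
proof -
  have "((\<lambda>t. v(i := t)) \<longlongrightarrow> v(i := v i)) (nhds (v i))"
  proof (rule tendsto_fun_componentwise)
    show "((\<lambda>t. (v(i := t)) j) \<longlongrightarrow> (v(i := v i)) j) (nhds (v i))" for j
      by (cases "j = i") (simp_all add: filterlim_ident)
  qed
  then show ?thesis
    using assms by (auto simp: tendsto_def)
qed

lemma partial_cong:
  assumes "open S" "v \<in> S" "\<And>w. w \<in> S \<Longrightarrow> F w = G w"
  shows "partial i F v = partial i G v"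
  unfolding partial_def
  by (rule deriv_cong_ev) (use eventually_line_in[OF assms(1,2), of i] assms(3) in \<open>auto elim: eventually_mono\<close>)

lemma differentiable_cong_ev:
  fixes f g :: "real \<Rightarrow> real"
  assumes "f differentiable (at x)" "\<forall>\<^sub>F t in nhds x. f t = g t"
  shows "g differentiable (at x)"
proof -
  obtain D where "(f has_real_derivative D) (at x)"
    using assms(1) real_differentiable_def by blast
  then have "(g has_real_derivative D) (at x)"
    using DERIV_cong_ev[OF refl assms(2) refl] by blast
  then show ?thesis using real_differentiable_def by blast
qed

lemma C_k_cong:
  assumes "open S" "\<And>w. w \<in> S \<Longrightarrow> F w = G w" "C_k n S F"
  shows "C_k n S G"
  using assms(2,3)
proof (induction n arbitrary: F G)
  case 0
  then show ?case by (simp cong: continuous_on_cong)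
next
  case (Suc n)
  have "continuous_on S G"
    using Suc.prems by (simp cong: continuous_on_cong)
  moreover have "(\<lambda>t. G (v(i := t))) differentiable (at (v i))" if "v \<in> S" for v i
  proof (rule differentiable_cong_ev)
    show "(\<lambda>t. F (v(i := t))) differentiable (at (v i))" using Suc.prems(2) that by simp
    show "\<forall>\<^sub>F t in nhds (v i). F (v(i := t)) = G (v(i := t))"
      by (rule eventually_mono[OF eventually_line_in[OF assms(1) that]]) (rule Suc.prems(1))
  qed
  moreover have "C_k n S (partial i G)" for i
  proof (rule Suc.IH)
    show "partial i F w = partial i G w" if "w \<in> S" for w
      using partial_cong[OF assms(1) that] Suc.prems(1) by blast
    show "C_k n S (partial i F)" using Suc.prems(2) by simp
  qed
  ultimately show ?case by simp
qed

lemma C_k_UN: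
  assumes "\<And>k. k \<in> K \<Longrightarrow> open (S k)" "\<And>k. k \<in> K \<Longrightarrow> C_k n (S k) F"
  shows "C_k n (\<Union>k\<in>K. S k) F"
  using assms(2)
  by (induction n arbitrary: F) (auto intro: continuous_on_open_UN assms(1))

lemma partial_const [simp]: "partial i (\<lambda>v. k) = (\<lambda>v. 0)"
  by (simp add: partial_def fun_eq_iff)

lemma partial_coord: "partial i (\<lambda>v. v j) = (\<lambda>v. if i = j then 1 else 0)"
  by (auto simp: partial_def fun_eq_iff)

lemma C_k_const: "C_k n S (\<lambda>v. k)"
  by (induction n arbitrary: k) auto

lemma C_k_coord: "C_k n S (\<lambda>v. v j)"
proof (cases n)
  case (Suc m)
  have "(\<lambda>t. if j = i then t else v j) differentiable (at (v i))" for v i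
    by (cases "j = i") simp_all
  then show ?thesis
    by (auto simp: Suc partial_coord C_k_const intro: continuous_on_subset[OF continuous_on_product_coordinates])
qed (auto intro: continuous_on_subset[OF continuous_on_product_coordinates])

lemma has_partial:
  assumes "C_k (Suc n) S F" "v \<in> S"
  shows "((\<lambda>t. F (v(i := t))) has_real_derivative partial i F v) (at (v i))"
  using assms by (auto simp: partial_def DERIV_deriv_iff_real_differentiable)

lemma partial_eqI:
  assumes "((\<lambda>t. F (v(i := t))) has_real_derivative D) (at (v i))"
  shows "partial i F v = D"
  using assms by (simp add: partial_def DERIV_imp_deriv)

lemma differentiableI_real: "(f has_real_derivative D) (at x) \<Longrightarrow> f differentiable (at x)"
  using real_differentiable_def by blast

text \<open>In applications the derivative formula \<open>F'\<close> is known only at points of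
  \<open>S\<close>; as \<open>S\<close> is open, \<open>C_k_cong\<close> transfers its regularity to
  \<open>partial i F\<close>.\<close>

lemma C_k_SucI:
  assumes "open S" "continuous_on S F"
    and "\<And>v i. v \<in> S \<Longrightarrow> ((\<lambda>t. F (v(i := t))) has_real_derivative F' i v) (at (v i))"
    and "\<And>i. C_k n S (F' i)"
  shows "C_k (Suc n) S F"
proof -
  have "C_k n S (partial i F)" for i
    by (rule C_k_cong[OF assms(1) _ assms(4)[of i]]) (rule partial_eqI[OF assms(3), symmetric])
  then show ?thesis
    using assms(2,3) by (auto intro: differentiableI_real)
qed

lemma C_k_add:
  assumes "open S" "C_k n S F" "C_k n S G"
  shows "C_k n S (\<lambda>v. F v + G v)"
  using assms(2,3)
proof (induction n arbitrary: F G)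
  case 0
  then show ?case by (auto intro: continuous_intros)
next
  case (Suc n)
  show ?case
  proof (rule C_k_SucI[OF assms(1)])
    show "continuous_on S (\<lambda>v. F v + G v)" using Suc.prems by (auto intro: continuous_intros)
    show "C_k n S (\<lambda>v. partial i F v + partial i G v)" for i using Suc by auto
  qed (rule DERIV_add; rule has_partial; use Suc.prems in blast)
qed

lemma C_k_mult:
  assumes "open S" "C_k n S F" "C_k n S G"
  shows "C_k n S (\<lambda>v. F v * G v)"
  using assms(2,3)
proof (induction n arbitrary: F G)
  case 0
  then show ?case by (auto intro: continuous_intros)
next
  case (Suc n)
  show ?case
  proof (rule C_k_SucI[OF assms(1)])
    show "continuous_on S (\<lambda>v. F v * G v)" using Suc.prems by (auto intro: continuous_intros)
    show "C_k n S (\<lambda>v. partial i F v * G v + partial i G v * F v)" for i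
      using Suc.prems by (intro C_k_add[OF assms(1)] Suc.IH) (auto intro: C_k_Suc simp del: C_k.simps(2), auto)
    show "((\<lambda>t. F (v(i := t)) * G (v(i := t))) has_real_derivative
        partial i F v * G v + partial i G v * F v) (at (v i))" if "v \<in> S" for v i
      using DERIV_mult[OF has_partial[OF Suc.prems(1) that, of i] has_partial[OF Suc.prems(2) that, of i]]
      unfolding fun_upd_triv .
  qed
qed

lemma C_k_sum:
  assumes "open S" "\<And>j. j \<in> J \<Longrightarrow> C_k n S (F j)"
  shows "C_k n S (\<lambda>v. \<Sum>j\<in>J. F j v)"
  using assms(2) by (induction J rule: infinite_finite_induct) (auto intro: C_k_const C_k_add[OF assms(1)])

text \<open>The derivative \<open>- F' / F^2\<close> contains the inverse again, but only at order
  \<open>n\<close>, where the induction hypothesis controls it.\<close>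

lemma C_k_inverse:
  assumes "open S" "C_k n S F" "\<And>v. v \<in> S \<Longrightarrow> F v \<noteq> 0"
  shows "C_k n S (\<lambda>v. inverse (F v))"
  using assms(2)
proof (induction n)
  case 0
  then show ?case using assms(3) by (auto intro: continuous_intros)
next
  case (Suc n)
  show ?case
  proof (rule C_k_SucI[OF assms(1)])
    show "continuous_on S (\<lambda>v. inverse (F v))" using Suc.prems assms(3) by (auto intro: continuous_intros)
    have "C_k n S (\<lambda>v. inverse (F v))" using Suc by (auto intro: C_k_Suc simp del: C_k.simps)
    then show "C_k n S (\<lambda>v. - 1 * partial i F v * inverse (F v) * inverse (F v))" for i
      using Suc.prems by (intro C_k_mult[OF assms(1)] C_k_const) auto
    show "((\<lambda>t. inverse (F (v(i := t)))) has_real_derivative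
        - 1 * partial i F v * inverse (F v) * inverse (F v)) (at (v i))" if "v \<in> S" for v i
    proof -
      have "((\<lambda>t. inverse (F (v(i := t)))) has_real_derivative
          - (inverse (F v) * partial i F v * inverse (F v))) (at (v i))"
        using DERIV_inverse'[OF has_partial[OF Suc.prems that, of i]] assms(3)[OF that]
        unfolding fun_upd_triv by blast
      then show ?thesis by (simp add: mult_ac del: fun_upd_apply)
    qed
  qed
qed

text \<open>Continuous partial derivatives yield a total derivative one coordinate at a time, by
  induction on the finite set \<open>J\<close> of coordinates in which \<open>a\<close> varies. All
  other coordinates, possibly infinitely many, are frozen at their values at
  \<open>s\<close>.\<close>

lemma chain_rule_partials_aux:
  fixes F :: "('i \<Rightarrow> real) \<Rightarrow> real" and a :: "'x::real_normed_vector \<Rightarrow> 'i \<Rightarrow> real"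
  assumes T: "open T" "C_k (Suc 0) T F" and "finite J"
    and a: "\<And>i. i \<in> J \<Longrightarrow> ((\<lambda>t. a t i) has_derivative a' i) (at s)"
    and "\<And>i t. i \<notin> J \<Longrightarrow> a t i = a s i" and "a s \<in> T"
  shows "((\<lambda>t. F (a t)) has_derivative (\<lambda>h. \<Sum>i\<in>J. partial i F (a s) * a' i h)) (at s)"
  using assms(3,4,5,6)
proof (induction J arbitrary: a)
  case empty
  then have "a t = a s" for t by (intro ext) blast
  then have "(\<lambda>t. F (a t)) = (\<lambda>t. F (a s))" by (intro ext) metis
  then show ?case by simp
next
  case (insert k J)
  \<comment> \<open>Freezing coordinate \<open>k\<close> brings \<open>b\<close> within reach of the
    induction hypothesis. \<open>\<phi>\<close> then makes coordinate \<open>k\<close> a variable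
    \<open>y\<close> of its own, and \<open>\<phi> t (a t k)\<close> is the original
    function.\<close>
  define b where "b t = (a t)(k := a s k)" for t
  define \<phi> where "\<phi> t y = F ((b t)(k := y))" for t y
  define \<phi>' where "\<phi>' t y = partial k F ((b t)(k := y))" for t y
  have bs: "b s = a s" by (simp add: b_def)
  have IH: "((\<lambda>t. F (b t)) has_derivative (\<lambda>h. \<Sum>i\<in>J. partial i F (b s) * a' i h)) (at s)"
  proof (rule insert.IH)
    show "b t i = b s i" if "i \<notin> J" for i t
      using insert.prems(2)[of i t] that by (cases "i = k") (simp_all add: b_def)
    show "((\<lambda>t. b t i) has_derivative a' i) (at s)" if "i \<in> J" for i
    proof -
      have "(\<lambda>t. b t i) = (\<lambda>t. a t i)" using that insert.hyps by (auto simp: b_def)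
      then show ?thesis using insert.prems(1) that by simp
    qed
  qed (use insert.prems(3) in \<open>simp add: bs\<close>)
  have tb: "((\<lambda>t. b t i) \<longlongrightarrow> b s i) (nhds s)" for i
  proof (cases "i \<in> J \<and> i \<noteq> k")
    case True
    then have "isCont (\<lambda>t. a t i) s" using insert.prems(1) has_derivative_continuous by blast
    then have "((\<lambda>t. a t i) \<longlongrightarrow> a s i) (nhds s)" by (simp add: isCont_def tendsto_at_iff_tendsto_nhds[of "\<lambda>t. a t i"])
    then show ?thesis using True by (simp add: b_def)
  next
    case False
    have "b t i = b s i" for t
    proof (cases "i = k")
      case neq: False
      then have "a t i = a s i" using False insert.prems(2)[of i t] by blast
      then show ?thesis using neq by (simp add: b_def)
    qed (simp add: b_def)
    then have "(\<lambda>t. b t i) = (\<lambda>t. b s i)" by (rule ext)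
    then show ?thesis by simp
  qed
  have lim: "((\<lambda>(t, y). (b t)(k := y)) \<longlongrightarrow> a s) (nhds s \<times>\<^sub>F nhds (a s k))"
  proof (rule tendsto_fun_componentwise)
    fix i
    show "((\<lambda>x. (case x of (t, y) \<Rightarrow> (b t)(k := y)) i) \<longlongrightarrow> a s i) (nhds s \<times>\<^sub>F nhds (a s k))"
    proof (cases "i = k")
      case True
      then show ?thesis using filterlim_snd[of "nhds (a s k)" "nhds s"] by (simp add: split_def)
    next
      case False
      then show ?thesis
        using filterlim_compose[OF tb[of i] filterlim_fst[of "nhds s" "nhds (a s k)"]]
        by (simp add: split_def bs)
    qed
  qed
  have "\<forall>\<^sub>F z in nhds s \<times>\<^sub>F nhds (a s k). (case z of (t, y) \<Rightarrow> (b t)(k := y)) \<in> T"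
    using topological_tendstoD[OF lim T(1) insert.prems(3)] .
  \<comment> \<open>\<open>has_derivative_partialsI\<close> works on a product set with convex
    second factor, so the neighbourhood is shrunk to a rectangle whose second factor is a
    ball.\<close>
  then obtain P Q where PQ: "eventually P (nhds s)" "eventually Q (nhds (a s k))"
    "\<And>t y. P t \<Longrightarrow> Q y \<Longrightarrow> (b t)(k := y) \<in> T"
    unfolding eventually_prod_filter by auto
  obtain X where X: "open X" "s \<in> X" "\<And>t. t \<in> X \<Longrightarrow> P t"
    using PQ(1) unfolding eventually_nhds by blast
  obtain e where e: "e > 0" "\<And>y. y \<in> ball (a s k) e \<Longrightarrow> Q y"
    using PQ(2) unfolding eventually_nhds_metric by (auto simp: dist_commute)
  let ?Y = "ball (a s k) e"
  have inT: "(b t)(k := y) \<in> T" if "t \<in> X" "y \<in> ?Y" for t y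
    using PQ(3) X(3) e(2) that by blast
  have "((\<lambda>(t, y). \<phi> t y) has_derivative
     (\<lambda>(dt, dy). (\<Sum>i\<in>J. partial i F (b s) * a' i dt) + blinfun_apply (blinfun_mult_right (\<phi>' s (a s k))) dy))
       (at (s, a s k) within X \<times> ?Y)"
  proof (rule has_derivative_partialsI[where fy = "\<lambda>t y. blinfun_mult_right (\<phi>' t y)"])
    have "(\<lambda>t. \<phi> t (a s k)) = (\<lambda>t. F (b t))" by (auto simp: \<phi>_def b_def)
    then show "((\<lambda>t. \<phi> t (a s k)) has_derivative (\<lambda>h. \<Sum>i\<in>J. partial i F (b s) * a' i h)) (at s within X)"
      using IH by (simp add: has_derivative_at_withinI)
    fix t y assume ty: "t \<in> X" "y \<in> ?Y"
    have "((\<lambda>r. F ((b t)(k := r))) has_real_derivative partial k F ((b t)(k := y))) (at y)"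
      using has_partial[OF T(2) inT[OF ty], of k] by simp
    then show "(\<phi> t has_derivative blinfun_apply (blinfun_mult_right (\<phi>' t y))) (at y within ?Y)"
      by (simp add: has_field_derivative_def has_derivative_at_withinI \<phi>_def[abs_def] \<phi>'_def)
  next
    have "continuous_on T (partial k F)" using T(2) by simp
    from filterlim_compose[OF continuous_on_open_tendsto_nhds[OF T(1) this insert.prems(3)] lim]
    have "((\<lambda>(t, y). \<phi>' t y) \<longlongrightarrow> \<phi>' s (a s k)) (nhds (s, a s k))"
      by (simp add: \<phi>'_def[abs_def] split_def bs nhds_prod)
    then have "((\<lambda>(t, y). \<phi>' t y) \<longlongrightarrow> \<phi>' s (a s k)) (at (s, a s k) within X \<times> ?Y)"
      by (rule filterlim_mono) (auto simp: at_within_def)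
    then show "continuous (at (s, a s k) within X \<times> ?Y) (\<lambda>(t, y). blinfun_mult_right (\<phi>' t y))"
      unfolding continuous_within
      by (auto simp: split_def intro!: bounded_linear.tendsto[OF bounded_linear_blinfun_mult_right])
  qed (use e in auto)
  then have D: "((\<lambda>(t, y). \<phi> t y) has_derivative
     (\<lambda>(dt, dy). (\<Sum>i\<in>J. partial i F (b s) * a' i dt) + \<phi>' s (a s k) * dy)) (at (s, a s k))"
    using X(1,2) e(1) by (subst (asm) at_within_open) (auto intro: open_Times)
  have "((\<lambda>t. (t, a t k)) has_derivative (\<lambda>h. (h, a' k h))) (at s)"
    using insert.prems(1)[of k] by (intro has_derivative_Pair has_derivative_ident) simp
  from has_derivative_compose[OF this D]
  have "((\<lambda>t. \<phi> t (a t k)) has_derivative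
      (\<lambda>h. (\<Sum>i\<in>J. partial i F (b s) * a' i h) + \<phi>' s (a s k) * a' k h)) (at s)"
    by (simp only: prod.case)
  moreover have "(\<lambda>t. \<phi> t (a t k)) = (\<lambda>t. F (a t))" by (auto simp: \<phi>_def b_def)
  moreover have "\<phi>' s (a s k) = partial k F (a s)" by (simp add: \<phi>'_def bs)
  moreover have "(\<lambda>h. (\<Sum>i\<in>J. partial i F (b s) * a' i h) + partial k F (a s) * a' k h)
      = (\<lambda>h. \<Sum>i\<in>insert k J. partial i F (a s) * a' i h)"
    using insert.hyps by (auto simp: bs algebra_simps)
  ultimately show ?case by simp
qed

lemma chain_rule_partials_has_derivative:
  fixes F :: "('i::finite \<Rightarrow> real) \<Rightarrow> real" and a :: "'x::real_normed_vector \<Rightarrow> 'i \<Rightarrow> real"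
  assumes "open T" "C_k (Suc n) T F" "a s \<in> T"
    and "\<And>i. ((\<lambda>t. a t i) has_derivative a' i) (at s)"
  shows "((\<lambda>t. F (a t)) has_derivative (\<lambda>h. \<Sum>i\<in>UNIV. partial i F (a s) * a' i h)) (at s)"
proof (rule chain_rule_partials_aux[OF assms(1)])
  show "C_k (Suc 0) T F"
    using assms(2) by (auto intro: C_k_continuous)
qed (use assms in auto)

lemma chain_rule_partials:
  fixes F :: "('i::finite \<Rightarrow> real) \<Rightarrow> real"
  assumes "open T" "C_k (Suc n) T F" "a s \<in> T"
    and "\<And>i. ((\<lambda>t. a t i) has_real_derivative a' i) (at s)"
  shows "((\<lambda>t. F (a t)) has_real_derivative (\<Sum>i\<in>UNIV. partial i F (a s) * a' i)) (at s)"
  using chain_rule_partials_has_derivative[OF assms(1,2), of a s "\<lambda>i. (*) (a' i)"] assms(3,4)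
  by (simp add: has_field_derivative_def mult.assoc[symmetric] sum_distrib_right[symmetric] fun_eq_iff[symmetric])

lemma C_k_compose:
  fixes F :: "('i::finite \<Rightarrow> real) \<Rightarrow> real" and G :: "('j \<Rightarrow> real) \<Rightarrow> 'i \<Rightarrow> real"
  assumes S: "open S" and T: "open T" and "C_k n T F" "\<And>i. C_k n S (\<lambda>v. G v i)"
    and GT: "\<And>v. v \<in> S \<Longrightarrow> G v \<in> T"
  shows "C_k n S (\<lambda>v. F (G v))"
  using assms(3,4)
proof (induction n arbitrary: F)
  case 0
  then have "continuous_on S G" by (auto intro: continuous_on_coordinatewise_then_product)
  then show ?case using 0 GT continuous_on_compose2[of T F S G] by auto
next
  case (Suc n)
  have C: "C_k n S (\<lambda>v. G v i)" for i using Suc.prems(2) C_k_Suc by blast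
  have "continuous_on S G" using Suc.prems by (auto intro: continuous_on_coordinatewise_then_product)
  then have "continuous_on S (\<lambda>v. F (G v))"
    using Suc.prems(1) GT continuous_on_compose2[of T F S G] by auto
  moreover have "((\<lambda>t. F (G (v(j := t)))) has_real_derivative
      (\<Sum>i\<in>UNIV. partial i F (G v) * partial j (\<lambda>v. G v i) v)) (at (v j))" if "v \<in> S" for v j
  proof -
    have "((\<lambda>t. F (G (v(j := t)))) has_real_derivative
      (\<Sum>i\<in>UNIV. partial i F (G (v(j := v j))) * partial j (\<lambda>v. G v i) v)) (at (v j))"
    proof (rule chain_rule_partials[OF T Suc.prems(1)])
      show "G (v(j := v j)) \<in> T" using GT[OF that] by simp
      show "((\<lambda>t. G (v(j := t)) i) has_real_derivative partial j (\<lambda>v. G v i) v) (at (v j))" for i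
        by (rule has_partial[OF Suc.prems(2) that])
    qed
    then show ?thesis by simp
  qed
  moreover have "C_k n S (\<lambda>v. \<Sum>i\<in>UNIV. partial i F (G v) * partial j (\<lambda>v. G v i) v)" for j
  proof (intro C_k_sum[OF S] C_k_mult[OF S])
    show "C_k n S (\<lambda>v. partial i F (G v))" for i
      by (rule Suc.IH) (use Suc.prems(1) C in simp_all)
    show "C_k n S (partial j (\<lambda>v. G v i))" for i using Suc.prems(2) by simp
  qed
  ultimately show ?case by (rule C_k_SucI[OF S])
qed

lemma partial_compose:
  fixes F :: "('i::finite \<Rightarrow> real) \<Rightarrow> real" and G :: "('j \<Rightarrow> real) \<Rightarrow> 'i \<Rightarrow> real"
  assumes "open T" "C_k (Suc n) T F" "\<And>i. C_k (Suc m) S (\<lambda>v. G v i)" "v \<in> S" "G v \<in> T"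
  shows "partial j (\<lambda>v. F (G v)) v = (\<Sum>i\<in>UNIV. partial i F (G v) * partial j (\<lambda>v. G v i) v)"
proof (rule partial_eqI)
  show "((\<lambda>t. F (G (v(j := t)))) has_real_derivative
      (\<Sum>i\<in>UNIV. partial i F (G v) * partial j (\<lambda>v. G v i) v)) (at (v j))"
  proof -
    have "((\<lambda>t. F (G (v(j := t)))) has_real_derivative
      (\<Sum>i\<in>UNIV. partial i F (G (v(j := v j))) * partial j (\<lambda>v. G v i) v)) (at (v j))"
    proof (rule chain_rule_partials[OF assms(1,2)])
      show "G (v(j := v j)) \<in> T" using assms(5) by simp
      show "((\<lambda>t. G (v(j := t)) i) has_real_derivative partial j (\<lambda>v. G v i) v) (at (v j))" for i
        by (rule has_partial[OF assms(3,4)])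
    qed
    then show ?thesis by simp
  qed
qed

section \<open>Symmetry of second partial derivatives\<close>

text \<open>Both mixed derivatives are limits of the second difference quotient of \<open>f\<close> along the diagonal.\<close>

lemma mixed_second_difference:
  fixes f :: "real \<Rightarrow> real \<Rightarrow> real"
  assumes h: "h > 0"
    and fx: "\<And>s t. s \<in> {x..x+h} \<Longrightarrow> t \<in> {y..y+h} \<Longrightarrow> ((\<lambda>s. f s t) has_real_derivative fx s t) (at s)"
    and fxy: "\<And>s t. s \<in> {x..x+h} \<Longrightarrow> t \<in> {y..y+h} \<Longrightarrow> ((\<lambda>t. fx s t) has_real_derivative fxy s t) (at t)"
  obtains s t where "s \<in> {x..x+h}" "t \<in> {y..y+h}"
    "f (x + h) (y + h) - f x (y + h) - f (x + h) y + f x y = h * h * fxy s t"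
proof -
  have "\<exists>s>x. s < x + h \<and> (f (x+h) (y+h) - f (x+h) y) - (f x (y+h) - f x y)
      = (x + h - x) * (fx s (y+h) - fx s y)"
    by (rule MVT2) (use h fx in \<open>auto intro!: DERIV_diff\<close>)
  then obtain s where s: "x < s" "s < x + h"
    "(f (x+h) (y+h) - f (x+h) y) - (f x (y+h) - f x y) = h * (fx s (y+h) - fx s y)" by auto
  have "\<exists>t>y. t < y + h \<and> fx s (y+h) - fx s y = (y + h - y) * fxy s t"
    by (rule MVT2) (use h s fxy in auto)
  then obtain t where "y < t" "t < y + h" "fx s (y+h) - fx s y = h * fxy s t" by auto
  with s that[of s t] show ?thesis by auto
qed

text \<open>Near \<open>v\<close> each mixed derivative is within \<open>e\<close> of its value at
  \<open>v\<close>, and the second difference over a small square is \<open>h * h\<close> times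
  either of them at suitable points of the square. So the values at \<open>v\<close> differ by less
  than \<open>2 * e\<close>.\<close>

lemma partial_commute:
  assumes S: "open S" and F: "C_k (Suc (Suc n)) S F" and v: "v \<in> S"
  shows "partial i (partial j F) v = partial j (partial i F) v"
proof (cases "i = j")
  case False
  define w where "w s t = v(i := s, j := t)" for s t
  let ?N = "nhds (v i) \<times>\<^sub>F nhds (v j)" and ?W = "\<lambda>(s, t). w s t"
  let ?Fij = "partial i (partial j F)" and ?Fji = "partial j (partial i F)"
  have w_i: "w s t = (w s' t)(i := s)" and w_j: "w s t = (w s t')(j := t)" for s t s' t'
    using False by (auto simp: w_def fun_eq_iff)
  have wc: "w s t i = s" "w s t j = t" for s t using False by (auto simp: w_def)
  have w0: "w (v i) (v j) = v" by (simp add: w_def)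
  have C1: "C_k (Suc n) S (partial k F)" for k using F by simp
  have di: "((\<lambda>s. G (w s t)) has_real_derivative partial i G (w s t)) (at s)"
    if "C_k (Suc m) S G" "w s t \<in> S" for G m s t
  proof -
    have "(\<lambda>r. G ((w s t)(i := r))) = (\<lambda>r. G (w r t))" using w_i by metis
    then show ?thesis using has_partial[OF that, of i] by (simp only: wc)
  qed
  have dj: "((\<lambda>t. G (w s t)) has_real_derivative partial j G (w s t)) (at t)"
    if "C_k (Suc m) S G" "w s t \<in> S" for G m s t
  proof -
    have "(\<lambda>r. G ((w s t)(j := r))) = (\<lambda>r. G (w s r))" using w_j by metis
    then show ?thesis using has_partial[OF that, of j] by (simp only: wc)
  qed
  have lim_w: "(?W \<longlongrightarrow> v) ?N"
  proof (rule tendsto_fun_componentwise)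
    fix k
    show "((\<lambda>x. (case x of (s, t) \<Rightarrow> w s t) k) \<longlongrightarrow> v k) ?N"
      using False filterlim_fst[of "nhds (v i)" "nhds (v j)"] filterlim_snd[of "nhds (v j)" "nhds (v i)"]
      by (cases "k = i"; cases "k = j") (simp_all add: w_def split_def)
  qed
  have "\<bar>?Fij v - ?Fji v\<bar> < 2 * e" if "e > 0" for e
  proof -
    have ev: "\<forall>\<^sub>F z in ?N. (?W z) \<in> S \<and>
       \<bar>?Fij (?W z) - ?Fij v\<bar> < e \<and>
       \<bar>?Fji (?W z) - ?Fji v\<bar> < e"
    proof (intro eventually_conj)
      show "\<forall>\<^sub>F z in ?N. (?W z) \<in> S"
        by (rule topological_tendstoD[OF lim_w S v])
      have *: "\<forall>\<^sub>F z in ?N. \<bar>G (?W z) - G v\<bar> < e"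
        if "continuous_on S G" for G
      proof -
        from tendstoD[OF filterlim_compose[OF continuous_on_open_tendsto_nhds[OF S that v] lim_w] \<open>e > 0\<close>] show ?thesis by (simp add: dist_real_def)
      qed
      show "\<forall>\<^sub>F z in ?N.
         \<bar>?Fij (?W z) - ?Fij v\<bar> < e"
        using C1 by (intro * C_k_continuous[of n]) simp
      show "\<forall>\<^sub>F z in ?N.
         \<bar>?Fji (?W z) - ?Fji v\<bar> < e"
        using C1 by (intro * C_k_continuous[of n]) simp
    qed
    then obtain P Q where PQ: "eventually P (nhds (v i))" "eventually Q (nhds (v j))"
      "\<And>s t. P s \<Longrightarrow> Q t \<Longrightarrow> w s t \<in> S \<and>
         \<bar>?Fij (w s t) - ?Fij v\<bar> < e \<and>
         \<bar>?Fji (w s t) - ?Fji v\<bar> < e"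
      unfolding eventually_prod_filter by auto
    obtain d1 d2 where d: "d1 > 0" "d2 > 0" "\<And>s. dist s (v i) < d1 \<Longrightarrow> P s" "\<And>t. dist t (v j) < d2 \<Longrightarrow> Q t"
      using PQ(1,2) unfolding eventually_nhds_metric by blast
    \<comment> \<open>Half the smaller radius keeps the closed square of side \<open>h\<close>
      inside the open neighbourhoods.\<close>
    define h where "h = min d1 d2 / 2"
    have h: "h > 0" using d by (simp add: h_def)
    have near: "w s t \<in> S" "\<bar>?Fij (w s t) - ?Fij v\<bar> < e"
      "\<bar>?Fji (w s t) - ?Fji v\<bar> < e"
      if "s \<in> {v i..v i + h}" "t \<in> {v j..v j + h}" for s t
    proof -
      have "P s" "Q t" using that h d by (auto simp: dist_real_def h_def)
      then show "w s t \<in> S" "\<bar>?Fij (w s t) - ?Fij v\<bar> < e"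
        "\<bar>?Fji (w s t) - ?Fji v\<bar> < e" using PQ(3) by auto
    qed
    let ?D = "F (w (v i + h) (v j + h)) - F (w (v i) (v j + h)) - F (w (v i + h) (v j)) + F (w (v i) (v j))"
    obtain s t where st: "s \<in> {v i..v i + h}" "t \<in> {v j..v j + h}" "?D = h * h * ?Fji (w s t)"
      by (rule mixed_second_difference[OF h, of "v i" "v j" "\<lambda>s t. F (w s t)"
            "\<lambda>s t. partial i F (w s t)" "\<lambda>s t. ?Fji (w s t)"])
        (blast intro: di dj F C1 near(1))+
    obtain s' t' where st': "t' \<in> {v i..v i + h}" "s' \<in> {v j..v j + h}"
      "F (w (v i + h) (v j + h)) - F (w (v i + h) (v j)) - F (w (v i) (v j + h)) + F (w (v i) (v j))
        = h * h * ?Fij (w t' s')"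
      by (rule mixed_second_difference[OF h, of "v j" "v i" "\<lambda>t s. F (w s t)"
            "\<lambda>t s. partial j F (w s t)" "\<lambda>t s. ?Fij (w s t)"])
        (blast intro: di dj F C1 near(1))+
    have "h * h * ?Fji (w s t) = h * h * ?Fij (w t' s')"
      using st(3) st'(3) by linarith
    then have "?Fji (w s t) = ?Fij (w t' s')" using h by simp
    then show ?thesis using near(3)[OF st(1,2)] near(2)[OF st'(1,2)] by linarith
  qed
  \<comment> \<open>If the two values differed, half their distance would be a positive
    \<open>e\<close>, and the distance would be smaller than itself.\<close>
  from this[of "\<bar>?Fij v - ?Fji v\<bar> / 2"] show ?thesis by fastforce
qed simp

section \<open>Calculus in charts\<close>

lemma open_vec_lambda_vimage: "open (S :: (real^'n::finite) set) \<Longrightarrow> open {v. vec_lambda v \<in> S}"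
proof -
  assume S: "open S"
  have "continuous_on UNIV (vec_lambda :: ('n \<Rightarrow> real) \<Rightarrow> real^'n)"
    by (intro continuous_on_vec_lambda continuous_on_product_coordinates)
  then have "open (vec_lambda -` S)" using S by (simp add: open_vimage)
  then show ?thesis by (simp add: vimage_def)
qed

lemma continuous_on_vec_nth: "continuous_on S (vec_nth :: real^'n::finite \<Rightarrow> _)"
  by (intro continuous_on_coordinatewise_then_product continuous_intros)

lemma open_vec_lambda_vimage_iff: "open {v. vec_lambda v \<in> S} \<longleftrightarrow> open (S :: (real^'n::finite) set)"
proof
  assume "open {v. vec_lambda v \<in> S}"
  then have "open (vec_nth -` {v. vec_lambda v \<in> S})" by (rule open_vimage) (rule continuous_on_vec_nth)
  then show "open S" by (simp add: vimage_def vec_nth_inverse)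
qed (rule open_vec_lambda_vimage)

lemma smooth_vec_iff:
  "smooth_vec S h \<longleftrightarrow> open S \<and> (\<forall>n. C_k n {v. vec_lambda v \<in> S} (\<lambda>v. h (vec_lambda v)))"
  by (simp add: smooth_vec_def smooth_fun_iff open_vec_lambda_vimage_iff)

text \<open>The coordinate derivative is taken of functions on the manifold rather than on a chart
  image, so that one function can be differentiated in several charts.\<close>

definition cpd :: "('a, 'n::finite) chart \<Rightarrow> 'n \<Rightarrow> ('a \<Rightarrow> real) \<Rightarrow> 'a \<Rightarrow> real" where
  "cpd c i h x = pd i (\<lambda>u. h (chart_inv c u)) (snd c x)"

definition smooth_in :: "('a::topological_space, 'n::finite) chart set \<Rightarrow> 'a set \<Rightarrow> ('a \<Rightarrow> real) \<Rightarrow> bool" where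
  "smooth_in A W f \<longleftrightarrow> open W \<and> (\<forall>c\<in>A. smooth_vec (snd c ` (W \<inter> dom_of c)) (\<lambda>u. f (chart_inv c u)))"

text \<open>Coordinates as families \<open>'n \<Rightarrow> real\<close> are what
  \<open>partial\<close> and \<open>C_k\<close> accept; \<open>vec_nth\<close> and
  \<open>vec_lambda\<close> mediate between them and \<open>real^'n\<close>.\<close>

abbreviation cvec :: "('a, 'n::finite) chart \<Rightarrow> 'a set \<Rightarrow> ('n \<Rightarrow> real) set" where
  "cvec c W \<equiv> {v. vec_lambda v \<in> snd c ` (W \<inter> dom_of c)}"

lemma cpd_partial: "cpd c i h x = partial i (\<lambda>v. h (chart_inv c (vec_lambda v))) (vec_nth (snd c x))"
  by (simp add: cpd_def pd_def)

lemma jac_cpd: "jac c d x i j = cpd c j (\<lambda>y. snd d y $ i) x"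
  by (simp add: jac_def cpd_def)

locale smooth_mfd =
  fixes A :: "('a::topological_space, 'n::finite) chart set"
  assumes atlas: "smooth_atlas A"
begin

abbreviation "smooth \<equiv> smooth_in A"

lemma chart_cover: obtains c where "c \<in> A" "x \<in> dom_of c"
  using atlas unfolding smooth_atlas_def by blast

lemma open_dom: "c \<in> A \<Longrightarrow> open (dom_of c)"
  using atlas unfolding smooth_atlas_def by blast

lemma open_img: "c \<in> A \<Longrightarrow> open (img_of c)"
  using atlas unfolding smooth_atlas_def by blast

lemma homeo: "c \<in> A \<Longrightarrow> homeomorphism (dom_of c) (img_of c) (snd c) (chart_inv c)"
  using atlas unfolding smooth_atlas_def by blast

lemma chart_inv_chart [simp]: "c \<in> A \<Longrightarrow> x \<in> dom_of c \<Longrightarrow> chart_inv c (snd c x) = x"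
  using homeo by (auto simp: homeomorphism_def)

lemma chart_chart_inv [simp]: "c \<in> A \<Longrightarrow> u \<in> img_of c \<Longrightarrow> snd c (chart_inv c u) = u"
  using homeo by (auto simp: homeomorphism_def)

lemma chart_inv_dom [simp]: "c \<in> A \<Longrightarrow> u \<in> img_of c \<Longrightarrow> chart_inv c u \<in> dom_of c"
  using homeo by (auto simp: homeomorphism_def)

lemma continuous_chart: "c \<in> A \<Longrightarrow> continuous_on (dom_of c) (snd c)"
  using homeo homeomorphism_def by blast

lemma continuous_chart_inv: "c \<in> A \<Longrightarrow> continuous_on (img_of c) (chart_inv c)"
  using homeo homeomorphism_def by blast

lemma open_chart_image:
  assumes "c \<in> A" "open W"
  shows "open (snd c ` (W \<inter> dom_of c))"
proof -
  have "openin (top_of_set (img_of c)) (snd c ` (W \<inter> dom_of c))"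
    by (rule homeomorphism_imp_open_map[OF homeo[OF assms(1)]])
      (use assms(2) in \<open>auto simp: openin_open\<close>)
  then show ?thesis using open_img[OF assms(1)] openin_open_trans by blast
qed

lemma cvec_iff: "c \<in> A \<Longrightarrow> v \<in> cvec c W \<longleftrightarrow> vec_lambda v \<in> img_of c \<and> chart_inv c (vec_lambda v) \<in> W"
  by (auto simp: image_iff)

lemma open_cvec: "c \<in> A \<Longrightarrow> open W \<Longrightarrow> open (cvec c W)"
  by (rule open_vec_lambda_vimage) (rule open_chart_image)

lemma in_cvec: "x \<in> W \<Longrightarrow> x \<in> dom_of c \<Longrightarrow> vec_nth (snd c x) \<in> cvec c W"
  by (simp add: vec_nth_inverse)

lemma cvecE:
  assumes "v \<in> cvec c W"
  obtains x where "x \<in> W" "x \<in> dom_of c" "v = vec_nth (snd c x)"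
proof -
  obtain x where "x \<in> W \<inter> dom_of c" "vec_lambda v = snd c x" using assms by blast
  then show ?thesis using that[of x] by (metis Int_iff vec_lambda_inverse UNIV_I)
qed

lemma smooth_iff:
  "smooth W f \<longleftrightarrow> open W \<and> (\<forall>c\<in>A. \<forall>n. C_k n (cvec c W) (\<lambda>v. f (chart_inv c (vec_lambda v))))"
  using open_chart_image by (auto simp: smooth_in_def smooth_vec_iff)

lemma smooth_open: "smooth W f \<Longrightarrow> open W"
  by (simp add: smooth_in_def)

lemma smooth_C_k:
  "smooth W f \<Longrightarrow> c \<in> A \<Longrightarrow> C_k n (cvec c W) (\<lambda>v. f (chart_inv c (vec_lambda v)))"
  by (simp add: smooth_iff)

lemma smooth_functions_iff: "f \<in> smooth_functions A \<longleftrightarrow> smooth UNIV f"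
  by (simp add: smooth_functions_def smooth_in_def)

lemma smooth_const: "open W \<Longrightarrow> smooth W (\<lambda>x. k)"
  by (simp add: smooth_iff C_k_const)

lemma smooth_add: "smooth W f \<Longrightarrow> smooth W g \<Longrightarrow> smooth W (\<lambda>x. f x + g x)"
  by (simp add: smooth_iff C_k_add[OF open_cvec])

lemma smooth_mult: "smooth W f \<Longrightarrow> smooth W g \<Longrightarrow> smooth W (\<lambda>x. f x * g x)"
  by (simp add: smooth_iff C_k_mult[OF open_cvec])

lemma smooth_minus: "smooth W f \<Longrightarrow> smooth W (\<lambda>x. - f x)"
  using smooth_mult[OF smooth_const[of W "-1"]] smooth_open by fastforce

lemma smooth_diff: "smooth W f \<Longrightarrow> smooth W g \<Longrightarrow> smooth W (\<lambda>x. f x - g x)"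
  using smooth_add[OF _ smooth_minus, of W f g] by simp

lemma smooth_sum:
  "open W \<Longrightarrow> (\<And>j. j \<in> J \<Longrightarrow> smooth W (f j)) \<Longrightarrow> smooth W (\<lambda>x. \<Sum>j\<in>J. f j x)"
  by (induction J rule: infinite_finite_induct) (auto intro: smooth_const smooth_add)

lemma smooth_inverse:
  assumes "smooth W f" "\<And>x. x \<in> W \<Longrightarrow> f x \<noteq> 0"
  shows "smooth W (\<lambda>x. inverse (f x))"
  unfolding smooth_iff
proof (intro conjI ballI allI)
  show "open W" using assms(1) by (rule smooth_open)
  fix c n assume c: "c \<in> A"
  show "C_k n (cvec c W) (\<lambda>v. inverse (f (chart_inv c (vec_lambda v))))"
    by (rule C_k_inverse[OF open_cvec[OF c \<open>open W\<close>] smooth_C_k[OF assms(1) c]])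
      (use assms(2) cvec_iff[OF c] in blast)
qed

lemma smooth_divide:
  assumes "smooth W f" "smooth W g" "\<And>x. x \<in> W \<Longrightarrow> g x \<noteq> 0"
  shows "smooth W (\<lambda>x. f x / g x)"
  using smooth_mult[OF assms(1) smooth_inverse[OF assms(2,3)]] by (simp add: divide_inverse)

lemma smooth_subset:
  assumes "smooth W f" "open V" "V \<subseteq> W"
  shows "smooth V f"
  unfolding smooth_iff using assms smooth_C_k[OF assms(1)] by (blast intro: C_k_subset)

lemma smooth_cong:
  assumes "smooth W f" "\<And>x. x \<in> W \<Longrightarrow> f x = g x"
  shows "smooth W g"
  unfolding smooth_iff
proof (intro conjI ballI allI)
  show "open W" using assms(1) by (rule smooth_open)
  fix c n assume c: "c \<in> A"
  show "C_k n (cvec c W) (\<lambda>v. g (chart_inv c (vec_lambda v)))"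
    by (rule C_k_cong[OF open_cvec[OF c \<open>open W\<close>] _ smooth_C_k[OF assms(1) c]])
      (use assms(2) cvec_iff[OF c] in blast)
qed

lemma smooth_UN:
  assumes "\<And>k. k \<in> K \<Longrightarrow> smooth (W k) f"
  shows "smooth (\<Union>k\<in>K. W k) f"
  unfolding smooth_iff
proof (intro conjI ballI allI)
  show "open (\<Union>k\<in>K. W k)" using assms smooth_open by blast
  fix c n assume c: "c \<in> A"
  have "C_k n (\<Union>k\<in>K. cvec c (W k)) (\<lambda>v. f (chart_inv c (vec_lambda v)))"
    by (rule C_k_UN) (use assms smooth_open open_cvec[OF c] smooth_C_k c in blast)+
  moreover have "(\<Union>k\<in>K. cvec c (W k)) = cvec c (\<Union>k\<in>K. W k)" by auto
  ultimately show "C_k n (cvec c (\<Union>k\<in>K. W k)) (\<lambda>v. f (chart_inv c (vec_lambda v)))" by simp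
qed

lemma smooth_localI:
  assumes "\<And>x. x \<in> W \<Longrightarrow> \<exists>V. x \<in> V \<and> V \<subseteq> W \<and> smooth V f"
  shows "smooth W f"
proof -
  obtain V where V: "\<And>x. x \<in> W \<Longrightarrow> x \<in> V x \<and> V x \<subseteq> W \<and> smooth (V x) f"
    using assms by metis
  then have "smooth (\<Union>x\<in>W. V x) f" by (intro smooth_UN) blast
  moreover have "(\<Union>x\<in>W. V x) = W" using V by blast
  ultimately show ?thesis by simp
qed

lemma smooth_chartwise:
  assumes "\<And>c. c \<in> A \<Longrightarrow> smooth (dom_of c) f"
  shows "smooth UNIV f"
  by (rule smooth_localI) (metis assms chart_cover subset_UNIV)

lemma transition_C_k:
  assumes "c \<in> A" "d \<in> A"
  shows "C_k n (cvec c (dom_of d)) (\<lambda>v. snd d (chart_inv c (vec_lambda v)) $ i)"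
proof -
  have "smooth_vec (snd c ` (dom_of c \<inter> dom_of d)) (\<lambda>u. snd d (chart_inv c u) $ i)"
    using atlas assms unfolding smooth_atlas_def by blast
  then show ?thesis by (simp add: smooth_vec_iff Int_commute)
qed

text \<open>In any other chart \<open>d\<close> the function is its expression in \<open>c\<close>
  composed with the transition map, which is smooth by the definition of an atlas.\<close>

lemma smooth_inI_chart:
  assumes c: "c \<in> A" and W: "open W" "W \<subseteq> dom_of c"
    and f: "\<And>n. C_k n (cvec c W) (\<lambda>v. f (chart_inv c (vec_lambda v)))"
  shows "smooth W f"
  unfolding smooth_iff
proof (intro conjI ballI allI)
  show "open W" by fact
  fix d n assume d: "d \<in> A"
  have sub: "cvec d W \<subseteq> cvec d (dom_of c)" using W(2) by blast
  have "C_k n (cvec d W) (\<lambda>v. f (chart_inv c (vec_lambda (vec_nth (snd c (chart_inv d (vec_lambda v)))))))"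
  proof (rule C_k_compose[OF open_cvec[OF d W(1)] open_cvec[OF c W(1)] f])
    show "C_k n (cvec d W) (\<lambda>v. snd c (chart_inv d (vec_lambda v)) $ i)" for i
      by (rule C_k_subset[OF transition_C_k[OF d c] sub])
    fix v assume "v \<in> cvec d W"
    then have "chart_inv d (vec_lambda v) \<in> W" using cvec_iff[OF d] by blast
    then show "vec_nth (snd c (chart_inv d (vec_lambda v))) \<in> cvec c W"
      using W(2) by (intro in_cvec) auto
  qed
  then show "C_k n (cvec d W) (\<lambda>v. f (chart_inv d (vec_lambda v)))"
  proof (rule C_k_cong[OF open_cvec[OF d W(1)], rotated])
    fix v assume "v \<in> cvec d W"
    then have "chart_inv d (vec_lambda v) \<in> dom_of c" using cvec_iff[OF d] W(2) by blast
    then show "f (chart_inv c (vec_lambda (vec_nth (snd c (chart_inv d (vec_lambda v))))))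
        = f (chart_inv d (vec_lambda v))"
      using c by (simp add: vec_nth_inverse)
  qed
qed

section \<open>Coordinate derivatives of functions on the manifold\<close>

lemma smooth_coord: "c \<in> A \<Longrightarrow> smooth (dom_of c) (\<lambda>x. snd c x $ i)"
  by (rule smooth_inI_chart) (use open_dom transition_C_k[of c c] in auto)

lemma smooth_cpd:
  assumes "smooth W f" "c \<in> A" "W \<subseteq> dom_of c"
  shows "smooth W (cpd c i f)"
proof (rule smooth_inI_chart[OF assms(2) smooth_open[OF assms(1)] assms(3)])
  fix n
  have W: "open W" using assms(1) by (rule smooth_open)
  have "C_k n (cvec c W) (partial i (\<lambda>v. f (chart_inv c (vec_lambda v))))"
    using smooth_C_k[OF assms(1,2), of "Suc n"] by simp
  then show "C_k n (cvec c W) (\<lambda>v. cpd c i f (chart_inv c (vec_lambda v)))"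
    by (rule C_k_cong[OF open_cvec[OF assms(2) W], rotated], elim cvecE)
      (use assms(2) in \<open>simp add: cpd_partial vec_nth_inverse\<close>)
qed

lemma cpd_cong:
  assumes "c \<in> A" "open W" "x \<in> W" "x \<in> dom_of c" "\<And>y. y \<in> W \<Longrightarrow> f y = g y"
  shows "cpd c i f x = cpd c i g x"
  unfolding cpd_partial
  by (rule partial_cong[OF open_cvec[OF assms(1,2)] in_cvec[OF assms(3,4)]])
    (use assms(1,5) cvec_iff in blast)

lemma has_cpd:
  assumes "smooth W f" "c \<in> A" "x \<in> W" "x \<in> dom_of c"
  shows "((\<lambda>t. f (chart_inv c (vec_lambda ((vec_nth (snd c x))(i := t))))) has_real_derivative cpd c i f x)
    (at (snd c x $ i))"
  unfolding cpd_partial by (rule has_partial[OF smooth_C_k[OF assms(1,2)] in_cvec[OF assms(3,4)]])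

lemma cpd_const [simp]: "cpd c i (\<lambda>x. k) x = 0"
  by (simp add: cpd_partial)

lemma cpd_add:
  assumes "smooth W f" "smooth W g" "c \<in> A" "x \<in> W" "x \<in> dom_of c"
  shows "cpd c i (\<lambda>y. f y + g y) x = cpd c i f x + cpd c i g x"
  unfolding cpd_partial[of _ _ "\<lambda>y. f y + g y"]
  by (rule partial_eqI) (intro DERIV_add has_cpd[OF assms(1,3-5)] has_cpd[OF assms(2,3-5)])

lemma cpd_mult:
  assumes "smooth W f" "smooth W g" "c \<in> A" "x \<in> W" "x \<in> dom_of c"
  shows "cpd c i (\<lambda>y. f y * g y) x = cpd c i f x * g x + cpd c i g x * f x"
  unfolding cpd_partial[of _ _ "\<lambda>y. f y * g y"]
  by (rule partial_eqI)
    (use DERIV_mult[OF has_cpd[OF assms(1,3-5), of i] has_cpd[OF assms(2,3-5), of i]] assms(3,5) in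
      \<open>simp add: vec_nth_inverse del: fun_upd_apply\<close>)

lemma cpd_minus:
  assumes "smooth W f" "c \<in> A" "x \<in> W" "x \<in> dom_of c"
  shows "cpd c i (\<lambda>y. - f y) x = - cpd c i f x"
  unfolding cpd_partial[of _ _ "\<lambda>y. - f y"]
  by (rule partial_eqI) (intro DERIV_minus has_cpd[OF assms])

lemma cpd_sum:
  assumes "\<And>j. j \<in> J \<Longrightarrow> smooth W (f j)" "c \<in> A" "x \<in> W" "x \<in> dom_of c" "open W"
  shows "cpd c i (\<lambda>y. \<Sum>j\<in>J. f j y) x = (\<Sum>j\<in>J. cpd c i (f j) x)"
  using assms(1)
proof (induction J rule: infinite_finite_induct)
  case (insert k J)
  then show ?case
    using cpd_add[OF insert.prems(1)[of k] smooth_sum[OF assms(5)] assms(2-4), of J f] by simp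
qed simp_all

lemma cpd_commute:
  assumes "smooth W f" "c \<in> A" "x \<in> W" "x \<in> dom_of c"
  shows "cpd c i (cpd c j f) x = cpd c j (cpd c i f) x"
proof -
  have W: "open W" using assms(1) by (rule smooth_open)
  let ?F = "\<lambda>v. f (chart_inv c (vec_lambda v))"
  have *: "cpd c k (cpd c l f) x = partial k (partial l ?F) (vec_nth (snd c x))" for k l
    unfolding cpd_partial[of _ _ "cpd c l f"]
    by (rule partial_cong[OF open_cvec[OF assms(2) W] in_cvec[OF assms(3,4)]], elim cvecE)
      (use assms(2) in \<open>simp add: cpd_partial vec_nth_inverse\<close>)
  show ?thesis
    unfolding *
    by (rule partial_commute[OF open_cvec[OF assms(2) W] smooth_C_k[OF assms(1,2)] in_cvec[OF assms(3,4)]])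
qed

text \<open>On the overlap, \<open>f\<close> read in \<open>c\<close> is \<open>f\<close> read in
  \<open>d\<close> after the transition map, whose partial derivatives are the entries of
  \<open>jac\<close>.\<close>

lemma cpd_chain:
  assumes "smooth W f" "c \<in> A" "d \<in> A" "x \<in> W" "x \<in> dom_of c" "x \<in> dom_of d"
  shows "cpd c j f x = (\<Sum>i\<in>UNIV. jac c d x i j * cpd d i f x)"
proof -
  let ?V = "W \<inter> dom_of d"
  let ?F = "\<lambda>v. f (chart_inv d (vec_lambda v))" and ?G = "\<lambda>v. vec_nth (snd d (chart_inv c (vec_lambda v)))"
  have W: "open ?V" using assms(1,3) smooth_open open_dom by blast
  have "cpd c j f x = partial j (\<lambda>v. ?F (?G v)) (vec_nth (snd c x))"
    unfolding cpd_partial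
  proof (rule partial_cong[OF open_cvec[OF assms(2) W]])
    show "vec_nth (snd c x) \<in> cvec c ?V" using assms by (intro in_cvec) auto
    show "f (chart_inv c (vec_lambda v)) = ?F (?G v)" if "v \<in> cvec c ?V" for v
      using that assms(2,3) by (elim cvecE) (simp add: vec_nth_inverse)
  qed
  also have "\<dots> = (\<Sum>i\<in>UNIV. partial i ?F (?G (vec_nth (snd c x))) * partial j (\<lambda>v. ?G v i) (vec_nth (snd c x)))"
  proof (rule partial_compose[OF open_cvec[OF assms(3) W]])
    show "C_k (Suc 0) (cvec d ?V) ?F"
      by (rule C_k_subset[OF smooth_C_k[OF assms(1,3)]]) blast
    show "C_k (Suc 0) (cvec c ?V) (\<lambda>v. ?G v i)" for i
      by (rule C_k_subset[OF transition_C_k[OF assms(2,3)]]) blast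
    show "vec_nth (snd c x) \<in> cvec c ?V" using assms by (intro in_cvec) auto
    show "?G (vec_nth (snd c x)) \<in> cvec d ?V"
      using assms by (simp add: vec_nth_inverse)
  qed
  also have "\<dots> = (\<Sum>i\<in>UNIV. jac c d x i j * cpd d i f x)"
    using assms by (simp add: jac_cpd cpd_partial vec_nth_inverse mult.commute)
  finally show ?thesis .
qed

lemma smooth_continuous:
  assumes "smooth W f"
  shows "continuous_on W f"
proof -
  have W: "open W" using assms by (rule smooth_open)
  have "continuous_on (W \<inter> dom_of c) f" if c: "c \<in> A" for c
  proof -
    have "continuous_on (cvec c W) (\<lambda>v. f (chart_inv c (vec_lambda v)))"
      using smooth_C_k[OF assms c] C_k_continuous by blast
    moreover have "continuous_on (W \<inter> dom_of c) (\<lambda>x. vec_nth (snd c x))"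
      by (rule continuous_on_compose2[OF continuous_on_vec_nth[of UNIV]])
        (auto intro: continuous_on_subset[OF continuous_chart[OF c]])
    ultimately have "continuous_on (W \<inter> dom_of c) (\<lambda>x. f (chart_inv c (vec_lambda (vec_nth (snd c x)))))"
      by (rule continuous_on_compose2) (auto simp: vec_nth_inverse)
    then show ?thesis
      by (rule continuous_on_cong[THEN iffD1, rotated 2]) (use c in \<open>simp_all add: vec_nth_inverse\<close>)
  qed
  then have "continuous_on (\<Union>c\<in>A. W \<inter> dom_of c) f"
    using W open_dom by (intro continuous_on_open_UN) auto
  moreover have "(\<Union>c\<in>A. W \<inter> dom_of c) = W" using chart_cover by blast
  ultimately show ?thesis by simp
qed

end

section \<open>Bump functions and partitions of unity\<close>

text \<open>The functions \<open>t^(-k) * exp (-1/t)\<close>, extended by 0 to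
  \<open>t \<le> 0\<close>, have derivatives that are linear combinations of members of the same
  family. Carrying all \<open>k\<close> along makes smoothness of the flat function
  \<open>k = 0\<close> an induction.\<close>

definition flat_exp :: "nat \<Rightarrow> real \<Rightarrow> real" where
  "flat_exp k t = (if t > 0 then inverse t ^ k * exp (- inverse t) else 0)"

text \<open>From the right, substituting \<open>s = 1 / t\<close> turns the function into a power
  over an exponential as \<open>s\<close> tends to infinity.\<close>

lemma flat_exp_tendsto_0: "(flat_exp k \<longlongrightarrow> 0) (at 0)"
proof -
  have "((\<lambda>t::real. inverse t ^ k / exp (inverse t)) \<longlongrightarrow> 0) (at_right 0)"
    by (rule filterlim_compose[OF tendsto_power_div_exp_0 filterlim_inverse_at_top_right])
  then have "(flat_exp k \<longlongrightarrow> 0) (at_right 0)"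
    by (rule Lim_transform_eventually)
      (auto simp: flat_exp_def eventually_at_filter exp_minus divide_inverse)
  moreover have "(flat_exp k \<longlongrightarrow> 0) (at_left 0)"
    by (rule Lim_transform_eventually[OF tendsto_const])
      (auto simp: flat_exp_def eventually_at_filter)
  ultimately show ?thesis by (simp add: filterlim_split_at)
qed

lemma flat_exp_has_derivative:
  "(flat_exp k has_real_derivative flat_exp (k + 2) t - k * flat_exp (k + 1) t) (at t)"
proof -
  consider "t > 0" | "t < 0" | "t = 0" by linarith
  then show ?thesis
  proof cases
    case 1
    have D: "((\<lambda>t. inverse t ^ k * exp (- inverse t)) has_real_derivative
        inverse t ^ (k + 2) * exp (- inverse t) - k * (inverse t ^ (k + 1) * exp (- inverse t))) (at t)"
    proof -
      have "((\<lambda>t. inverse t ^ k) has_real_derivative real k * (- (inverse t * 1 * inverse t) * inverse t ^ (k - Suc 0))) (at t)"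
        using 1 by (intro DERIV_power DERIV_inverse' DERIV_ident) simp
      also have "real k * (- (inverse t * 1 * inverse t) * inverse t ^ (k - Suc 0)) = - real k * inverse t ^ (k + 1)"
        by (cases k) (simp_all add: algebra_simps)
      finally have "((\<lambda>t. inverse t ^ k * exp (- inverse t)) has_real_derivative
          - real k * inverse t ^ (k + 1) * exp (- inverse t)
          + exp (- inverse t) * (- (- (inverse t * 1 * inverse t))) * inverse t ^ k) (at t)"
        using 1 by (intro DERIV_mult DERIV_fun_exp DERIV_minus DERIV_inverse' DERIV_ident) simp_all
      then show ?thesis by (simp add: algebra_simps)
    qed
    have ev: "\<forall>\<^sub>F s in nhds t. inverse s ^ k * exp (- inverse s) = flat_exp k s"
      using eventually_nhds_in_open[of "{0<..}" t] 1 by (auto simp: flat_exp_def elim: eventually_mono)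
    show ?thesis
      using DERIV_cong_ev[OF refl ev refl, THEN iffD1, OF D] 1
      by (simp only: flat_exp_def[of "k + 1"] flat_exp_def[of "k + 2"] if_True)
  next
    case 2
    have ev: "\<forall>\<^sub>F s in nhds t. 0 = flat_exp k s"
      using eventually_nhds_in_open[of "{..<0}" t] 2 by (auto simp: flat_exp_def elim!: eventually_mono)
    show ?thesis
      using DERIV_cong_ev[OF refl ev refl, THEN iffD1, OF DERIV_const] 2
      by (simp add: flat_exp_def[of "k + 1"] flat_exp_def[of "k + 2"] flat_exp_def[of "Suc k"] flat_exp_def[of "Suc (Suc k)"])
  next
    case 3
    \<comment> \<open>At 0 the difference quotient is the next member of the family: dividing by
      \<open>h\<close> raises the power of \<open>inverse h\<close> by one.\<close>
    have "(\<lambda>h. (flat_exp k (0 + h) - flat_exp k 0) / h) = flat_exp (k + 1)"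
      by (auto simp: fun_eq_iff flat_exp_def field_simps)
    then have "(flat_exp k has_real_derivative 0) (at 0)"
      using flat_exp_tendsto_0[of "k + 1"] by (simp add: DERIV_def)
    then show ?thesis using 3 by (simp add: flat_exp_def[of "Suc k"] flat_exp_def[of "Suc (Suc k)"])
  qed
qed

lemma continuous_on_flat_exp: "continuous_on UNIV (flat_exp k)"
  by (intro continuous_at_imp_continuous_on ballI DERIV_isCont[OF flat_exp_has_derivative])

lemma C_k_flat_exp:
  assumes "open S" "C_k n S H"
  shows "C_k n S (\<lambda>v. flat_exp k (H v))"
  using assms(2)
proof (induction n arbitrary: k)
  case 0
  then show ?case using continuous_on_flat_exp by (auto intro: continuous_on_compose2)
next
  case (Suc n)
  have "continuous_on S (\<lambda>v. flat_exp k (H v))"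
    using Suc.prems continuous_on_flat_exp by (auto intro: continuous_on_compose2)
  moreover have "((\<lambda>t. flat_exp k (H (v(i := t)))) has_real_derivative
      (flat_exp (k + 2) (H v) + (- real k) * flat_exp (k + 1) (H v)) * partial i H v) (at (v i))"
    if "v \<in> S" for v i
    using DERIV_chain2[OF flat_exp_has_derivative has_partial[OF Suc.prems that, of i], of k]
    by (simp del: fun_upd_apply)
  moreover have "C_k n S (\<lambda>v. (flat_exp (k + 2) (H v) + (- real k) * flat_exp (k + 1) (H v)) * partial i H v)" for i
    using Suc.prems
    by (intro C_k_mult C_k_add C_k_const Suc.IH assms(1)) (auto intro: C_k_Suc simp del: C_k.simps, simp)
  ultimately show ?case by (rule C_k_SucI[OF assms(1)])
qed

locale closed_mfd = smooth_mfd A for A :: "('a::t2_space, 'n::finite) chart set" +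
  assumes compact_UNIV: "compact (UNIV :: 'a set)"
begin

text \<open>\<open>dom_of c\<close> and the complement of \<open>K\<close> form an open cover, and
  on the latter the function is 0. The complement is open because compact sets of a Hausdorff space
  are closed.\<close>

lemma smooth_zero_ext:
  assumes "c \<in> A" "smooth (dom_of c) f" "compact K" "K \<subseteq> dom_of c" "\<And>x. x \<notin> K \<Longrightarrow> f x = 0"
  shows "smooth UNIV f"
proof (rule smooth_localI)
  fix x
  have "smooth (- K) f"
    by (rule smooth_cong[OF smooth_const[of _ 0]])
      (use assms(3,5) compact_imp_closed in auto)
  then show "\<exists>V. x \<in> V \<and> V \<subseteq> UNIV \<and> smooth V f"
    using assms(2,4) by (cases "x \<in> K") auto
qed

lemma bump:
  assumes c: "c \<in> A" and x0: "x0 \<in> dom_of c"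
  obtains \<rho> K where "smooth UNIV \<rho>" "compact K" "K \<subseteq> dom_of c" "\<And>x. x \<notin> K \<Longrightarrow> \<rho> x = 0"
    "\<And>x. 0 \<le> \<rho> x" "\<rho> x0 > 0"
proof -
  let ?a = "snd c x0"
  have "?a \<in> img_of c" using x0 by blast
  then obtain r where r: "r > 0" "cball ?a r \<subseteq> img_of c"
    using open_img[OF c] open_contains_cball by blast
  \<comment> \<open>The squared radius minus the squared Euclidean distance from the centre,
    positive exactly on the open ball. It is written with sums and products only, to match the
    closure rules for \<open>C_k\<close>.\<close>
  define H where "H v = r^2 + - 1 * (\<Sum>i\<in>UNIV. (v i + - (?a $ i)) * (v i + - (?a $ i)))" for v
  define \<rho> where "\<rho> x = (if x \<in> dom_of c then flat_exp 0 (H (vec_nth (snd c x))) else 0)" for x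
  define K where "K = chart_inv c ` cball ?a r"
  have K: "compact K" "K \<subseteq> dom_of c"
    unfolding K_def using r(2) c
    by (auto intro!: compact_continuous_image continuous_on_subset[OF continuous_chart_inv[OF c]])
  have Hdist: "H (vec_nth u) = r^2 - (dist ?a u)^2" for u
    by (simp add: H_def dist_norm norm_vec_def L2_set_def sum_nonneg power2_eq_square[symmetric] power2_commute)
  show thesis
  proof
    show z: "\<rho> x = 0" if "x \<notin> K" for x
    proof (cases "x \<in> dom_of c")
      case True
      then have "snd c x \<notin> cball ?a r" using that c unfolding K_def by (metis chart_inv_chart imageI)
      then have "r^2 < (dist ?a (snd c x))^2" using r(1) by (simp add: power_strict_mono)
      then show ?thesis by (simp add: \<rho>_def Hdist flat_exp_def)
    qed (simp add: \<rho>_def)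
    have "smooth (dom_of c) \<rho>"
    proof (rule smooth_inI_chart[OF c open_dom[OF c] order_refl])
      fix n
      have S: "open (cvec c (dom_of c))" using open_cvec[OF c open_dom[OF c]] .
      have "C_k n (cvec c (dom_of c)) (\<lambda>v. flat_exp 0 (H v))"
        unfolding H_def
        by (intro C_k_flat_exp C_k_add C_k_sum C_k_mult C_k_coord C_k_const S)
      then show "C_k n (cvec c (dom_of c)) (\<lambda>v. \<rho> (chart_inv c (vec_lambda v)))"
        by (rule C_k_cong[OF S, rotated], elim cvecE) (use c in \<open>simp add: \<rho>_def vec_nth_inverse\<close>)
    qed
    then show "smooth UNIV \<rho>" by (rule smooth_zero_ext[OF c _ K z])
    show "0 \<le> \<rho> x" for x by (simp add: \<rho>_def flat_exp_def)
    show "\<rho> x0 > 0" using x0 r(1) by (simp add: \<rho>_def Hdist flat_exp_def)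
  qed (use K in auto)
qed

text \<open>By compactness finitely many bump functions have a positive sum everywhere; dividing by
  this sum normalises them.\<close>

lemma partition_of_unity_exists:
  obtains C \<rho> where "partition_of_unity A C \<rho>"
proof -
  have "\<exists>c \<rho> K. c \<in> A \<and> smooth UNIV \<rho> \<and> compact K \<and> K \<subseteq> dom_of c \<and> (\<forall>y. y \<notin> K \<longrightarrow> \<rho> y = 0) \<and>
     (\<forall>y. 0 \<le> \<rho> y) \<and> \<rho> x > 0" for x
  proof -
    obtain c where "c \<in> A" "x \<in> dom_of c" by (rule chart_cover)
    then show ?thesis by (metis bump)
  qed
  then obtain c \<rho> K where *: "\<And>x. c x \<in> A" "\<And>x. smooth UNIV (\<rho> x)" "\<And>x. compact (K x)"
    "\<And>x. K x \<subseteq> dom_of (c x)" "\<And>x y. y \<notin> K x \<Longrightarrow> \<rho> x y = 0" "\<And>x y. 0 \<le> \<rho> x y" "\<And>x. \<rho> x x > 0"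
    by metis
  have "open {y. \<rho> x y > 0}" for x
    using smooth_continuous[OF *(2)[of x]] by (intro open_Collect_less) auto
  moreover have "UNIV \<subseteq> (\<Union>x\<in>UNIV. {y. \<rho> x y > 0})" using *(7) by blast
  ultimately obtain X where X: "finite X" "UNIV \<subseteq> (\<Union>x\<in>X. {y. \<rho> x y > 0})"
    using compactE_image[OF compact_UNIV, of UNIV "\<lambda>x. {y. \<rho> x y > 0}"] by auto
  define \<sigma> where "\<sigma> y = (\<Sum>x\<in>X. \<rho> x y)" for y
  have \<sigma>: "\<sigma> y > 0" for y
  proof -
    obtain x where "x \<in> X" "\<rho> x y > 0" using X(2) by blast
    then show ?thesis unfolding \<sigma>_def by (intro sum_pos2[OF X(1)]) (auto intro: *(6))
  qed
  have \<sigma>_smooth: "smooth UNIV \<sigma>"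
    unfolding \<sigma>_def by (rule smooth_sum) (auto intro: *(2))
  \<comment> \<open>A partition of unity assigns one function to each chart, so all bumps built in
    the same chart are added up.\<close>
  define \<tau> where "\<tau> d y = (\<Sum>x\<in>{x\<in>X. c x = d}. \<rho> x y) / \<sigma> y" for d y
  have "partition_of_unity A (c ` X) \<tau>"
    unfolding partition_of_unity_def
  proof (intro conjI ballI allI)
    show "finite (c ` X)" "c ` X \<subseteq> A" using X(1) *(1) by auto
    fix d
    show "\<tau> d \<in> smooth_functions A"
      unfolding smooth_functions_iff \<tau>_def
      using \<sigma> by (intro smooth_divide smooth_sum *(2) \<sigma>_smooth) (auto simp: less_imp_neq[symmetric])
    show "0 \<le> \<tau> d x" for x
      unfolding \<tau>_def using \<sigma>[of x] *(6) by (auto intro!: divide_nonneg_pos sum_nonneg)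
    have "{x. \<tau> d x \<noteq> 0} \<subseteq> (\<Union>x\<in>{x\<in>X. c x = d}. K x)"
    proof
      fix y assume "y \<in> {x. \<tau> d x \<noteq> 0}"
      then have "(\<Sum>x\<in>{x\<in>X. c x = d}. \<rho> x y) \<noteq> 0" by (auto simp: \<tau>_def)
      then obtain x where "x \<in> {x\<in>X. c x = d}" "\<rho> x y \<noteq> 0" by (meson sum.neutral)
      then show "y \<in> (\<Union>x\<in>{x\<in>X. c x = d}. K x)" using *(5) by blast
    qed
    moreover have "closed (\<Union>x\<in>{x\<in>X. c x = d}. K x)"
      using X(1) *(3) by (auto intro!: closed_UN compact_imp_closed)
    ultimately have "closure {x. \<tau> d x \<noteq> 0} \<subseteq> (\<Union>x\<in>{x\<in>X. c x = d}. K x)" by (rule closure_minimal)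
    then show "closure {x. \<tau> d x \<noteq> 0} \<subseteq> dom_of d" using *(4) by blast
  next
    fix y
    have "(\<Sum>d\<in>c ` X. \<tau> d y) = (\<Sum>d\<in>c ` X. \<Sum>x\<in>{x\<in>X. c x = d}. \<rho> x y) / \<sigma> y"
      by (simp add: \<tau>_def sum_divide_distrib)
    also have "\<dots> = 1" using \<sigma>[of y] sum.image_gen[OF X(1), of "\<lambda>x. \<rho> x y" c] by (simp add: \<sigma>_def)
    finally show "(\<Sum>d\<in>c ` X. \<tau> d y) = 1" .
  qed
  then show thesis by (rule that)
qed

end

section \<open>Integration against a density\<close>

lemma continuous_on_zero_ext:
  fixes f :: "'a::topological_space \<Rightarrow> real"
  assumes "open U" "closed K" "K \<subseteq> U" "continuous_on U f" "\<And>u. u \<in> U \<Longrightarrow> u \<notin> K \<Longrightarrow> f u = 0"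
  shows "continuous_on UNIV (\<lambda>u. if u \<in> U then f u else 0)"
proof -
  let ?E = "\<lambda>u. if u \<in> U then f u else 0"
  have "continuous_on U ?E" using assms(4) by (simp cong: continuous_on_cong)
  moreover have "continuous_on (- K) ?E"
    by (rule continuous_on_cong[THEN iffD1, OF refl _ continuous_on_const[of _ 0]]) (use assms(5) in auto)
  ultimately have "continuous_on (U \<union> - K) ?E"
    using assms(1,2) by (intro continuous_on_open_Un) auto
  moreover have "U \<union> - K = UNIV" using assms(3) by blast
  ultimately show ?thesis by simp
qed

lemma integrable_lborel_compact_support:
  fixes f :: "'a::euclidean_space \<Rightarrow> real"
  assumes "compact K" "continuous_on UNIV f" "\<And>u. u \<notin> K \<Longrightarrow> f u = 0"
  shows "integrable lborel f"
proof -
  have "integrable lborel (\<lambda>u. indicator K u *\<^sub>R f u)"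
    using assms by (intro borel_integrable_compact) (auto intro: continuous_on_subset)
  moreover have "(\<lambda>u. indicator K u *\<^sub>R f u) = f"
    using assms(3) by (auto simp: fun_eq_iff indicator_def)
  ultimately show ?thesis by simp
qed

text \<open>Bridge between the Lebesgue integral in the definition of \<open>integral_form\<close>
  and the gauge integral \<open>integral\<close>, for which differentiation under the integral and
  change of variables are stated.\<close>

lemma compact_support_integral:
  fixes f :: "'a::euclidean_space \<Rightarrow> real"
  assumes "open U" "compact K" "K \<subseteq> U" "continuous_on U f" "\<And>u. u \<in> U \<Longrightarrow> u \<notin> K \<Longrightarrow> f u = 0"
  shows "f absolutely_integrable_on U" "(LINT u:U|lborel. f u) = integral U f"
proof -
  let ?E = "\<lambda>u. if u \<in> U then f u else 0"
  have E: "continuous_on UNIV ?E"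
    by (rule continuous_on_zero_ext) (use assms compact_imp_closed in auto)
  have int: "integrable lborel ?E"
    by (rule integrable_lborel_compact_support[OF assms(2) E]) (use assms(5) in auto)
  have ind: "(\<lambda>u. indicator U u *\<^sub>R f u) = ?E" by (auto simp: fun_eq_iff)
  have "?E \<in> borel_measurable lborel"
    using borel_measurable_continuous_onI[OF E] by simp
  then show "f absolutely_integrable_on U"
    using int unfolding set_integrable_def ind by (simp add: integrable_completion)
  show "(LINT u:U|lborel. f u) = integral U f"
    using integral_lborel[OF int] unfolding set_lebesgue_integral_def ind by (simp add: integral_restrict_UNIV)
qed

lemma integral_translate_compact_support:
  fixes f :: "'a::euclidean_space \<Rightarrow> real"
  assumes "compact K" "continuous_on UNIV f" "\<And>u. u \<notin> K \<Longrightarrow> f u = 0"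
  shows "integral UNIV (\<lambda>u. f (u + c)) = integral UNIV f"
proof -
  have m: "f \<in> borel_measurable borel" using assms(2) by (rule borel_measurable_continuous_onI)
  have i: "integrable lborel f" by (rule integrable_lborel_compact_support) fact+
  have "integrable (distr lborel borel ((+) c)) f" using i by (simp add: lborel_distr_plus)
  then have i': "integrable lborel (\<lambda>u. f (u + c))"
    using m by (subst (asm) integrable_distr_eq) (auto simp: add.commute)
  have "(\<integral>u. f u \<partial>distr lborel borel ((+) c)) = (\<integral>u. f (c + u) \<partial>lborel)"
    using m by (intro integral_distr) auto
  then show ?thesis
    using i i' by (simp add: integral_lborel lborel_distr_plus add.commute)
qed

text \<open>The integral of a translate of \<open>E\<close> does not depend on the translation; differentiate under the integral sign.\<close>

lemma integral_directional_derivative_eq_0: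
  fixes E E' :: "'a::euclidean_space \<Rightarrow> real"
  assumes K: "compact K" and E: "continuous_on UNIV E" "\<And>u. u \<notin> K \<Longrightarrow> E u = 0"
    and E': "continuous_on UNIV E'" "\<And>u. u \<notin> K \<Longrightarrow> E' u = 0"
    and D: "\<And>u. ((\<lambda>t. E (u + t *\<^sub>R e)) has_real_derivative E' u) (at 0)"
  shows "integral UNIV E' = 0"
proof -
  \<comment> \<open>Compactness gives one box containing every translate of \<open>K\<close> by
    \<open>- t\<close> times \<open>e\<close> with \<open>t\<close> in \<open>{-1..1}\<close>.
    Integrals over this fixed box, to which the Leibniz rule applies, then agree with integrals over
    the whole space.\<close>
  have "compact ((\<lambda>(u, t). u - t *\<^sub>R e) ` (K \<times> {-1..1::real}))"
    by (intro compact_continuous_image compact_Times K compact_Icc)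
      (auto intro!: continuous_intros simp: split_def)
  then obtain a where a: "(\<lambda>(u, t). u - t *\<^sub>R e) ` (K \<times> {-1..1::real}) \<subseteq> cbox (- a) a"
    using bounded_subset_cbox_symmetric compact_imp_bounded by metis
  have out: "u + t *\<^sub>R e \<notin> K" if "u \<notin> cbox (- a) a" "t \<in> {-1..1}" for u t
  proof
    assume "u + t *\<^sub>R e \<in> K"
    then have "(u + t *\<^sub>R e, t) \<in> K \<times> {-1..1}" using that by simp
    then have "(u + t *\<^sub>R e) - t *\<^sub>R e \<in> cbox (- a) a" using a by blast
    then show False using that by simp
  qed
  have to_UNIV: "integral (cbox (- a) a) (\<lambda>u. f (u + t *\<^sub>R e)) = integral UNIV (\<lambda>u. f (u + t *\<^sub>R e))"
    if "\<And>u. u \<notin> K \<Longrightarrow> f u = 0" "t \<in> {-1..1}" for f :: "'a \<Rightarrow> real" and t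
  proof -
    have "(\<lambda>u. if u \<in> cbox (- a) a then f (u + t *\<^sub>R e) else 0) = (\<lambda>u. f (u + t *\<^sub>R e))"
      using out that by (auto simp: fun_eq_iff)
    then show ?thesis
      using integral_restrict_UNIV[of "cbox (- a) a" "\<lambda>u. f (u + t *\<^sub>R e)"] by simp
  qed
  have cont: "continuous_on (S \<times> T) (\<lambda>(t, u). E' (u + t *\<^sub>R e))" for S T
    unfolding split_def by (rule continuous_on_compose2[OF E'(1)]) (auto intro!: continuous_intros)
  have "((\<lambda>t. integral (cbox (- a) a) (\<lambda>u. E (u + t *\<^sub>R e))) has_real_derivative
      integral (cbox (- a) a) (\<lambda>u. E' (u + 0 *\<^sub>R e))) (at 0 within {-1..1})"
  proof (rule leibniz_rule_field_derivative)
    show "((\<lambda>t. E (u + t *\<^sub>R e)) has_real_derivative E' (u + t *\<^sub>R e)) (at t within {-1..1})" for t u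
    proof -
      have "((\<lambda>s. E (u + t *\<^sub>R e + s *\<^sub>R e)) has_real_derivative E' (u + t *\<^sub>R e)) (at 0)" by (rule D)
      then have "((\<lambda>s. E (u + (s + t) *\<^sub>R e)) has_real_derivative E' (u + t *\<^sub>R e)) (at 0)"
        by (simp add: algebra_simps)
      then have "((\<lambda>s. E (u + s *\<^sub>R e)) has_real_derivative E' (u + t *\<^sub>R e)) (at (0 + t))"
        using DERIV_shift[of "\<lambda>s. E (u + s *\<^sub>R e)" _ 0 t] by simp
      then show ?thesis by (simp add: has_field_derivative_at_within)
    qed
    show "(\<lambda>u. E (u + t *\<^sub>R e)) integrable_on cbox (- a) a" for t
      by (intro integrable_continuous continuous_on_compose2[OF E(1)] continuous_intros) auto
  qed (use cont in auto)
  moreover have const: "integral (cbox (- a) a) (\<lambda>u. E (u + t *\<^sub>R e)) = integral UNIV E" if "t \<in> {-1..1}" for t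
    using to_UNIV[of E, OF E(2) that] integral_translate_compact_support[OF K E] by simp
  ultimately have "((\<lambda>t. integral UNIV E) has_real_derivative
      integral (cbox (- a) a) (\<lambda>u. E' (u + 0 *\<^sub>R e))) (at 0 within {-1..1})"
    by (subst (asm) has_field_derivative_cong_eventually[where g = "\<lambda>t. integral UNIV E"])
      (use const[of 0] in \<open>auto simp: eventually_at_filter\<close>)
  then have "((\<lambda>t. integral UNIV E) has_real_derivative integral (cbox (- a) a) (\<lambda>u. E' (u + 0 *\<^sub>R e))) (at 0)"
    by (simp add: at_within_Icc_at)
  then have "integral (cbox (- a) a) (\<lambda>u. E' (u + 0 *\<^sub>R e)) = 0"
    using DERIV_unique[OF _ DERIV_const] by blast
  then show ?thesis using to_UNIV[of E' 0, OF E'(2)] by simp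
qed

lemma vec_lambda_upd: "vec_lambda ((vec_nth u)(i := t)) = u + (t - u $ i) *\<^sub>R axis i (1::real)"
  by (simp add: vec_eq_iff axis_def)

text \<open>Integration against Lebesgue measure in the coordinates of \<open>c\<close>; a density
  has to be part of \<open>\<phi>\<close>.\<close>

definition cint :: "('a, 'n::finite) chart \<Rightarrow> ('a \<Rightarrow> real) \<Rightarrow> real" where
  "cint c \<phi> = integral (img_of c) (\<lambda>u. \<phi> (chart_inv c u))"

context closed_mfd
begin

lemma chart_support:
  assumes "c \<in> A" "compact K" "K \<subseteq> dom_of c" "continuous_on (dom_of c) \<phi>"
    "\<And>x. x \<in> dom_of c \<Longrightarrow> x \<notin> K \<Longrightarrow> \<phi> x = 0"
  shows "compact (snd c ` K)" "snd c ` K \<subseteq> img_of c" "continuous_on (img_of c) (\<lambda>u. \<phi> (chart_inv c u))"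
    "\<And>u. u \<in> img_of c \<Longrightarrow> u \<notin> snd c ` K \<Longrightarrow> \<phi> (chart_inv c u) = 0"
proof -
  show "compact (snd c ` K)"
    using assms(1-3) continuous_chart by (blast intro: compact_continuous_image continuous_on_subset)
  show "snd c ` K \<subseteq> img_of c" using assms(3) by blast
  show "continuous_on (img_of c) (\<lambda>u. \<phi> (chart_inv c u))"
    by (rule continuous_on_compose2[OF assms(4) continuous_chart_inv[OF assms(1)]])
      (use assms(1) in auto)
  fix u assume "u \<in> img_of c" "u \<notin> snd c ` K"
  then show "\<phi> (chart_inv c u) = 0"
    by (intro assms(5)) (use assms(1) in \<open>auto simp: image_iff\<close>)
qed

lemma cint_lborel:
  assumes "c \<in> A" "compact K" "K \<subseteq> dom_of c" "continuous_on (dom_of c) \<phi>"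
    "\<And>x. x \<in> dom_of c \<Longrightarrow> x \<notin> K \<Longrightarrow> \<phi> x = 0"
  shows "(\<lambda>u. \<phi> (chart_inv c u)) absolutely_integrable_on img_of c"
    "(LINT u:img_of c|lborel. \<phi> (chart_inv c u)) = cint c \<phi>"
  using compact_support_integral[OF open_img[OF assms(1)] chart_support[OF assms]] by (simp_all add: cint_def)

lemma cint_sum:
  assumes "c \<in> A" "finite J" "compact K" "K \<subseteq> dom_of c"
    "\<And>j. j \<in> J \<Longrightarrow> continuous_on (dom_of c) (\<phi> j)"
    "\<And>j x. j \<in> J \<Longrightarrow> x \<in> dom_of c \<Longrightarrow> x \<notin> K \<Longrightarrow> \<phi> j x = 0"
  shows "cint c (\<lambda>x. \<Sum>j\<in>J. \<phi> j x) = (\<Sum>j\<in>J. cint c (\<phi> j))"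
  unfolding cint_def
proof (rule integral_sum[OF assms(2)])
  fix j assume "j \<in> J"
  then show "(\<lambda>u. \<phi> j (chart_inv c u)) integrable_on img_of c"
    using cint_lborel(1)[OF assms(1,3,4), of "\<phi> j"] assms(5,6) absolutely_integrable_on_def by blast
qed

lemma cint_cong: "(\<And>x. x \<in> dom_of c \<Longrightarrow> \<phi> x = \<psi> x) \<Longrightarrow> c \<in> A \<Longrightarrow> cint c \<phi> = cint c \<psi>"
  unfolding cint_def by (rule integral_cong) simp

text \<open>Extended by 0, the function and its derivative are continuous with compact support on
  the whole coordinate space, where a directional derivative integrates to 0. On the image of
  \<open>K\<close> the derivative comes from the chart; elsewhere the extension is 0 near the
  point.\<close>

lemma cint_cpd_eq_0:
  assumes c: "c \<in> A" and K: "compact K" "K \<subseteq> dom_of c" and \<phi>: "smooth (dom_of c) \<phi>"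
    "\<And>x. x \<in> dom_of c \<Longrightarrow> x \<notin> K \<Longrightarrow> \<phi> x = 0"
  shows "cint c (cpd c i \<phi>) = 0"
proof -
  let ?U = "img_of c"
  let ?E = "\<lambda>u. if u \<in> ?U then \<phi> (chart_inv c u) else 0"
  let ?E' = "\<lambda>u. if u \<in> ?U then cpd c i \<phi> (chart_inv c u) else 0"
  have c': "continuous_on (dom_of c) (cpd c i \<phi>)"
    using smooth_cpd[OF \<phi>(1) c order_refl] smooth_continuous by blast
  have z': "cpd c i \<phi> x = 0" if "x \<in> dom_of c" "x \<notin> K" for x
  proof -
    have "cpd c i \<phi> x = cpd c i (\<lambda>_. 0) x"
      by (rule cpd_cong[OF c, of "dom_of c - K"])
        (use that \<phi>(2) K(1) compact_imp_closed open_dom[OF c] in \<open>auto intro: open_Diff\<close>)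
    then show ?thesis by simp
  qed
  note S = chart_support[OF c K smooth_continuous[OF \<phi>(1)] \<phi>(2)]
  note S' = chart_support[OF c K c' z']
  have "integral UNIV ?E' = 0"
  proof (rule integral_directional_derivative_eq_0[OF S(1), where E = ?E and e = "axis i 1"])
    show "continuous_on UNIV ?E"
      by (rule continuous_on_zero_ext[OF open_img[OF c] compact_imp_closed[OF S(1)] S(2,3,4)])
    show "continuous_on UNIV ?E'"
      by (rule continuous_on_zero_ext[OF open_img[OF c] compact_imp_closed[OF S'(1)] S'(2,3,4)])
    show z: "?E u = 0" if "u \<notin> snd c ` K" for u using S(4) that by simp
    show "?E' u = 0" if "u \<notin> snd c ` K" for u using S'(4) that by simp
    fix u
    show "((\<lambda>t. ?E (u + t *\<^sub>R axis i 1)) has_real_derivative ?E' u) (at 0)"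
    proof (cases "u \<in> snd c ` K")
      case True
      then have u: "u \<in> ?U" using S(2) by blast
      have "((\<lambda>t. \<phi> (chart_inv c (u + (t - u $ i) *\<^sub>R axis i 1))) has_real_derivative ?E' u) (at (u $ i))"
        using has_cpd[OF \<phi>(1) c chart_inv_dom[OF c u] chart_inv_dom[OF c u], of i] c u
        by (simp add: vec_lambda_upd)
      then have "((\<lambda>t. \<phi> (chart_inv c (u + t *\<^sub>R axis i 1))) has_real_derivative ?E' u) (at 0)"
        using DERIV_shift[of "\<lambda>t. \<phi> (chart_inv c (u + (t - u $ i) *\<^sub>R axis i 1))" _ 0 "u $ i"] by simp
      moreover have "\<forall>\<^sub>F t in nhds 0. \<phi> (chart_inv c (u + t *\<^sub>R axis i 1)) = ?E (u + t *\<^sub>R axis i 1)"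
      proof -
        have "((\<lambda>t. u + t *\<^sub>R axis i 1) \<longlongrightarrow> u + 0 *\<^sub>R axis i 1) (nhds (0::real))"
          by (intro tendsto_intros filterlim_ident)
        then have "\<forall>\<^sub>F t in nhds (0::real). u + t *\<^sub>R axis i 1 \<in> ?U"
          using topological_tendstoD[OF _ open_img[OF c]] u by fastforce
        then show ?thesis by (rule eventually_mono) simp
      qed
      ultimately show ?thesis by (rule DERIV_cong_ev[OF refl _ refl, THEN iffD1, rotated])
    next
      case False
      have "((\<lambda>t. u + t *\<^sub>R axis i 1) \<longlongrightarrow> u + 0 *\<^sub>R axis i 1) (nhds (0::real))"
        by (intro tendsto_intros filterlim_ident)
      then have "\<forall>\<^sub>F t in nhds (0::real). u + t *\<^sub>R axis i 1 \<in> - snd c ` K"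
        using topological_tendstoD[of _ _ _ "- snd c ` K"] False compact_imp_closed[OF S(1)] by fastforce
      then have "\<forall>\<^sub>F t in nhds (0::real). 0 = ?E (u + t *\<^sub>R axis i 1)"
        by (rule eventually_mono) (use z in fastforce)
      moreover have "?E' u = 0" using S'(4) False by simp
      ultimately show ?thesis by (simp only: DERIV_cong_ev[OF refl _ refl, THEN iffD1, OF _ DERIV_const])
    qed
  qed
  then show ?thesis by (simp add: cint_def integral_restrict_UNIV)
qed

end

section \<open>Change of variables between charts\<close>

lemma has_derivative_vecI:
  fixes f :: "'x::real_normed_vector \<Rightarrow> real^'n::finite"
  assumes "\<And>i. ((\<lambda>x. f x $ i) has_derivative (\<lambda>h. f' h $ i)) (at s)"
  shows "(f has_derivative f') (at s)"
  by (subst has_derivative_componentwise_within) (use assms in \<open>auto simp: Basis_vec_def inner_axis\<close>)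

text \<open>\<open>has_absolute_integral_change_of_variables\<close> speaks of vector-valued
  functions; a real function is sent to \<open>real^1\<close> by \<open>v\<close> and recovered as
  the component of the result.\<close>

lemma integral_change_of_variables_real:
  fixes f :: "real^'m::{finite,wellorder} \<Rightarrow> real" and g :: "real^'m::_ \<Rightarrow> real^'m::_"
  assumes S: "S \<in> sets lebesgue"
    and der_g: "\<And>x. x \<in> S \<Longrightarrow> (g has_derivative g' x) (at x within S)"
    and inj: "inj_on g S" and f: "f absolutely_integrable_on (g ` S)"
  shows "integral S (\<lambda>x. \<bar>det (matrix (g' x))\<bar> * f (g x)) = integral (g ` S) f"
proof -
  define v :: "real \<Rightarrow> real^1" where "v r = r *\<^sub>R axis 1 1" for r
  have bl: "bounded_linear v" unfolding v_def by (rule bounded_linear_scaleR_left)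
  have F: "(v \<circ> f) absolutely_integrable_on (g ` S)"
    by (rule absolutely_integrable_linear[OF f bl])
  have *: "(\<lambda>x. \<bar>det (matrix (g' x))\<bar> *\<^sub>R (v \<circ> f) (g x)) absolutely_integrable_on S \<and>
     integral S (\<lambda>x. \<bar>det (matrix (g' x))\<bar> *\<^sub>R (v \<circ> f) (g x)) = integral (g ` S) (v \<circ> f)"
    using F by (subst has_absolute_integral_change_of_variables[OF S der_g inj]) auto
  have "integral (g ` S) (v \<circ> f) = v (integral (g ` S) f)"
    using f by (intro integral_linear[OF _ bl]) (simp add: absolutely_integrable_on_def)
  moreover have "integral S ((\<lambda>y. y $ 1) \<circ> (\<lambda>x. \<bar>det (matrix (g' x))\<bar> *\<^sub>R (v \<circ> f) (g x)))
      = integral S (\<lambda>x. \<bar>det (matrix (g' x))\<bar> *\<^sub>R (v \<circ> f) (g x)) $ 1"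
    using * by (intro integral_linear bounded_linear_vec_nth) (simp add: absolutely_integrable_on_def)
  ultimately show ?thesis using * by (simp add: o_def v_def axis_def)
qed

lemma integral_subset_eq:
  fixes f :: "'a::euclidean_space \<Rightarrow> real"
  assumes "\<And>u. u \<in> T \<Longrightarrow> u \<notin> S \<Longrightarrow> f u = 0" "S \<subseteq> T"
  shows "integral S f = integral T f"
proof -
  have "(\<lambda>u. if u \<in> S then f u else 0) = (\<lambda>u. if u \<in> T then f u else 0)"
    using assms by (auto simp: fun_eq_iff)
  then show ?thesis
    using integral_restrict_UNIV[of S f] integral_restrict_UNIV[of T f] by simp
qed

lemma (in smooth_mfd) transition_has_derivative:
  assumes "c \<in> A" "d \<in> A" "x \<in> dom_of c" "x \<in> dom_of d"
  shows "((\<lambda>u. snd d (chart_inv c u)) has_derivative (\<lambda>h. (\<chi> i j. jac c d x i j) *v h)) (at (snd c x))"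
proof (rule has_derivative_vecI)
  fix i
  let ?F = "\<lambda>v. snd d (chart_inv c (vec_lambda v)) $ i"
  have "((\<lambda>u. ?F (vec_nth u)) has_derivative (\<lambda>h. \<Sum>j\<in>UNIV. partial j ?F (vec_nth (snd c x)) * h $ j)) (at (snd c x))"
  proof (rule chain_rule_partials_has_derivative[OF open_cvec[OF assms(1) open_dom[OF assms(2)]]])
    show "C_k (Suc 0) (cvec c (dom_of d)) ?F" using transition_C_k[OF assms(1,2)] .
    show "vec_nth (snd c x) \<in> cvec c (dom_of d)" using assms(3,4) by (intro in_cvec)
  qed (intro bounded_linear_imp_has_derivative bounded_linear_vec_nth)
  then show "((\<lambda>u. snd d (chart_inv c u) $ i) has_derivative
      (\<lambda>h. ((\<chi> i j. jac c d x i j) *v h) $ i)) (at (snd c x))"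
    by (simp add: vec_nth_inverse matrix_vector_mult_def jac_cpd cpd_partial)
qed

section \<open>Integration of functions against a positive density\<close>

abbreviation supp :: "('a::topological_space \<Rightarrow> real) \<Rightarrow> 'a set" where
  "supp f \<equiv> closure {x. f x \<noteq> 0}"

text \<open>The weights change by the absolute value of the Jacobian determinant, the very factor of
  the change of variables formula. For a volume form, \<open>w\<close> will be the absolute value of
  its component.\<close>

locale density_mfd = closed_mfd A for A :: "('a::t2_space, 'n::{finite,wellorder}) chart set" +
  fixes w :: "('a, 'n) chart \<Rightarrow> 'a \<Rightarrow> real"
  assumes w_cont: "c \<in> A \<Longrightarrow> continuous_on (dom_of c) (w c)"
    and w_pos: "c \<in> A \<Longrightarrow> x \<in> dom_of c \<Longrightarrow> w c x > 0"
    and w_trans: "c \<in> A \<Longrightarrow> d \<in> A \<Longrightarrow> x \<in> dom_of c \<Longrightarrow> x \<in> dom_of d \<Longrightarrow>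
      w c x = \<bar>det (\<chi> i j. jac c d x i j)\<bar> * w d x"
begin

text \<open>Since \<open>\<psi>\<close> vanishes off \<open>K\<close>, both integrals may be taken
  over the images of the overlap, where \<open>w_trans\<close> supplies the Jacobian factor.\<close>

lemma cint_change_chart:
  assumes c: "c \<in> A" and d: "d \<in> A" and K: "compact K" "K \<subseteq> dom_of c" "K \<subseteq> dom_of d"
    and \<psi>: "continuous_on (dom_of d) \<psi>" "\<And>x. x \<notin> K \<Longrightarrow> \<psi> x = 0"
  shows "cint c (\<lambda>x. \<psi> x * w c x) = cint d (\<lambda>x. \<psi> x * w d x)"
proof -
  let ?W = "dom_of c \<inter> dom_of d"
  let ?S = "snd c ` ?W" and ?T = "snd d ` ?W"
  let ?g = "\<lambda>u. snd d (chart_inv c u)"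
  let ?f = "\<lambda>v. \<psi> (chart_inv d v) * w d (chart_inv d v)"
  let ?J = "\<lambda>u. \<chi> i j. jac c d (chart_inv c u) i j"
  have gS: "?g ` ?S = ?T" using c by (force simp: image_iff)
  have "?f absolutely_integrable_on img_of d"
    by (rule cint_lborel(1)[OF d K(1,3)]) (use \<psi> w_cont[OF d] in \<open>auto intro: continuous_on_mult\<close>)
  then have f_int: "?f absolutely_integrable_on ?T"
    by (rule set_integrable_subset) (use open_chart_image[OF d open_dom[OF c]] in \<open>auto simp: lmeasurable_iff_integrable_on\<close>)
  have "integral ?S (\<lambda>u. \<bar>det (matrix ((*v) (?J u)))\<bar> * ?f (?g u)) = integral (?g ` ?S) ?f"
  proof (rule integral_change_of_variables_real)
    show "?S \<in> sets lebesgue"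
      using open_chart_image[OF c open_dom[OF d]] by (simp add: Int_commute)
    show "inj_on ?g ?S"
      using c d by (auto simp: inj_on_def) (metis chart_inv_chart)
    show "(?g has_derivative (*v) (?J u)) (at u within ?S)" if u: "u \<in> ?S" for u
    proof -
      obtain x where x: "x \<in> dom_of c" "x \<in> dom_of d" "u = snd c x" using u by blast
      show ?thesis
        using transition_has_derivative[OF c d x(1,2)] c x by (auto intro: has_derivative_at_withinI)
    qed
    show "?f absolutely_integrable_on ?g ` ?S" unfolding gS by (rule f_int)
  qed
  also have "integral ?S (\<lambda>u. \<bar>det (matrix ((*v) (?J u)))\<bar> * ?f (?g u))
      = integral ?S (\<lambda>u. \<psi> (chart_inv c u) * w c (chart_inv c u))"
  proof (rule integral_cong)
    fix u assume "u \<in> ?S"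
    then obtain x where x: "x \<in> dom_of c" "x \<in> dom_of d" "u = snd c x" by blast
    have "matrix ((*v) (?J u)) = ?J u" by (rule matrix_of_matrix_vector_mul)
    then show "\<bar>det (matrix ((*v) (?J u)))\<bar> * ?f (?g u) = \<psi> (chart_inv c u) * w c (chart_inv c u)"
      using x c d w_trans[OF c d x(1,2)] by simp
  qed
  also have "integral ?S (\<lambda>u. \<psi> (chart_inv c u) * w c (chart_inv c u)) = cint c (\<lambda>x. \<psi> x * w c x)"
    unfolding cint_def
  proof (rule integral_subset_eq)
    fix u assume u: "u \<in> img_of c" "u \<notin> ?S"
    then have "chart_inv c u \<notin> K" using c K(3) by (auto simp: image_iff)
    then show "\<psi> (chart_inv c u) * w c (chart_inv c u) = 0" using \<psi>(2) by simp
  qed blast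
  also note gS
  also have "integral ?T ?f = cint d (\<lambda>x. \<psi> x * w d x)"
    unfolding cint_def
  proof (rule integral_subset_eq)
    fix u assume u: "u \<in> img_of d" "u \<notin> ?T"
    then have "chart_inv d u \<notin> K" using d K(2) by (auto simp: image_iff)
    then show "\<psi> (chart_inv d u) * w d (chart_inv d u) = 0" using \<psi>(2) by simp
  qed blast
  finally show ?thesis .
qed

lemma partition_support:
  assumes "partition_of_unity A C \<rho>" "c \<in> C"
  shows "c \<in> A" "smooth UNIV (\<rho> c)" "continuous_on S (\<rho> c)" "compact (supp (\<rho> c))"
    "supp (\<rho> c) \<subseteq> dom_of c" "\<And>x. x \<notin> supp (\<rho> c) \<Longrightarrow> \<rho> c x = 0"
proof -
  show "c \<in> A" "supp (\<rho> c) \<subseteq> dom_of c" and s: "smooth UNIV (\<rho> c)"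
    using assms by (auto simp: partition_of_unity_def smooth_functions_iff)
  show "continuous_on S (\<rho> c)" using smooth_continuous[OF s] continuous_on_subset by blast
  show "compact (supp (\<rho> c))"
    using compact_Int_closed[OF compact_UNIV closed_closure] by simp
  show "\<rho> c x = 0" if "x \<notin> supp (\<rho> c)" for x
    using that closure_subset[of "{x. \<rho> c x \<noteq> 0}"] by blast
qed

text \<open>Each piece \<open>\<rho> d * h\<close> is supported in both \<open>dom_of c\<close> and
  \<open>dom_of d\<close>, so it can be integrated in the chart \<open>d\<close> instead of
  \<open>c\<close>.\<close>

lemma cint_split:
  assumes C: "partition_of_unity A C \<rho>" and c: "c \<in> A" and K: "compact K" "K \<subseteq> dom_of c"
    and h: "continuous_on UNIV h" "\<And>x. x \<notin> K \<Longrightarrow> h x = 0"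
  shows "cint c (\<lambda>x. h x * w c x) = (\<Sum>d\<in>C. cint d (\<lambda>x. \<rho> d x * (h x * w d x)))"
proof -
  have fin: "finite C" and one: "\<And>x. (\<Sum>d\<in>C. \<rho> d x) = 1" using C by (auto simp: partition_of_unity_def)
  have h': "continuous_on S h" for S using h(1) continuous_on_subset by blast
  note P = partition_support[OF C]
  have "cint c (\<lambda>x. h x * w c x) = cint c (\<lambda>x. \<Sum>d\<in>C. \<rho> d x * h x * w c x)"
    by (simp only: sum_distrib_right[symmetric] one mult_1_left)
  also have "\<dots> = (\<Sum>d\<in>C. cint c (\<lambda>x. \<rho> d x * h x * w c x))"
  proof (rule cint_sum[OF c fin K])
    show "continuous_on (dom_of c) (\<lambda>x. \<rho> d x * h x * w c x)" if "d \<in> C" for d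
      by (intro continuous_on_mult P(3)[OF that] h' w_cont[OF c])
    show "\<rho> d x * h x * w c x = 0" if "x \<notin> K" for d x using h(2)[OF that] by simp
  qed
  also have "\<dots> = (\<Sum>d\<in>C. cint d (\<lambda>x. \<rho> d x * h x * w d x))"
  proof (rule sum.cong[OF refl])
    fix d assume d: "d \<in> C"
    show "cint c (\<lambda>x. \<rho> d x * h x * w c x) = cint d (\<lambda>x. \<rho> d x * h x * w d x)"
    proof (rule cint_change_chart[OF c P(1)[OF d], of "K \<inter> supp (\<rho> d)"])
      show "compact (K \<inter> supp (\<rho> d))" using K(1) by (rule compact_Int_closed) simp
      show "continuous_on (dom_of d) (\<lambda>x. \<rho> d x * h x)" by (intro continuous_on_mult P(3)[OF d] h')
      show "K \<inter> supp (\<rho> d) \<subseteq> dom_of c" using K(2) by blast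
      show "K \<inter> supp (\<rho> d) \<subseteq> dom_of d" using P(5)[OF d] by blast
      show "\<rho> d x * h x = 0" if "x \<notin> K \<inter> supp (\<rho> d)" for x
        using that P(6)[OF d, of x] h(2)[of x] by (metis IntI mult_zero_left mult_zero_right)
    qed
  qed
  finally show ?thesis by (simp add: mult.assoc)
qed

text \<open>Both sides expand to the double sum over \<open>C\<close> and \<open>D\<close> of the
  integrals of \<open>\<sigma> d * \<rho> c * h\<close>, computed in the chart
  \<open>d\<close>.\<close>

lemma partition_sum_unique:
  assumes C: "partition_of_unity A C \<rho>" and D: "partition_of_unity A D \<sigma>" and h: "continuous_on UNIV h"
  shows "(\<Sum>c\<in>C. cint c (\<lambda>x. \<rho> c x * (h x * w c x))) = (\<Sum>d\<in>D. cint d (\<lambda>x. \<sigma> d x * (h x * w d x)))"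
proof -
  have *: "cint c (\<lambda>x. \<rho> c x * (h x * w c x)) = (\<Sum>d\<in>D. cint d (\<lambda>x. \<sigma> d x * (\<rho> c x * h x * w d x)))" if c: "c \<in> C" for c
  proof -
    have "cint c (\<lambda>x. \<rho> c x * h x * w c x) = (\<Sum>d\<in>D. cint d (\<lambda>x. \<sigma> d x * (\<rho> c x * h x * w d x)))"
    proof (rule cint_split[OF D partition_support(1,4,5)[OF C c]])
      show "continuous_on UNIV (\<lambda>x. \<rho> c x * h x)" by (intro continuous_on_mult partition_support(3)[OF C c] h)
      show "\<rho> c x * h x = 0" if "x \<notin> supp (\<rho> c)" for x
        using partition_support(6)[OF C c that] by simp
    qed
    then show ?thesis by (simp only: mult.assoc)
  qed
  have "cint d (\<lambda>x. \<sigma> d x * (h x * w d x)) = (\<Sum>c\<in>C. cint d (\<lambda>x. \<sigma> d x * (\<rho> c x * h x * w d x)))" if d: "d \<in> D" for d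
  proof -
    have fin: "finite C" and one: "\<And>x. (\<Sum>c\<in>C. \<rho> c x) = 1" using C by (auto simp: partition_of_unity_def)
    have "(\<lambda>x. \<sigma> d x * (h x * w d x)) = (\<lambda>x. \<Sum>c\<in>C. \<sigma> d x * (\<rho> c x * h x * w d x))"
      by (simp add: sum_distrib_left[symmetric] sum_distrib_right[symmetric] one)
    moreover have "cint d (\<lambda>x. \<Sum>c\<in>C. \<sigma> d x * (\<rho> c x * h x * w d x)) = (\<Sum>c\<in>C. cint d (\<lambda>x. \<sigma> d x * (\<rho> c x * h x * w d x)))"
    proof (rule cint_sum[OF partition_support(1)[OF D d] fin partition_support(4,5)[OF D d]])
      show "continuous_on (dom_of d) (\<lambda>x. \<sigma> d x * (\<rho> c x * h x * w d x))" if "c \<in> C" for c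
        by (intro continuous_on_mult partition_support(3)[OF C that] partition_support(3)[OF D d]
            w_cont[OF partition_support(1)[OF D d]] continuous_on_subset[OF h]) simp
      show "\<sigma> d x * (\<rho> c x * h x * w d x) = 0" if "x \<notin> supp (\<sigma> d)" for c x
        using partition_support(6)[OF D d that] by simp
    qed
    ultimately show ?thesis by simp
  qed
  then show ?thesis using * by (simp add: sum.swap[of _ C D])
qed

text \<open>The description has the shape of \<open>integral_form\<close>, so that the two agree as
  soon as their summands do.\<close>

definition mint :: "('a \<Rightarrow> real) \<Rightarrow> real" where
  "mint h = (THE s. \<forall>C \<rho>. partition_of_unity A C \<rho> \<longrightarrow> s = (\<Sum>c\<in>C. cint c (\<lambda>x. \<rho> c x * (h x * w c x))))"

lemma mint_eq:
  assumes "partition_of_unity A C \<rho>" "continuous_on UNIV h"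
  shows "mint h = (\<Sum>c\<in>C. cint c (\<lambda>x. \<rho> c x * (h x * w c x)))"
  unfolding mint_def by (rule the_equality) (use partition_sum_unique assms in blast)+

lemma mint_chart:
  assumes "c \<in> A" "compact K" "K \<subseteq> dom_of c" "continuous_on UNIV h" "\<And>x. x \<notin> K \<Longrightarrow> h x = 0"
  shows "mint h = cint c (\<lambda>x. h x * w c x)"
proof -
  obtain C \<rho> where C: "partition_of_unity A C \<rho>" by (rule partition_of_unity_exists)
  show ?thesis using mint_eq[OF C assms(4)] cint_split[OF C assms] by simp
qed

lemma mint_sum:
  assumes "finite J" "\<And>j. j \<in> J \<Longrightarrow> continuous_on UNIV (h j)"
  shows "mint (\<lambda>x. \<Sum>j\<in>J. h j x) = (\<Sum>j\<in>J. mint (h j))"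
proof -
  obtain C \<rho> where C: "partition_of_unity A C \<rho>" by (rule partition_of_unity_exists)
  have "cint c (\<lambda>x. \<rho> c x * ((\<Sum>j\<in>J. h j x) * w c x)) = (\<Sum>j\<in>J. cint c (\<lambda>x. \<rho> c x * (h j x * w c x)))"
    if c: "c \<in> C" for c
  proof -
    have "cint c (\<lambda>x. \<rho> c x * ((\<Sum>j\<in>J. h j x) * w c x)) = cint c (\<lambda>x. \<Sum>j\<in>J. \<rho> c x * (h j x * w c x))"
      by (simp add: sum_distrib_left sum_distrib_right)
    also have "\<dots> = (\<Sum>j\<in>J. cint c (\<lambda>x. \<rho> c x * (h j x * w c x)))"
    proof (rule cint_sum[OF partition_support(1)[OF C c] assms(1) partition_support(4,5)[OF C c]])
      show "continuous_on (dom_of c) (\<lambda>x. \<rho> c x * (h j x * w c x))" if "j \<in> J" for j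
        by (intro continuous_on_mult partition_support(3)[OF C c]
            w_cont[OF partition_support(1)[OF C c]] continuous_on_subset[OF assms(2)[OF that]]) simp
      show "\<rho> c x * (h j x * w c x) = 0" if "x \<notin> supp (\<rho> c)" for j x
        using partition_support(6)[OF C c that] by simp
    qed
    finally show ?thesis .
  qed
  then have "mint (\<lambda>x. \<Sum>j\<in>J. h j x) = (\<Sum>c\<in>C. \<Sum>j\<in>J. cint c (\<lambda>x. \<rho> c x * (h j x * w c x)))"
    using mint_eq[OF C, of "\<lambda>x. \<Sum>j\<in>J. h j x"] assms(2) by (simp add: continuous_on_sum)
  also have "\<dots> = (\<Sum>j\<in>J. mint (h j))"
    using assms(2) by (subst sum.swap) (simp add: mint_eq[OF C])
  finally show ?thesis .
qed

lemma mint_add: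
  assumes "continuous_on UNIV f" "continuous_on UNIV g"
  shows "mint (\<lambda>x. f x + g x) = mint f + mint g"
  using mint_sum[of "UNIV :: bool set" "\<lambda>b. if b then f else g"] assms by (simp add: UNIV_bool add.commute)

text \<open>In the chart, \<open>h * w c\<close> extended by 0 is continuous and nonnegative with
  integral 0, hence identically 0, and the positive factor \<open>w c\<close> cancels. Nondegeneracy
  of the pairing rests on this.\<close>

lemma mint_eq_0_nonneg:
  assumes c: "c \<in> A" and K: "compact K" "K \<subseteq> dom_of c"
    and h: "continuous_on UNIV h" "\<And>x. x \<notin> K \<Longrightarrow> h x = 0" "\<And>x. 0 \<le> h x" and "mint h = 0"
  shows "h x = 0"
proof (cases "x \<in> K")
  case True
  let ?E = "\<lambda>u. if u \<in> img_of c then h (chart_inv c u) * w c (chart_inv c u) else 0"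
  have cont: "continuous_on (dom_of c) (\<lambda>x. h x * w c x)"
    using h(1) w_cont[OF c] by (auto intro!: continuous_on_mult intro: continuous_on_subset)
  have z: "h x * w c x = 0" if "x \<notin> K" for x using h(2) that by simp
  note S = chart_support[OF c K cont z]
  have E: "continuous_on UNIV ?E"
    by (rule continuous_on_zero_ext[OF open_img[OF c] compact_imp_closed[OF S(1)] S(2,3,4)])
  have "cint c (\<lambda>x. h x * w c x) = 0" using mint_chart[OF c K h(1,2)] assms(7) by simp
  moreover have "integrable lborel ?E"
    by (rule integrable_lborel_compact_support[OF S(1) E]) (use S(4) in auto)
  ultimately have "(?E has_integral 0) UNIV"
    using has_integral_integral_lborel[of ?E] integral_lborel[of ?E] by (simp add: cint_def integral_restrict_UNIV)
  then have int0: "integral UNIV ?E = 0" "?E integrable_on UNIV" by (auto simp: has_integral_iff)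
  have nonneg: "?E u \<ge> 0" for u
    using h(3) w_pos[OF c] c by (auto intro!: mult_nonneg_nonneg intro: less_imp_le)
  let ?u = "snd c x"
  \<comment> \<open>The unit ball puts the point into the open box, which is therefore
    nondegenerate.\<close>
  obtain a where a: "cball ?u 1 \<subseteq> cbox (- a) a" using bounded_subset_cbox_symmetric bounded_cball by metis
  have uin: "?u \<in> box (- a) a"
  proof -
    have "ball ?u 1 \<subseteq> interior (cbox (- a) a)" using a by (intro interior_maximal) auto
    then show ?thesis by (auto simp: interior_cbox)
  qed
  have "integral (cbox (- a) a) ?E \<le> integral UNIV ?E"
    by (rule integral_subset_le) (use int0(2) nonneg integrable_on_subcbox[OF int0(2)] in auto)
  moreover have "integral (cbox (- a) a) ?E \<ge> 0" using nonneg by (intro integral_nonneg integrable_on_subcbox[OF int0(2)]) auto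
  ultimately have "(?E has_integral 0) (cbox (- a) a)"
    using int0(1) integrable_on_subcbox[OF int0(2), of "- a" a] by (simp add: has_integral_iff)
  then have "?E ?u = 0"
    by (intro has_integral_0_cbox_imp_0[of "- a" a ?E])
      (use nonneg uin E box_subset_cbox[of "- a" a] in \<open>auto intro: continuous_on_subset\<close>)
  moreover have "x \<in> dom_of c" using True K(2) by blast
  ultimately show ?thesis using w_pos[OF c, of x] c by auto
qed (rule h(2))

end

section \<open>Tensor fields on surfaces\<close>

text \<open>The two coordinate indices, in the order used for integration.\<close>

definition ia :: 2 where "ia = top_index ! 0"
definition ib :: 2 where "ib = top_index ! 1"

lemma top_index_2: "(top_index :: 2 list) = [ia, ib]" "ia \<noteq> ib" and UNIV_ab: "(UNIV :: 2 set) = {ia, ib}"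
proof -
  have "\<exists>I :: 2 list. distinct I \<and> set I = UNIV"
    by (rule exI[of _ "[1, 2]"]) (auto simp: UNIV_2)
  then have *: "distinct (top_index :: 2 list)" "set (top_index :: 2 list) = UNIV"
    unfolding top_index_def by (metis (mono_tags, lifting) someI_ex)+
  then have "length (top_index :: 2 list) = 2" using distinct_card by fastforce
  then show t: "(top_index :: 2 list) = [ia, ib]"
    by (auto simp: ia_def ib_def intro!: nth_equalityI simp: less_Suc_eq numeral_2_eq_2)
  show "ia \<noteq> ib" "(UNIV :: 2 set) = {ia, ib}" using * by (auto simp: t)
qed

lemma ib_neq_ia [simp]: "ib \<noteq> ia" "ia \<noteq> ib"
  using top_index_2(2) by auto

lemma ab_cases: "i = ia \<or> i = ib" for i :: 2
  using UNIV_ab by blast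

lemma sum_ab: "(\<Sum>i\<in>(UNIV :: 2 set). f i) = f ia + f ib"
  by (simp add: UNIV_ab)

text \<open>\<open>det_2\<close> refers to the indices 1 and 2. If \<open>ia\<close> and
  \<open>ib\<close> name them in the opposite order, rows and columns are permuted simultaneously
  and the determinant is unchanged.\<close>

lemma det_ab: "det (\<chi> i j. M i j :: real^2^2) = M ia ia * M ib ib - M ia ib * M ib ia"
  using ab_cases[of 1] ab_cases[of 2] ib_neq_ia by (auto simp: det_2)

lemma sum_length_0: "(\<Sum>I | length I = 0. f I) = f []"
  by simp

lemma sum_length_Suc:
  "(\<Sum>I :: 'n::finite list | length I = Suc n. f I) = (\<Sum>i\<in>UNIV. \<Sum>I | length I = n. f (i # I))"
proof -
  have img: "{I :: 'n list. length I = Suc n} = (\<lambda>(i, I). i # I) ` (UNIV \<times> {I. length I = n})"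
    by (auto simp: length_Suc_conv image_iff)
  have inj: "inj_on (\<lambda>(i :: 'n, I). i # I) (UNIV \<times> {I. length I = n})" by (auto simp: inj_on_def)
  have "(\<Sum>I :: 'n list | length I = Suc n. f I)
      = (\<Sum>(i, I)\<in>UNIV \<times> {I. length I = n}. f (i # I))"
    unfolding img sum.reindex[OF inj] by (simp add: split_def)
  then show ?thesis by (simp add: sum.cartesian_product)
qed

lemma sum_length_1: "(\<Sum>I :: 2 list | length I = Suc 0. f I) = f [ia] + f [ib]"
  by (simp only: sum_length_Suc sum_length_0 sum_ab)

lemma sum_length_2: "(\<Sum>I :: 2 list | length I = 2. f I) = f [ia, ia] + f [ia, ib] + (f [ib, ia] + f [ib, ib])"
  by (simp only: numeral_2_eq_2 sum_length_Suc sum_length_0 sum_ab)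

lemma prod_lessThan_2: "(\<Prod>k<(2::nat). f k) = f 0 * f 1"
  by (simp add: lessThan_Suc numeral_2_eq_2 mult.commute)

lemma list2_cases: "length I = 2 \<Longrightarrow> I \<in> {[ia, ia], [ia, ib], [ib, ia], [ib, ib]}" for I :: "2 list"
  using ab_cases by (auto simp: numeral_2_eq_2 length_Suc_conv)

text \<open>The support condition of \<open>smooth_alternating\<close> in isolation. It reduces
  equality of tensors to the arguments that make sense, also for values of \<open>iota\<close> and
  \<open>ext_d\<close>.\<close>

definition homogeneous :: "('a, 'n::finite) chart set \<Rightarrow> nat \<Rightarrow> ('a, 'n) tensor \<Rightarrow> bool" where
  "homogeneous A k \<omega> \<longleftrightarrow> (\<forall>c x I. \<omega> c x I \<noteq> 0 \<longrightarrow> c \<in> A \<and> x \<in> dom_of c \<and> length I = k)"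

lemma homogeneousD: "homogeneous A k \<omega> \<Longrightarrow> \<not> (c \<in> A \<and> x \<in> dom_of c \<and> length I = k) \<Longrightarrow> \<omega> c x I = 0"
  unfolding homogeneous_def by blast

lemma homogeneous_ext:
  assumes "homogeneous A k \<omega>" "homogeneous A k \<eta>"
    "\<And>c x I. c \<in> A \<Longrightarrow> x \<in> dom_of c \<Longrightarrow> length I = k \<Longrightarrow> \<omega> c x I = \<eta> c x I"
  shows "\<omega> = \<eta>"
proof (intro ext)
  fix c x I
  show "\<omega> c x I = \<eta> c x I"
    using assms homogeneousD[OF assms(1), of c x I] homogeneousD[OF assms(2), of c x I]
    by (cases "c \<in> A \<and> x \<in> dom_of c \<and> length I = k") auto
qed

lemma diff_forms_homogeneous: "P \<in> diff_forms A p \<Longrightarrow> homogeneous A p P"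
  unfolding diff_forms_def smooth_alternating_def homogeneous_def by blast

lemma alternating_swap:
  assumes "smooth_alternating A p P"
  shows "P c x [j, i] = - P c x [i, j]"
proof -
  have "P c x ([i, j][0 := [i, j] ! 1, 1 := [i, j] ! 0]) = - P c x [i, j]"
    using assms unfolding smooth_alternating_def by (metis length_Cons less_Suc_eq list.size(3) zero_less_one One_nat_def)
  then show ?thesis by simp
qed

lemma alternating_ab:
  assumes "smooth_alternating A p P"
  shows "P c x [ib, ia] = - P c x [ia, ib]" "P c x [i, i] = 0"
  using alternating_swap[OF assms, of c x ib ia] alternating_swap[OF assms, of c x i i] by simp_all

lemma multivec_alt: "P \<in> multivec A p \<Longrightarrow> smooth_alternating A p P"
  by (simp add: multivec_def)

lemma diff_forms_alt: "P \<in> diff_forms A p \<Longrightarrow> smooth_alternating A p P"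
  by (simp add: diff_forms_def)

text \<open>Three or more indices from a type with two elements repeat one; swapping the repeated
  entries reverses the sign of the component but leaves the index list as it is.\<close>

lemma alternating_high_zero:
  fixes P :: "('a, 2) tensor"
  assumes "smooth_alternating A p P" "p \<ge> 3"
  shows "P = (\<lambda>c x I. 0)"
proof (intro ext, rule ccontr)
  fix c x and I :: "2 list"
  assume nz: "P c x I \<noteq> 0"
  then have "length I = p" using assms(1) unfolding smooth_alternating_def by blast
  then have len: "length I \<ge> 3" using assms(2) by simp
  have "\<not> distinct I"
  proof
    assume "distinct I"
    then have "length I = card (set I)" by (simp add: distinct_card)
    also have "\<dots> \<le> card (UNIV :: 2 set)" by (rule card_mono) auto
    finally show False using len by simp
  qed
  then obtain k l where kl: "k < l" "l < length I" "I ! k = I ! l"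
    unfolding distinct_conv_nth by (metis linorder_neqE_nat)
  then have "I[k := I ! l, l := I ! k] = I"
    by (metis list_update_id)
  then have "P c x I = - P c x I"
    using assms(1) kl unfolding smooth_alternating_def by metis
  then show False using nz by simp
qed

text \<open>The Jacobian determinant of the coordinate change from \<open>c\<close> to
  \<open>d\<close>.\<close>

definition jd :: "('a, 2) chart \<Rightarrow> ('a, 2) chart \<Rightarrow> 'a \<Rightarrow> real" where
  "jd c d x = jac c d x ia ia * jac c d x ib ib - jac c d x ia ib * jac c d x ib ia"

lemma multivec_trans:
  assumes "P \<in> multivec A p" "c \<in> A" "d \<in> A" "x \<in> dom_of c" "x \<in> dom_of d" "length J = p"
  shows "P d x J = (\<Sum>I | length I = p. (\<Prod>k<p. jac c d x (J ! k) (I ! k)) * P c x I)"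
  using assms unfolding multivec_def by blast

text \<open>The charts are exchanged relative to \<open>diff_forms\<close>, so that one matrix
  \<open>jac c d\<close> governs both kinds of tensor: it takes vectors from \<open>c\<close> to
  \<open>d\<close> and forms from \<open>d\<close> to \<open>c\<close>.\<close>

lemma diff_forms_trans:
  assumes "\<omega> \<in> diff_forms A p" "c \<in> A" "d \<in> A" "x \<in> dom_of c" "x \<in> dom_of d" "length J = p"
  shows "\<omega> c x J = (\<Sum>I | length I = p. (\<Prod>k<p. jac c d x (I ! k) (J ! k)) * \<omega> d x I)"
  using assms unfolding diff_forms_def by blast

lemma multivec_1_trans:
  assumes "X \<in> multivec A 1" "c \<in> A" "d \<in> A" "x \<in> dom_of c" "x \<in> dom_of d"
  shows "X d x [j] = jac c d x j ia * X c x [ia] + jac c d x j ib * X c x [ib]"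
proof -
  have "X d x [j] = (\<Sum>I | length I = 1. (\<Prod>k<1. jac c d x ([j] ! k) (I ! k)) * X c x I)"
    by (rule multivec_trans[OF assms]) simp
  then show ?thesis by (simp add: sum_length_1)
qed

lemma diff_forms_1_trans:
  assumes "\<eta> \<in> diff_forms A 1" "c \<in> A" "d \<in> A" "x \<in> dom_of c" "x \<in> dom_of d"
  shows "\<eta> c x [j] = jac c d x ia j * \<eta> d x [ia] + jac c d x ib j * \<eta> d x [ib]"
proof -
  have "\<eta> c x [j] = (\<Sum>I | length I = 1. (\<Prod>k<1. jac c d x (I ! k) ([j] ! k)) * \<eta> d x I)"
    by (rule diff_forms_trans[OF assms]) simp
  then show ?thesis by (simp add: sum_length_1)
qed

lemma multivec_2_trans:
  assumes P: "P \<in> multivec A 2" and "c \<in> A" "d \<in> A" "x \<in> dom_of c" "x \<in> dom_of d"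
  shows "P d x [ia, ib] = jd c d x * P c x [ia, ib]"
proof -
  have "P d x [ia, ib] = (\<Sum>I | length I = 2. (\<Prod>k<2. jac c d x ([ia, ib] ! k) (I ! k)) * P c x I)"
    by (rule multivec_trans[OF assms]) simp
  then show ?thesis
    using alternating_ab[OF multivec_alt[OF P]]
    by (simp add: sum_length_2 jd_def prod_lessThan_2 algebra_simps)
qed

lemma diff_forms_2_trans:
  assumes P: "P \<in> diff_forms A 2" and "c \<in> A" "d \<in> A" "x \<in> dom_of c" "x \<in> dom_of d"
  shows "P c x [ia, ib] = jd c d x * P d x [ia, ib]"
proof -
  have "P c x [ia, ib] = (\<Sum>I | length I = 2. (\<Prod>k<2. jac c d x (I ! k) ([ia, ib] ! k)) * P d x I)"
    by (rule diff_forms_trans[OF assms]) simp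
  then show ?thesis
    using alternating_ab[OF diff_forms_alt[OF P]]
    by (simp add: sum_length_2 jd_def prod_lessThan_2 algebra_simps)
qed

lemma alternating_swap_short:
  assumes "homogeneous A p P" "p < 2" "k < l" "l < length I"
  shows "P c x (I[k := I ! l, l := I ! k]) = - P c x I"
  using homogeneousD[OF assms(1), of c x I] homogeneousD[OF assms(1), of c x "I[k := I ! l, l := I ! k]"] assms(2-4)
  by simp

context smooth_mfd
begin

lemma smooth_vec_img:
  assumes "c \<in> A"
  shows "smooth_vec (img_of c) (\<lambda>u. f (chart_inv c u)) \<longleftrightarrow> smooth (dom_of c) f"
proof
  assume "smooth_vec (img_of c) (\<lambda>u. f (chart_inv c u))"
  then show "smooth (dom_of c) f"
    by (intro smooth_inI_chart[OF assms open_dom[OF assms]]) (auto simp: smooth_vec_iff)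
qed (use assms in \<open>auto simp: smooth_in_def\<close>)

lemma smooth_alternating_iff:
  "smooth_alternating A p P \<longleftrightarrow> homogeneous A p P \<and>
     (\<forall>c x I k l. k < l \<and> l < length I \<longrightarrow> P c x (I[k := I ! l, l := I ! k]) = - P c x I) \<and>
     (\<forall>c\<in>A. \<forall>I. smooth (dom_of c) (\<lambda>x. P c x I))"
proof -
  have "(\<forall>c\<in>A. \<forall>I. smooth_vec (img_of c) (\<lambda>u. P c (chart_inv c u) I)) \<longleftrightarrow>
      (\<forall>c\<in>A. \<forall>I. smooth (dom_of c) (\<lambda>x. P c x I))"
    by (intro ball_cong refl all_cong1) (rule smooth_vec_img[of _ "\<lambda>x. P _ x _"])
  then show ?thesis unfolding smooth_alternating_def homogeneous_def by (simp only:)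
qed

lemma alternating_smooth: "smooth_alternating A p P \<Longrightarrow> c \<in> A \<Longrightarrow> smooth (dom_of c) (\<lambda>x. P c x I)"
  by (simp add: smooth_alternating_iff)

lemmas multivec_smooth = alternating_smooth[OF multivec_alt]
lemmas diff_forms_smooth = alternating_smooth[OF diff_forms_alt]

lemma ext_d_cpd:
  assumes "c \<in> A" "x \<in> dom_of c"
  shows "ext_d A \<omega> c x I = (\<Sum>k<length I. (-1) ^ k * cpd c (I ! k) (\<lambda>y. \<omega> c y (take k I @ drop (Suc k) I)) x)"
  using assms by (simp add: ext_d_def cpd_def)

lemma cpd_of_fun:
  assumes "c \<in> A" "x \<in> dom_of c"
  shows "cpd c i (\<lambda>y. of_fun A f c y []) x = cpd c i f x"
  by (rule cpd_cong[OF assms(1) open_dom[OF assms(1)] assms(2,2)]) (simp add: of_fun_def assms(1))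

lemma ext_d_of_fun:
  assumes "c \<in> A" "x \<in> dom_of c"
  shows "ext_d A (of_fun A f) c x [i] = cpd c i f x"
  using assms by (simp add: ext_d_cpd cpd_of_fun)

lemma ext_d_homogeneous:
  assumes "homogeneous A k \<omega>"
  shows "homogeneous A (Suc k) (ext_d A \<omega>)"
  unfolding homogeneous_def
proof (intro allI impI conjI)
  fix c x I
  assume nz: "ext_d A \<omega> c x I \<noteq> 0"
  then show c: "c \<in> A" and x: "x \<in> dom_of c" by (auto simp: ext_d_def split: if_splits)
  show "length I = Suc k"
  proof (rule ccontr)
    assume len: "length I \<noteq> Suc k"
    have "(\<lambda>y. \<omega> c y (take j I @ drop (Suc j) I)) = (\<lambda>y. 0)" if "j < length I" for j
      by (intro ext homogeneousD[OF assms]) (use len that in auto)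
    then have "ext_d A \<omega> c x I = 0" by (simp add: ext_d_cpd c x)
    then show False using nz by simp
  qed
qed

lemma iota_homogeneous:
  assumes "homogeneous A (p + k) \<omega>"
  shows "homogeneous A k (iota p P \<omega>)"
  unfolding homogeneous_def
proof (intro allI impI)
  fix c x J
  assume "iota p P \<omega> c x J \<noteq> 0"
  then have "(\<Sum>I | length I = p. P c x I * \<omega> c x (I @ J)) \<noteq> 0" by (auto simp: iota_def)
  then obtain I where I: "length I = p" "\<omega> c x (I @ J) \<noteq> 0"
    using sum.not_neutral_contains_not_neutral by force
  then show "c \<in> A \<and> x \<in> dom_of c \<and> length J = k" using homogeneousD[OF assms, of c x "I @ J"] by auto
qed

lemma iota_low_degree:
  assumes "homogeneous A k \<omega>" "k < p"
  shows "iota p P \<omega> = (\<lambda>c x J. 0)"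
proof (intro ext)
  fix c x J
  have "(\<Sum>I | length I = p. P c x I * \<omega> c x (I @ J)) = 0"
    by (rule sum.neutral) (use homogeneousD[OF assms(1), of c x "_ @ J"] assms(2) in simp)
  then show "iota p P \<omega> c x J = 0" by (simp add: iota_def)
qed

lemma iota_zero: "iota p P (\<lambda>c x J. 0) = (\<lambda>c x J. 0)"
  by (simp add: iota_def)

lemma ext_d_zero: "ext_d A (\<lambda>c x J. 0) = (\<lambda>c x J. 0)"
proof (intro ext)
  fix c x J
  show "ext_d A (\<lambda>c x J. 0) c x J = 0"
    by (cases "c \<in> A \<and> x \<in> dom_of c") (simp add: ext_d_cpd, simp only: ext_d_def if_False)
qed

lemma to_fun_eq:
  assumes "\<And>c. c \<in> A \<Longrightarrow> x \<in> dom_of c \<Longrightarrow> \<omega> c x [] = h"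
  shows "to_fun A \<omega> x = h"
proof -
  have "\<exists>c. c \<in> A \<and> x \<in> dom_of c" by (meson chart_cover)
  then have "(SOME c. c \<in> A \<and> x \<in> dom_of c) \<in> A \<and> x \<in> dom_of (SOME c. c \<in> A \<and> x \<in> dom_of c)" by (rule someI_ex)
  then show ?thesis using assms by (simp add: to_fun_def)
qed

end

section \<open>Vector fields, forms and bivector fields in two dimensions\<close>

locale surface = closed_mfd A for A :: "('a::t2_space, 2) chart set"
begin

lemma iota_1: "iota 1 X \<omega> c x J = X c x [ia] * \<omega> c x (ia # J) + X c x [ib] * \<omega> c x (ib # J)"
  by (simp add: iota_def sum_length_1)

lemma iota_2:
  assumes "smooth_alternating A 2 P" 
  shows "iota 2 P \<omega> c x J = P c x [ia, ib] * (\<omega> c x (ia # ib # J) - \<omega> c x (ib # ia # J)) / 2"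
  using alternating_ab[OF assms, of c x] by (simp add: iota_def sum_length_2 algebra_simps)

lemma iota_2_form:
  assumes "smooth_alternating A 2 P" "smooth_alternating A 2 \<omega>"
  shows "iota 2 P \<omega> c x [] = P c x [ia, ib] * \<omega> c x [ia, ib]"
  using alternating_ab[OF assms(2), of c x] by (simp add: iota_2[OF assms(1)])

lemmas iota_Suc_0 = iota_1[unfolded One_nat_def]

lemma scalar_2:
  assumes "P \<in> multivec A 2" "\<omega> \<in> diff_forms A 2" "c \<in> A" "d \<in> A" "x \<in> dom_of c" "x \<in> dom_of d"
  shows "P c x [ia, ib] * \<omega> c x [ia, ib] = P d x [ia, ib] * \<omega> d x [ia, ib]"
  using multivec_2_trans[OF assms(1,3-6)] diff_forms_2_trans[OF assms(2-6)] by simp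

lemma scalar_1:
  assumes "X \<in> multivec A 1" "\<eta> \<in> diff_forms A 1" "c \<in> A" "d \<in> A" "x \<in> dom_of c" "x \<in> dom_of d"
  shows "X c x [ia] * \<eta> c x [ia] + X c x [ib] * \<eta> c x [ib] = X d x [ia] * \<eta> d x [ia] + X d x [ib] * \<eta> d x [ib]"
  unfolding multivec_1_trans[OF assms(1,3-6)] diff_forms_1_trans[OF assms(2-6)]
  by (simp add: algebra_simps)

lemma to_fun_iota_2:
  assumes "P \<in> multivec A 2" "\<omega> \<in> diff_forms A 2" "c \<in> A" "x \<in> dom_of c"
  shows "to_fun A (iota 2 P \<omega>) x = P c x [ia, ib] * \<omega> c x [ia, ib]"
  by (rule to_fun_eq)
    (simp add: iota_2_form[OF multivec_alt[OF assms(1)] diff_forms_alt[OF assms(2)]]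
      scalar_2[OF assms(1,2) _ assms(3) _ assms(4)])

lemma to_fun_iota_1:
  assumes "X \<in> multivec A 1" "\<eta> \<in> diff_forms A 1" "c \<in> A" "x \<in> dom_of c"
  shows "to_fun A (iota 1 X \<eta>) x = X c x [ia] * \<eta> c x [ia] + X c x [ib] * \<eta> c x [ib]"
  by (rule to_fun_eq) (simp add: iota_Suc_0 scalar_1[OF assms(1,2) _ assms(3) _ assms(4)])

lemma alternating_1I:
  assumes "homogeneous A 1 X" "\<And>c i. c \<in> A \<Longrightarrow> smooth (dom_of c) (\<lambda>x. X c x [i])"
  shows "smooth_alternating A 1 X"
proof -
  have "smooth (dom_of c) (\<lambda>x. X c x I)" if "c \<in> A" for c I
  proof (cases "length I = 1")
    case True
    then obtain i where "I = [i]" by (auto simp: length_Suc_conv)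
    then show ?thesis using assms(2)[OF that] by simp
  next
    case False
    then have "(\<lambda>x. X c x I) = (\<lambda>x. 0)" using homogeneousD[OF assms(1)] by blast
    then show ?thesis using smooth_const[OF open_dom[OF that]] by simp
  qed
  then show ?thesis
    using assms(1) alternating_swap_short[OF assms(1)] by (simp add: smooth_alternating_iff)
qed

lemma multivec_1I:
  assumes "homogeneous A 1 X" "\<And>c i. c \<in> A \<Longrightarrow> smooth (dom_of c) (\<lambda>x. X c x [i])"
    "\<And>c d x j. c \<in> A \<Longrightarrow> d \<in> A \<Longrightarrow> x \<in> dom_of c \<Longrightarrow> x \<in> dom_of d \<Longrightarrow>
       X d x [j] = jac c d x j ia * X c x [ia] + jac c d x j ib * X c x [ib]"
  shows "X \<in> multivec A 1"
proof -
  have "smooth_alternating A 1 X" by (rule alternating_1I[OF assms(1,2)])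
  moreover have "X d x J = (\<Sum>I | length I = 1. (\<Prod>k<1. jac c d x (J ! k) (I ! k)) * X c x I)"
    if "c \<in> A" "d \<in> A" "x \<in> dom_of c \<inter> dom_of d" "length J = 1" for c d x J
  proof -
    note J = that
    obtain j where "J = [j]" using J(4) by (auto simp: length_Suc_conv)
    then show ?thesis using assms(3)[OF J(1,2), of x j] J(3) by (simp add: sum_length_1)
  qed
  ultimately show ?thesis unfolding multivec_def by blast
qed

lemma diff_forms_1I:
  assumes "homogeneous A 1 \<eta>" "\<And>c i. c \<in> A \<Longrightarrow> smooth (dom_of c) (\<lambda>x. \<eta> c x [i])"
    "\<And>c d x j. c \<in> A \<Longrightarrow> d \<in> A \<Longrightarrow> x \<in> dom_of c \<Longrightarrow> x \<in> dom_of d \<Longrightarrow>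
       \<eta> c x [j] = jac c d x ia j * \<eta> d x [ia] + jac c d x ib j * \<eta> d x [ib]"
  shows "\<eta> \<in> diff_forms A 1"
proof -
  have "smooth_alternating A 1 \<eta>" by (rule alternating_1I[OF assms(1,2)])
  moreover have "\<eta> d x J = (\<Sum>I | length I = 1. (\<Prod>k<1. jac d c x (I ! k) (J ! k)) * \<eta> c x I)"
    if "c \<in> A" "d \<in> A" "x \<in> dom_of c \<inter> dom_of d" "length J = 1" for c d x J
  proof -
    note J = that
    obtain j where "J = [j]" using J(4) by (auto simp: length_Suc_conv)
    then show ?thesis using assms(3)[OF J(2,1), of x j] J(3) by (simp add: sum_length_1)
  qed
  ultimately show ?thesis unfolding diff_forms_def by blast
qed

lemma ext_d_of_fun_form:
  assumes "smooth UNIV h"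
  shows "ext_d A (of_fun A h) \<in> diff_forms A 1"
proof (rule diff_forms_1I)
  have "homogeneous A 0 (of_fun A h)" by (auto simp: homogeneous_def of_fun_def)
  then show "homogeneous A 1 (ext_d A (of_fun A h))" using ext_d_homogeneous by fastforce
  fix c assume c: "c \<in> A"
  have h: "smooth (dom_of c) h" using smooth_subset[OF assms open_dom[OF c]] by simp
  show "smooth (dom_of c) (\<lambda>x. ext_d A (of_fun A h) c x [i])" for i
    by (rule smooth_cong[OF smooth_cpd[OF h c order_refl]]) (simp add: ext_d_of_fun c)
  fix d x j assume "d \<in> A" "x \<in> dom_of c" "x \<in> dom_of d"
  then show "ext_d A (of_fun A h) c x [j] =
      jac c d x ia j * ext_d A (of_fun A h) d x [ia] + jac c d x ib j * ext_d A (of_fun A h) d x [ib]"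
    using cpd_chain[OF assms c] c by (simp add: ext_d_of_fun sum_ab)
qed

lemma diff_forms_1_add:
  assumes "\<eta> \<in> diff_forms A 1" "\<theta> \<in> diff_forms A 1"
  shows "\<eta> + \<theta> \<in> diff_forms A 1"
proof (rule diff_forms_1I)
  show "homogeneous A 1 (\<eta> + \<theta>)"
    using assms[THEN diff_forms_homogeneous] unfolding homogeneous_def by (metis add.right_neutral plus_fun_apply)
  show "smooth (dom_of c) (\<lambda>x. (\<eta> + \<theta>) c x [i])" if "c \<in> A" for c i
    using smooth_add[OF assms[THEN diff_forms_smooth, OF that]] by simp
  show "(\<eta> + \<theta>) c x [j] = jac c d x ia j * (\<eta> + \<theta>) d x [ia] + jac c d x ib j * (\<eta> + \<theta>) d x [ib]"
    if "c \<in> A" "d \<in> A" "x \<in> dom_of c" "x \<in> dom_of d" for c d x j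
    using assms[THEN diff_forms_1_trans, OF that, of j] by (simp add: algebra_simps)
qed

lemma diff_forms_1_fscale:
  assumes "\<eta> \<in> diff_forms A 1" "smooth UNIV f"
  shows "fscale f \<eta> \<in> diff_forms A 1"
proof (rule diff_forms_1I)
  show "homogeneous A 1 (fscale f \<eta>)"
    using diff_forms_homogeneous[OF assms(1)] unfolding homogeneous_def fscale_def by (metis mult_zero_right)
  show "smooth (dom_of c) (\<lambda>x. fscale f \<eta> c x [i])" if "c \<in> A" for c i
    unfolding fscale_def
    by (intro smooth_mult diff_forms_smooth[OF assms(1) that] smooth_subset[OF assms(2) open_dom[OF that]]) simp
  show "fscale f \<eta> c x [j] = jac c d x ia j * fscale f \<eta> d x [ia] + jac c d x ib j * fscale f \<eta> d x [ib]"
    if "c \<in> A" "d \<in> A" "x \<in> dom_of c" "x \<in> dom_of d" for c d x j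
    using diff_forms_1_trans[OF assms(1) that, of j] by (simp add: fscale_def algebra_simps)
qed

lemma diff_forms_1_uminus:
  assumes "\<eta> \<in> diff_forms A 1"
  shows "- \<eta> \<in> diff_forms A 1"
proof -
  have "- \<eta> = fscale (\<lambda>x. -1) \<eta>" by (simp add: fscale_def fun_eq_iff)
  then show ?thesis using diff_forms_1_fscale[OF assms smooth_const[OF open_UNIV]] by simp
qed

definition bivec :: "(('a, 2) chart \<Rightarrow> 'a \<Rightarrow> real) \<Rightarrow> ('a, 2) tensor" where
  "bivec r = (\<lambda>c x I. if c \<in> A \<and> x \<in> dom_of c
     then if I = [ia, ib] then r c x else if I = [ib, ia] then - r c x else 0 else 0)"

lemma bivec_ab: "c \<in> A \<Longrightarrow> x \<in> dom_of c \<Longrightarrow> bivec r c x [ia, ib] = r c x"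
  by (simp add: bivec_def)

lemma bivec_multivec:
  assumes "\<And>c. c \<in> A \<Longrightarrow> smooth (dom_of c) (r c)"
    "\<And>c d x. c \<in> A \<Longrightarrow> d \<in> A \<Longrightarrow> x \<in> dom_of c \<Longrightarrow> x \<in> dom_of d \<Longrightarrow> r d x = jd c d x * r c x"
  shows "bivec r \<in> multivec A 2"
proof -
  have hom: "homogeneous A 2 (bivec r)" by (auto simp: homogeneous_def bivec_def split: if_splits)
  have swap: "bivec r c x (I[k := I ! l, l := I ! k]) = - bivec r c x I" if "k < l" "l < length I" for c x I k l
  proof (cases "length I = 2")
    case True
    then have "k = 0" "l = 1" using that by auto
    then show ?thesis using list2_cases[OF True] by (auto simp: bivec_def)
  next
    case False
    then show ?thesis
      using homogeneousD[OF hom, of c x I] homogeneousD[OF hom, of c x "I[k := I ! l, l := I ! k]"] by simp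
  qed
  have smooth: "smooth (dom_of c) (\<lambda>x. bivec r c x I)" if c: "c \<in> A" for c I
  proof -
    consider "I = [ia, ib]" | "I = [ib, ia]" | "I \<noteq> [ia, ib]" "I \<noteq> [ib, ia]" by blast
    then show ?thesis
    proof cases
      case 1
      show ?thesis by (rule smooth_cong[OF assms(1)[OF c]]) (simp add: bivec_def c 1)
    next
      case 2
      show ?thesis by (rule smooth_cong[OF smooth_minus[OF assms(1)[OF c]]]) (simp add: bivec_def c 2)
    next
      case 3
      show ?thesis by (rule smooth_cong[OF smooth_const[OF open_dom[OF c], of 0]]) (simp add: bivec_def 3)
    qed
  qed
  have "bivec r d x J = (\<Sum>I | length I = 2. (\<Prod>k<2. jac c d x (J ! k) (I ! k)) * bivec r c x I)"
    if "c \<in> A" "d \<in> A" "x \<in> dom_of c \<inter> dom_of d" "length J = 2" for c d x J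
  proof -
    have "r d x = jd c d x * r c x" using assms(2) that by blast
    then show ?thesis
      using list2_cases[OF that(4)] that(1-3)
      by (elim insertE emptyE)
        (simp_all add: sum_length_2 bivec_def jd_def prod_lessThan_2 algebra_simps)
  qed
  moreover have "smooth_alternating A 2 (bivec r)"
    using hom swap smooth unfolding smooth_alternating_iff by blast
  ultimately show ?thesis unfolding multivec_def by blast
qed

lemma alternating_2_eqI:
  assumes "smooth_alternating A 2 P" "smooth_alternating A 2 Q"
    "\<And>c x. c \<in> A \<Longrightarrow> x \<in> dom_of c \<Longrightarrow> P c x [ia, ib] = Q c x [ia, ib]"
  shows "P = Q"
proof (rule homogeneous_ext[of A 2])
  show "homogeneous A 2 P" "homogeneous A 2 Q" using assms(1,2) by (simp_all add: smooth_alternating_iff)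
  fix c x and I :: "2 list"
  assume "c \<in> A" "x \<in> dom_of c" "length I = 2"
  then show "P c x I = Q c x I"
    using list2_cases[of I] alternating_ab[OF assms(1), of c x] alternating_ab[OF assms(2), of c x]
      assms(3)[of c x] by auto
qed

lemma diff_forms_2_fscale:
  assumes "\<omega> \<in> diff_forms A 2" "smooth UNIV f"
  shows "fscale f \<omega> \<in> diff_forms A 2"
proof -
  have alt: "smooth_alternating A 2 (fscale f \<omega>)"
    using diff_forms_alt[OF assms(1)]
    unfolding smooth_alternating_iff homogeneous_def fscale_def
    by (auto intro!: smooth_mult smooth_subset[OF assms(2) open_dom])
  have "fscale f \<omega> d x J = (\<Sum>I | length I = 2. (\<Prod>k<2. jac d c x (I ! k) (J ! k)) * fscale f \<omega> c x I)"
    if "c \<in> A" "d \<in> A" "x \<in> dom_of c \<inter> dom_of d" "length J = 2" for c d x J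
  proof -
    have "\<omega> d x J = (\<Sum>I | length I = 2. (\<Prod>k<2. jac d c x (I ! k) (J ! k)) * \<omega> c x I)"
      using assms(1) that unfolding diff_forms_def by blast
    then show ?thesis by (simp add: fscale_def sum_distrib_left mult_ac)
  qed
  then show ?thesis using alt unfolding diff_forms_def by blast
qed

end

section \<open>Divergence on a surface with a volume form\<close>

locale volume_surface = surface A for A :: "('a::t2_space, 2) chart set" +
  fixes \<mu> :: "('a, 2) tensor"
  assumes vol: "volume_form A \<mu>"
begin

abbreviation m where "m c x \<equiv> \<mu> c x [ia, ib]"

lemma vol_form: "\<mu> \<in> diff_forms A 2"
  using vol by (simp add: volume_form_def)

lemma m_nz: "c \<in> A \<Longrightarrow> x \<in> dom_of c \<Longrightarrow> m c x \<noteq> 0"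
proof -
  assume "c \<in> A" "x \<in> dom_of c"
  then obtain I where I: "\<mu> c x I \<noteq> 0" using vol unfolding volume_form_def by blast
  then have "length I = 2" using homogeneousD[OF diff_forms_homogeneous[OF vol_form]] by blast
  then show "m c x \<noteq> 0"
    using list2_cases[of I] alternating_ab[OF diff_forms_alt[OF vol_form], of c x] I by auto
qed

lemmas m_trans = diff_forms_2_trans[OF vol_form]

lemma m_smooth: "c \<in> A \<Longrightarrow> smooth (dom_of c) (m c)"
  by (rule diff_forms_smooth[OF vol_form])

text \<open>A 2-form changes by the Jacobian determinant itself, so the absolute value of its
  component changes by the absolute value.\<close>

sublocale density_mfd A "\<lambda>c x. \<bar>m c x\<bar>"
proof
  fix c assume c: "c \<in> A"
  show "continuous_on (dom_of c) (\<lambda>x. \<bar>m c x\<bar>)"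
    by (rule continuous_on_rabs) (rule smooth_continuous[OF m_smooth[OF c]])
  show "\<bar>m c x\<bar> > 0" if "x \<in> dom_of c" for x using m_nz[OF c that] by simp
  show "\<bar>m c x\<bar> = \<bar>det (\<chi> i j. jac c d x i j)\<bar> * \<bar>m d x\<bar>" if "d \<in> A" "x \<in> dom_of c" "x \<in> dom_of d" for d x
    unfolding m_trans[OF c that] det_ab jd_def[symmetric] by (rule abs_mult)
qed

text \<open>In every chart the factor \<open>sgn\<close> of \<open>integral_form\<close>, multiplied
  by the component of \<open>\<mu>\<close>, is the absolute value of that component.\<close>

lemma integral_form_eq_mint:
  assumes "continuous_on UNIV h"
  shows "integral_form A \<mu> (fscale h \<mu>) = mint h"
proof -
  let ?L = "\<lambda>\<rho> c. LINT u:img_of c|lborel. \<rho> c (chart_inv c u) *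
        (sgn (\<mu> c (chart_inv c u) top_index) * fscale h \<mu> c (chart_inv c u) top_index)"
  have "(\<Sum>c\<in>C. ?L \<rho> c) = (\<Sum>c\<in>C. cint c (\<lambda>x. \<rho> c x * (h x * \<bar>m c x\<bar>)))" if C: "partition_of_unity A C \<rho>" for C \<rho>
  proof (rule sum.cong[OF refl])
    fix c assume c: "c \<in> C"
    note P = partition_support[OF C c]
    have "(\<lambda>u. \<rho> c (chart_inv c u) * (sgn (\<mu> c (chart_inv c u) top_index) * fscale h \<mu> c (chart_inv c u) top_index))
        = (\<lambda>u. \<rho> c (chart_inv c u) * (h (chart_inv c u) * \<bar>m c (chart_inv c u)\<bar>))"
      by (auto simp: fun_eq_iff top_index_2(1) fscale_def abs_sgn mult_ac)
    moreover have "(LINT u:img_of c|lborel. \<rho> c (chart_inv c u) * (h (chart_inv c u) * \<bar>m c (chart_inv c u)\<bar>))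
        = cint c (\<lambda>x. \<rho> c x * (h x * \<bar>m c x\<bar>))"
    proof (rule cint_lborel(2)[OF P(1,4,5)])
      show "continuous_on (dom_of c) (\<lambda>x. \<rho> c x * (h x * \<bar>m c x\<bar>))"
        by (intro continuous_on_mult P(3) w_cont[OF P(1)] continuous_on_subset[OF assms]) simp
      show "\<rho> c x * (h x * \<bar>m c x\<bar>) = 0" if "x \<notin> supp (\<rho> c)" for x using P(6)[OF that] by simp
    qed
    ultimately show "(?L \<rho> c)
      = cint c (\<lambda>x. \<rho> c x * (h x * \<bar>m c x\<bar>))" by simp
  qed
  then have "(\<lambda>s. \<forall>C \<rho>. partition_of_unity A C \<rho> \<longrightarrow> s = (\<Sum>c\<in>C. ?L \<rho> c))
    = (\<lambda>s. \<forall>C \<rho>. partition_of_unity A C \<rho> \<longrightarrow> s = (\<Sum>c\<in>C. cint c (\<lambda>x. \<rho> c x * (h x * \<bar>m c x\<bar>))))"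
    by (intro ext) (metis (no_types, lifting))
  then show ?thesis unfolding integral_form_def mint_def by simp
qed

text \<open>\<open>m c\<close> is continuous without zeros, so its sign is locally constant.
  Derivatives of the absolute value thus become derivatives of a constant multiple of
  \<open>m c\<close>.\<close>

lemma abs_m_sign:
  assumes c: "c \<in> A" and x: "x \<in> dom_of c"
  obtains V where "open V" "x \<in> V" "V \<subseteq> dom_of c" "\<And>y. y \<in> V \<Longrightarrow> \<bar>m c y\<bar> = sgn (m c x) * m c y"
proof
  let ?V = "dom_of c \<inter> (\<lambda>y. sgn (m c x) * m c y) -` {0<..}"
  show "open ?V"
    by (intro continuous_open_preimage continuous_on_mult continuous_on_const open_greaterThan
        smooth_continuous[OF m_smooth[OF c]] open_dom[OF c])
  show "x \<in> ?V" using m_nz[OF c x] x by (auto simp: sgn_if)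
  show "?V \<subseteq> dom_of c" by blast
  show "\<bar>m c y\<bar> = sgn (m c x) * m c y" if "y \<in> ?V" for y
    using that m_nz[OF c x] by (auto simp: sgn_if split: if_splits)
qed

lemma abs_m_smooth:
  assumes c: "c \<in> A"
  shows "smooth (dom_of c) (\<lambda>y. \<bar>m c y\<bar>)"
proof (rule smooth_localI)
  fix x assume x: "x \<in> dom_of c"
  obtain V where V: "open V" "x \<in> V" "V \<subseteq> dom_of c" "\<And>y. y \<in> V \<Longrightarrow> \<bar>m c y\<bar> = sgn (m c x) * m c y"
    using abs_m_sign[OF c x] by blast
  have "smooth V (\<lambda>y. sgn (m c x) * m c y)"
    by (intro smooth_mult smooth_const V(1) smooth_subset[OF m_smooth[OF c] V(1,3)])
  then have "smooth V (\<lambda>y. \<bar>m c y\<bar>)" by (rule smooth_cong) (simp add: V(4))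
  then show "\<exists>V. x \<in> V \<and> V \<subseteq> dom_of c \<and> smooth V (\<lambda>y. \<bar>m c y\<bar>)" using V by blast
qed

text \<open>\<open>curl c X\<close> is the component of the exterior derivative of the contraction of \<open>\<mu>\<close> with \<open>X\<close>.\<close>

definition curl :: "('a, 2) chart \<Rightarrow> ('a, 2) tensor \<Rightarrow> 'a \<Rightarrow> real" where
  "curl c X x = cpd c ia (\<lambda>y. m c y * X c y [ia]) x + cpd c ib (\<lambda>y. m c y * X c y [ib]) x"

text \<open>The exterior derivative of a 1-form is compatible with coordinate changes: first
  derivatives follow the chain rule, and the second derivatives of the transition map cancel by
  symmetry (\<open>J_comm\<close>).\<close>

lemma curl_trans:
  assumes X: "X \<in> multivec A 1" and c: "c \<in> A" and d: "d \<in> A" and x: "x \<in> dom_of c" "x \<in> dom_of d"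
  shows "curl c X x = jd c d x * curl d X x"
proof -
  let ?W = "dom_of c \<inter> dom_of d"
  \<comment> \<open>\<open>\<alpha>a\<close> and \<open>\<alpha>b\<close> are the components of the
    1-form \<open>iota 1 X \<mu>\<close> in the chart \<open>e\<close>.\<close>
  define \<alpha>a where "\<alpha>a e y = - (m e y * X e y [ib])" for e y
  define \<alpha>b where "\<alpha>b e y = m e y * X e y [ia]" for e y
  define J where "J i j y = jac c d y i j" for i j y
  have W: "open ?W" "x \<in> ?W" using open_dom[OF c] open_dom[OF d] x by auto
  have sm: "smooth (dom_of e) (\<lambda>y. m e y * X e y [i])" if "e \<in> A" for e i
    using that by (intro smooth_mult m_smooth multivec_smooth[OF X])
  have \<alpha>_smooth: "smooth ?W (\<alpha>a d)" "smooth ?W (\<alpha>b d)"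
    unfolding \<alpha>a_def[abs_def] \<alpha>b_def[abs_def]
    by (intro smooth_minus smooth_subset[OF sm[OF d] W(1)] Int_lower2)+
  have coord: "smooth ?W (\<lambda>y. snd d y $ i)" for i
    by (rule smooth_subset[OF smooth_coord[OF d] W(1)]) simp
  have J: "J i j = cpd c j (\<lambda>y. snd d y $ i)" for i j
    by (simp add: J_def[abs_def] jac_cpd fun_eq_iff)
  have J_smooth: "smooth ?W (J i j)" for i j
    unfolding J by (rule smooth_cpd[OF coord c]) simp
  have J_comm: "cpd c ia (J i ib) x = cpd c ib (J i ia) x" for i
    unfolding J by (rule cpd_commute[OF coord c W(2) x(1)])
  have trans: "\<alpha>a c y = J ia ia y * \<alpha>a d y + J ib ia y * \<alpha>b d y"
    "\<alpha>b c y = J ia ib y * \<alpha>a d y + J ib ib y * \<alpha>b d y" if "y \<in> ?W" for y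
  proof -
    have y: "y \<in> dom_of c" "y \<in> dom_of d" using that by auto
    show "\<alpha>a c y = J ia ia y * \<alpha>a d y + J ib ia y * \<alpha>b d y"
      "\<alpha>b c y = J ia ib y * \<alpha>a d y + J ib ib y * \<alpha>b d y"
      unfolding \<alpha>a_def \<alpha>b_def J_def m_trans[OF c d y] multivec_1_trans[OF X c d y] jd_def
      by (simp_all add: algebra_simps)
  qed
  have diff: "cpd c k (\<lambda>y. J ia j y * \<alpha>a d y + J ib j y * \<alpha>b d y) x =
      cpd c k (J ia j) x * \<alpha>a d x + (J ia k x * cpd d ia (\<alpha>a d) x + J ib k x * cpd d ib (\<alpha>a d) x) * J ia j x
    + (cpd c k (J ib j) x * \<alpha>b d x + (J ia k x * cpd d ia (\<alpha>b d) x + J ib k x * cpd d ib (\<alpha>b d) x) * J ib j x)" for k j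
    unfolding cpd_add[OF smooth_mult[OF J_smooth \<alpha>_smooth(1)] smooth_mult[OF J_smooth \<alpha>_smooth(2)] c W(2) x(1)]
      cpd_mult[OF J_smooth \<alpha>_smooth(1) c W(2) x(1)] cpd_mult[OF J_smooth \<alpha>_smooth(2) c W(2) x(1)]
      cpd_chain[OF \<alpha>_smooth(1) c d W(2) x] cpd_chain[OF \<alpha>_smooth(2) c d W(2) x] sum_ab J_def[symmetric] ..
  have curl_\<alpha>: "curl e X x = cpd e ia (\<alpha>b e) x - cpd e ib (\<alpha>a e) x" if "e \<in> A" "x \<in> dom_of e" for e
    unfolding curl_def \<alpha>a_def[abs_def] \<alpha>b_def[abs_def]
    using cpd_minus[OF sm[OF that(1)] that(1,2,2)] by simp
  have e1: "cpd c ia (\<alpha>b c) x = cpd c ia (\<lambda>y. J ia ib y * \<alpha>a d y + J ib ib y * \<alpha>b d y) x"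
    by (rule cpd_cong[OF c W x(1)]) (rule trans(2))
  have e2: "cpd c ib (\<alpha>a c) x = cpd c ib (\<lambda>y. J ia ia y * \<alpha>a d y + J ib ia y * \<alpha>b d y) x"
    by (rule cpd_cong[OF c W x(1)]) (rule trans(1))
  show ?thesis
    unfolding curl_\<alpha>[OF c x(1)] curl_\<alpha>[OF d x(2)] e1[unfolded diff J_comm] e2[unfolded diff] jd_def J_def[symmetric]
    by (simp add: algebra_simps)
qed

text \<open>The divergence of \<open>X\<close>. Numerator and denominator change by the same
  determinant, so the quotient is a function on the manifold.\<close>

definition dv :: "('a, 2) tensor \<Rightarrow> 'a \<Rightarrow> real" where
  "dv X = to_fun A (\<lambda>c x I. curl c X x / m c x)"

lemma dv_curl:
  assumes "X \<in> multivec A 1" "c \<in> A" "x \<in> dom_of c"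
  shows "dv X x * m c x = curl c X x"
proof -
  have "dv X x = curl c X x / m c x"
    unfolding dv_def
  proof (rule to_fun_eq)
    fix d assume d: "d \<in> A" "x \<in> dom_of d"
    have "jd c d x \<noteq> 0" using m_trans[OF assms(2) d(1) assms(3) d(2)] m_nz[OF assms(2,3)] by auto
    then show "curl d X x / m d x = curl c X x / m c x"
      using curl_trans[OF assms(1,2) d(1) assms(3) d(2)] m_trans[OF assms(2) d(1) assms(3) d(2)] by simp
  qed
  then show ?thesis using m_nz[OF assms(2,3)] by simp
qed

lemma curl_smooth:
  assumes X: "X \<in> multivec A 1" and c: "c \<in> A"
  shows "smooth (dom_of c) (curl c X)"
  unfolding curl_def[abs_def]
  by (intro smooth_add smooth_cpd[OF _ c order_refl] smooth_mult m_smooth[OF c] multivec_smooth[OF X c])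

lemma dv_smooth:
  assumes X: "X \<in> multivec A 1"
  shows "smooth UNIV (dv X)"
proof (rule smooth_chartwise)
  fix c assume c: "c \<in> A"
  have "smooth (dom_of c) (\<lambda>x. curl c X x / m c x)"
    by (rule smooth_divide[OF curl_smooth[OF X c] m_smooth[OF c] m_nz[OF c]])
  then show "smooth (dom_of c) (dv X)"
    by (rule smooth_cong) (use dv_curl[OF X c, symmetric] m_nz[OF c] in simp)
qed

text \<open>The directional derivative of \<open>f\<close> along \<open>X\<close>, written as a
  contraction so that independence of the chart is inherited from the pairing of vectors with
  1-forms.\<close>

definition act :: "('a, 2) tensor \<Rightarrow> ('a \<Rightarrow> real) \<Rightarrow> 'a \<Rightarrow> real" where
  "act X f = to_fun A (iota 1 X (ext_d A (of_fun A f)))"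

lemma act_cpd:
  assumes "X \<in> multivec A 1" "smooth UNIV f" "c \<in> A" "x \<in> dom_of c"
  shows "act X f x = X c x [ia] * cpd c ia f x + X c x [ib] * cpd c ib f x"
  unfolding act_def to_fun_iota_1[OF assms(1) ext_d_of_fun_form[OF assms(2)] assms(3,4)]
  by (simp add: ext_d_of_fun assms(3,4))

lemma act_smooth:
  assumes X: "X \<in> multivec A 1" and f: "smooth UNIV f"
  shows "smooth UNIV (act X f)"
proof (rule smooth_chartwise)
  fix c assume c: "c \<in> A"
  have "smooth (dom_of c) (\<lambda>x. X c x [ia] * cpd c ia f x + X c x [ib] * cpd c ib f x)"
    by (intro smooth_add smooth_mult multivec_smooth[OF X c] smooth_cpd[OF _ c order_refl]
        smooth_subset[OF f open_dom[OF c]]) simp_all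
  then show "smooth (dom_of c) (act X f)"
    by (rule smooth_cong) (simp add: act_cpd[OF X f c])
qed

text \<open>The integrand is the divergence of the field \<open>h X\<close>. Multiplied by the
  density it is the sum of the coordinate derivatives of \<open>F i\<close>, each of which vanishes
  off \<open>K\<close> and integrates to 0.\<close>

lemma divergence_theorem_chart:
  assumes X: "X \<in> multivec A 1" and h: "smooth UNIV h"
    and e: "e \<in> A" and K: "compact K" "K \<subseteq> dom_of e" "\<And>x. x \<notin> K \<Longrightarrow> h x = 0"
  shows "mint (\<lambda>x. h x * dv X x + act X h x) = 0"
proof -
  let ?k = "\<lambda>x. h x * dv X x + act X h x"
  define F where "F i y = \<bar>m e y\<bar> * (h y * X e y [i])" for i y
  have he: "smooth (dom_of e) h" using smooth_subset[OF h open_dom[OF e]] by simp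
  have F_smooth: "smooth (dom_of e) (F i)" for i
    unfolding F_def[abs_def] by (intro smooth_mult abs_m_smooth[OF e] he multivec_smooth[OF X e])
  have opK: "open (- K)" using compact_imp_closed[OF K(1)] by auto
  have act0: "act X h x = 0" if "x \<notin> K" for x
  proof -
    obtain c where c: "c \<in> A" "x \<in> dom_of c" by (rule chart_cover)
    have "cpd c i h x = cpd c i (\<lambda>_. 0) x" for i
      by (rule cpd_cong[OF c(1) opK _ c(2)]) (use that K(3) in auto)
    then show ?thesis by (simp add: act_cpd[OF X h c])
  qed
  have "mint ?k = cint e (\<lambda>x. ?k x * \<bar>m e x\<bar>)"
  proof (rule mint_chart[OF e K(1,2)])
    show "continuous_on UNIV ?k"
      by (intro smooth_continuous smooth_add smooth_mult h dv_smooth[OF X] act_smooth[OF X h])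
  qed (simp add: K(3) act0)
  also have "\<dots> = cint e (\<lambda>x. \<Sum>i\<in>UNIV. cpd e i (F i) x)"
  proof (rule cint_cong[OF _ e])
    fix x assume x: "x \<in> dom_of e"
    \<comment> \<open>Near \<open>x\<close> the density is \<open>s * m e\<close> with constant
      \<open>s\<close>, which passes through the product rule.\<close>
    define s where "s = sgn (m e x)"
    obtain V where V: "open V" "x \<in> V" "V \<subseteq> dom_of e" "\<And>y. y \<in> V \<Longrightarrow> \<bar>m e y\<bar> = s * m e y"
      using abs_m_sign[OF e x] unfolding s_def by blast
    have G: "smooth (dom_of e) (\<lambda>y. m e y * X e y [i])" for i
      by (intro smooth_mult m_smooth[OF e] multivec_smooth[OF X e])
    have "cpd e i (F i) x = s * (cpd e i h x * (m e x * X e x [i]) + cpd e i (\<lambda>y. m e y * X e y [i]) x * h x)" for i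
    proof -
      have "cpd e i (F i) x = cpd e i (\<lambda>y. s * (h y * (m e y * X e y [i]))) x"
        by (rule cpd_cong[OF e V(1,2) x]) (simp add: F_def V(4))
      also have "\<dots> = s * cpd e i (\<lambda>y. h y * (m e y * X e y [i])) x"
        using cpd_mult[OF smooth_const[OF open_dom[OF e]] smooth_mult[OF he G] e x x] by simp
      finally show ?thesis unfolding cpd_mult[OF he G e x x] .
    qed
    then have "(\<Sum>i\<in>UNIV. cpd e i (F i) x) = s * (h x * curl e X x + m e x * act X h x)"
      by (simp add: sum_ab curl_def act_cpd[OF X h e x] algebra_simps)
    also have "\<dots> = ?k x * (s * m e x)"
      unfolding dv_curl[OF X e x, symmetric] by (simp add: algebra_simps)
    finally show "?k x * \<bar>m e x\<bar> = (\<Sum>i\<in>UNIV. cpd e i (F i) x)" using V(2,4) by simp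
  qed
  also have "\<dots> = (\<Sum>i\<in>UNIV. cint e (cpd e i (F i)))"
  proof (rule cint_sum[OF e _ K(1,2)])
    show "continuous_on (dom_of e) (cpd e i (F i))" for i
      by (rule smooth_continuous[OF smooth_cpd[OF F_smooth e order_refl]])
    show "cpd e i (F i) x = 0" if x: "x \<in> dom_of e" "x \<notin> K" for i x
    proof -
      have "cpd e i (F i) x = cpd e i (\<lambda>_. 0) x"
        by (rule cpd_cong[OF e opK _ x(1)]) (use x(2) K(3) in \<open>auto simp: F_def\<close>)
      then show ?thesis by simp
    qed
  qed simp
  also have "\<dots> = 0"
    by (intro sum.neutral ballI cint_cpd_eq_0[OF e K(1,2) F_smooth]) (simp add: F_def K(3))
  finally show ?thesis .
qed

text \<open>Both terms are linear in \<open>h\<close>, so a partition of unity cuts \<open>h\<close>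
  into pieces supported in single charts.\<close>

lemma divergence_theorem:
  assumes X: "X \<in> multivec A 1" and h: "smooth UNIV h"
  shows "mint (\<lambda>x. h x * dv X x + act X h x) = 0"
proof -
  obtain C \<rho> where C: "partition_of_unity A C \<rho>" by (rule partition_of_unity_exists)
  have fin: "finite C" and one: "\<And>x. (\<Sum>c\<in>C. \<rho> c x) = 1" using C by (auto simp: partition_of_unity_def)
  note P = partition_support[OF C]
  define k where "k c x = \<rho> c x * h x" for c x
  have k_smooth: "smooth UNIV (k c)" if "c \<in> C" for c
    unfolding k_def[abs_def] by (intro smooth_mult P(2)[OF that] h)
  have sum_k: "(\<Sum>c\<in>C. k c x) = h x" for x
    by (simp add: k_def sum_distrib_right[symmetric] one)
  have "act X h x = (\<Sum>c\<in>C. act X (k c) x)" for x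
  proof -
    obtain e where e: "e \<in> A" "x \<in> dom_of e" by (rule chart_cover)
    have "cpd e i h x = (\<Sum>c\<in>C. cpd e i (k c) x)" for i
      using cpd_sum[of C UNIV k, OF k_smooth e(1) UNIV_I e(2) open_UNIV] by (simp add: sum_k)
    then show ?thesis
      by (simp add: act_cpd[OF X h e] act_cpd[OF X k_smooth e] sum.distrib sum_distrib_left)
  qed
  then have "mint (\<lambda>x. h x * dv X x + act X h x) = mint (\<lambda>x. \<Sum>c\<in>C. k c x * dv X x + act X (k c) x)"
    by (simp add: sum.distrib sum_k sum_distrib_right[symmetric])
  also have "\<dots> = (\<Sum>c\<in>C. mint (\<lambda>x. k c x * dv X x + act X (k c) x))"
  proof (rule mint_sum[OF fin])
    fix c assume "c \<in> C"
    then have kc: "smooth UNIV (k c)" by (rule k_smooth)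
    show "continuous_on UNIV (\<lambda>x. k c x * dv X x + act X (k c) x)"
      by (rule smooth_continuous[OF smooth_add[OF smooth_mult[OF kc dv_smooth[OF X]] act_smooth[OF X kc]]])
  qed
  also have "\<dots> = 0"
  proof (intro sum.neutral ballI)
    fix c assume c: "c \<in> C"
    show "mint (\<lambda>x. k c x * dv X x + act X (k c) x) = 0"
    proof (rule divergence_theorem_chart[OF X k_smooth[OF c] P(1,4,5)[OF c]])
      show "k c x = 0" if "x \<notin> supp (\<rho> c)" for x
        unfolding k_def P(6)[OF c that] by (rule mult_zero_left)
    qed
  qed
  finally show ?thesis .
qed

end

section \<open>Schouten brackets with a bivector field and the codifferential\<close>

context smooth_mfd
begin

lemma jac_self:
  assumes c: "c \<in> A" and x: "x \<in> dom_of c"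
  shows "jac c c x i j = (if i = j then 1 else 0)"
proof -
  have "jac c c x i j = partial j (\<lambda>v. v i) (vec_nth (snd c x))"
    unfolding jac_cpd cpd_partial
    by (rule partial_cong[OF open_cvec[OF c open_dom[OF c]] in_cvec[OF x x]], elim cvecE)
      (use c in \<open>simp add: vec_nth_inverse\<close>)
  then show ?thesis by (auto simp: partial_coord)
qed

lemma jac_chain:
  assumes "c \<in> A" "d \<in> A" "e \<in> A" "x \<in> dom_of c" "x \<in> dom_of d" "x \<in> dom_of e"
  shows "jac c e x i j = (\<Sum>k\<in>UNIV. jac d e x i k * jac c d x k j)"
  using cpd_chain[OF smooth_coord[OF assms(3)] assms(1,2,6,4,5), of j i]
  by (simp add: jac_cpd[of _ e] mult.commute)

end

context surface
begin

lemma ext_d_2: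
  assumes "c \<in> A" "x \<in> dom_of c"
  shows "ext_d A \<omega> c x [i, j] = cpd c i (\<lambda>y. \<omega> c y [j]) x - cpd c j (\<lambda>y. \<omega> c y [i]) x"
  by (simp add: ext_d_cpd[OF assms] lessThan_Suc)

lemma ext_d_1:
  assumes "c \<in> A" "x \<in> dom_of c"
  shows "ext_d A \<omega> c x [i] = cpd c i (\<lambda>y. \<omega> c y []) x"
  by (simp add: ext_d_cpd[OF assms])

lemma ext_d_0: "ext_d A \<omega> c x [] = 0"
  by (simp add: ext_d_def)

text \<open>Among three indices two agree, and antisymmetry of the 2-form makes the terms vanish or
  cancel in pairs.\<close>

lemma ext_d_3:
  assumes \<omega>: "\<omega> \<in> diff_forms A 2" and c: "c \<in> A" and x: "x \<in> dom_of c"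
  shows "ext_d A \<omega> c x [i, j, k] = 0"
proof -
  have *: "(\<lambda>y. \<omega> c y [ib, ia]) = (\<lambda>y. - \<omega> c y [ia, ib])" "(\<lambda>y. \<omega> c y [i, i]) = (\<lambda>y. 0)" for i
    using alternating_ab[OF diff_forms_alt[OF \<omega>]] by (auto simp: fun_eq_iff)
  have m: "cpd c l (\<lambda>y. - \<omega> c y [ia, ib]) x = - cpd c l (\<lambda>y. \<omega> c y [ia, ib]) x" for l
    by (rule cpd_minus[OF diff_forms_smooth[OF \<omega> c] c x x])
  have "ext_d A \<omega> c x [i, j, k] =
      cpd c i (\<lambda>y. \<omega> c y [j, k]) x - cpd c j (\<lambda>y. \<omega> c y [i, k]) x + cpd c k (\<lambda>y. \<omega> c y [i, j]) x"
    by (simp add: ext_d_cpd[OF c x] lessThan_Suc)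
  then show ?thesis
    using ab_cases[of i] ab_cases[of j] ab_cases[of k] by (elim disjE) (simp_all add: * m)
qed

text \<open>The component of the Schouten bracket \<open>[P, X]\<close>, which is minus the Lie derivative of \<open>P\<close> along \<open>X\<close>.\<close>

definition sch :: "('a, 2) tensor \<Rightarrow> ('a, 2) tensor \<Rightarrow> ('a, 2) chart \<Rightarrow> 'a \<Rightarrow> real" where
  "sch P X c x =
     P c x [ia, ib] * (cpd c ia (\<lambda>y. X c y [ia]) x + cpd c ib (\<lambda>y. X c y [ib]) x) -
     (X c x [ia] * cpd c ia (\<lambda>y. P c y [ia, ib]) x + X c x [ib] * cpd c ib (\<lambda>y. P c y [ia, ib]) x)"

lemma sch_smooth:
  assumes "P \<in> multivec A 2" "X \<in> multivec A 1" "c \<in> A"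
  shows "smooth (dom_of c) (sch P X c)"
  unfolding sch_def[abs_def]
  by (intro smooth_diff smooth_add smooth_mult smooth_cpd[OF _ assms(3) order_refl]
      multivec_smooth[OF assms(1,3)] multivec_smooth[OF assms(2,3)])

text \<open>The right-hand sides of the identity defining \<open>schouten\<close> in bidegrees (2,1)
  and (1,2). The inner commutator has the parity of \<open>p + 1\<close>, whence the leading 3 and
  2.\<close>

abbreviation comm_21 where
  "comm_21 P X \<equiv> gcomm 3 1 (gcomm 2 1 (iota 2 P) (ext_d A)) (iota 1 X)"

abbreviation comm_12 where
  "comm_12 X P \<equiv> gcomm 2 2 (gcomm 1 1 (iota 1 X) (ext_d A)) (iota 2 P)"

lemma gcomm_homogeneous:
  "homogeneous A k (S (T \<omega>)) \<Longrightarrow> homogeneous A k (T (S \<omega>)) \<Longrightarrow> homogeneous A k (gcomm a b S T \<omega>)"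
  unfolding homogeneous_def gcomm_def by (metis diff_zero mult_zero_right)

lemma homogeneous_zero: "homogeneous A k (\<lambda>c x I. 0)"
  by (simp add: homogeneous_def)

lemma comm_P_d_homogeneous:
  assumes "homogeneous A (Suc k) \<omega>"
  shows "homogeneous A k (gcomm 2 1 (iota 2 P) (ext_d A) \<omega>)"
proof (rule gcomm_homogeneous)
  show "homogeneous A k (iota 2 P (ext_d A \<omega>))"
    by (rule iota_homogeneous) (use ext_d_homogeneous[OF assms] in simp)
  show "homogeneous A k (ext_d A (iota 2 P \<omega>))"
  proof (cases k)
    case 0
    then have "iota 2 P \<omega> = (\<lambda>c x J. 0)" using iota_low_degree[OF assms] by simp
    then show ?thesis by (simp add: ext_d_zero homogeneous_zero)
  next
    case (Suc j)
    have "homogeneous A j (iota 2 P \<omega>)" by (rule iota_homogeneous) (use assms Suc in simp)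
    then show ?thesis using ext_d_homogeneous Suc by blast
  qed
qed

lemma comm_P_d_0:
  assumes "homogeneous A 0 \<omega>"
  shows "gcomm 2 1 (iota 2 P) (ext_d A) \<omega> = (\<lambda>c x I. 0)"
proof -
  have "iota 2 P \<omega> = (\<lambda>c x J. 0)" by (rule iota_low_degree[OF assms]) simp
  moreover have "iota 2 P (ext_d A \<omega>) = (\<lambda>c x J. 0)" by (rule iota_low_degree[OF ext_d_homogeneous[OF assms]]) simp
  ultimately show ?thesis by (simp add: gcomm_def ext_d_zero)
qed

lemma comm_X_d_homogeneous:
  assumes "homogeneous A k \<omega>"
  shows "homogeneous A k (gcomm 1 1 (iota 1 X) (ext_d A) \<omega>)"
proof (rule gcomm_homogeneous)
  show "homogeneous A k (iota 1 X (ext_d A \<omega>))"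
    by (rule iota_homogeneous) (use ext_d_homogeneous[OF assms] in simp)
  show "homogeneous A k (ext_d A (iota 1 X \<omega>))"
  proof (cases k)
    case 0
    then have "iota 1 X \<omega> = (\<lambda>c x J. 0)" using iota_low_degree[OF assms] by simp
    then show ?thesis by (simp add: ext_d_zero homogeneous_zero)
  next
    case (Suc j)
    have "homogeneous A j (iota 1 X \<omega>)" by (rule iota_homogeneous) (use assms Suc in simp)
    then show ?thesis using ext_d_homogeneous Suc by blast
  qed
qed

text \<open>The commutator lowers the degree by two. Degrees 0 and 1 matter because the definition
  of \<open>schouten\<close> quantifies over forms of every degree.\<close>

lemma comm_21_low:
  assumes "homogeneous A k \<omega>" "k < 2"
  shows "comm_21 P X \<omega> = (\<lambda>c x I. 0)"
proof -
  let ?L = "gcomm 2 1 (iota 2 P) (ext_d A)"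
  have "homogeneous A 0 (iota 1 X \<omega>)"
  proof (cases "k = 0")
    case True
    then show ?thesis using iota_low_degree[OF assms(1)] homogeneous_zero by simp
  next
    case False
    then show ?thesis using assms by (intro iota_homogeneous) (simp add: less_2_cases_iff)
  qed
  then have "?L (iota 1 X \<omega>) = (\<lambda>c x I. 0)" by (rule comm_P_d_0)
  moreover have "iota 1 X (?L \<omega>) = (\<lambda>c x I. 0)"
  proof (cases "k = 0")
    case True
    then show ?thesis using comm_P_d_0 assms(1) iota_zero by metis
  next
    case False
    then have "homogeneous A 0 (?L \<omega>)" using assms by (intro comm_P_d_homogeneous) (simp add: less_2_cases_iff)
    then show ?thesis by (rule iota_low_degree) simp
  qed
  ultimately show ?thesis by (simp add: gcomm_def[of 3])
qed

lemma comm_12_low: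
  assumes "homogeneous A k \<omega>" "k < 2"
  shows "comm_12 X P \<omega> = (\<lambda>c x I. 0)"
proof -
  let ?L = "gcomm 1 1 (iota 1 X) (ext_d A)"
  have "?L (iota 2 P \<omega>) = (\<lambda>c x I. 0)"
    unfolding iota_low_degree[OF assms] gcomm_def by (simp add: iota_zero ext_d_zero)
  moreover have "iota 2 P (?L \<omega>) = (\<lambda>c x I. 0)"
    by (rule iota_low_degree[OF comm_X_d_homogeneous[OF assms(1)] assms(2)])
  ultimately show ?thesis by (simp add: gcomm_def[of 2])
qed

lemma iota_X_form:
  assumes "\<omega> \<in> diff_forms A 2"
  shows "iota 1 X \<omega> c y [ib] = X c y [ia] * \<omega> c y [ia, ib]" "iota 1 X \<omega> c y [ia] = - (X c y [ib] * \<omega> c y [ia, ib])"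
  using alternating_ab[OF diff_forms_alt[OF assms], of c y] by (simp_all add: iota_Suc_0)

text \<open>On a 2-form both commutators are, up to sign, the contraction of \<open>P\<close> with
  \<open>d (iota X \<omega>)\<close> minus the derivative along \<open>X\<close> of the contraction
  of \<open>P\<close> with \<open>\<omega>\<close>. After the product rule the derivatives of
  \<open>\<omega>\<close> cancel, leaving a multiple of \<open>\<omega>\<close>, as a contraction
  must.\<close>

lemma comm_values:
  assumes P: "P \<in> multivec A 2" and X: "X \<in> multivec A 1" and \<omega>: "\<omega> \<in> diff_forms A 2"
    and c: "c \<in> A" and x: "x \<in> dom_of c"
  shows "comm_21 P X \<omega> c x [] = sch P X c x * \<omega> c x [ia, ib]"
    "comm_12 X P \<omega> c x [] = - sch P X c x * \<omega> c x [ia, ib]"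
proof -
  let ?X = "\<lambda>i. cpd c i (\<lambda>y. X c y [i] * \<omega> c y [ia, ib]) x"
    and ?P = "\<lambda>i. cpd c i (\<lambda>y. P c y [ia, ib] * \<omega> c y [ia, ib]) x"
  have sm: "smooth (dom_of c) (\<lambda>y. P c y [ia, ib])" "smooth (dom_of c) (\<lambda>y. \<omega> c y [ia, ib])"
    "\<And>i. smooth (dom_of c) (\<lambda>y. X c y [i])"
    using P X \<omega> c by (auto intro: multivec_smooth diff_forms_smooth)
  note altP = multivec_alt[OF P] and alt\<omega> = diff_forms_alt[OF \<omega>]
  have iPw: "(\<lambda>y. iota 2 P \<omega> c y []) = (\<lambda>y. P c y [ia, ib] * \<omega> c y [ia, ib])"
    by (simp add: fun_eq_iff iota_2_form[OF altP alt\<omega>])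
  have dXw: "ext_d A (iota 1 X \<omega>) c x [ia, ib] =
      ?X ia + ?X ib"
    "ext_d A (iota 1 X \<omega>) c x [ib, ia] = - ext_d A (iota 1 X \<omega>) c x [ia, ib]"
    using cpd_minus[OF smooth_mult[OF sm(3) sm(2)] c x x]
    by (simp_all add: ext_d_2[OF c x] iota_X_form[OF \<omega>, unfolded One_nat_def])
  have dPw: "ext_d A (iota 2 P \<omega>) c x [i] = ?P i" for i
    by (simp add: ext_d_1[OF c x] iPw)
  have "comm_21 P X \<omega> c x [] =
      P c x [ia, ib] * (?X ia + ?X ib)
    - (X c x [ia] * ?P ia
      + X c x [ib] * ?P ib)"
    unfolding gcomm_def[of 3]
    by (simp add: iota_Suc_0 gcomm_def[of 2 "Suc 0"] ext_d_0 iota_2[OF altP] dXw[unfolded One_nat_def]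
        ext_d_3[OF \<omega> c x] dPw field_simps)
  then show "comm_21 P X \<omega> c x [] = sch P X c x * \<omega> c x [ia, ib]"
    unfolding sch_def cpd_mult[OF sm(3,2) c x x] cpd_mult[OF sm(1,2) c x x] by (simp add: algebra_simps)
  have "comm_12 X P \<omega> c x [] =
     (X c x [ia] * ?P ia
      + X c x [ib] * ?P ib)
    - P c x [ia, ib] * (?X ia + ?X ib)"
    unfolding gcomm_def[of 2]
    by (simp add: gcomm_def ext_d_0 iota_Suc_0 iota_2[OF altP] dXw[unfolded One_nat_def]
        ext_d_3[OF \<omega> c x] dPw field_simps)
  then show "comm_12 X P \<omega> c x [] = - sch P X c x * \<omega> c x [ia, ib]"
    unfolding sch_def cpd_mult[OF sm(3,2) c x x] cpd_mult[OF sm(1,2) c x x] by (simp add: algebra_simps)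
qed

lemma comm_homogeneous_2:
  assumes "\<omega> \<in> diff_forms A 2"
  shows "homogeneous A 0 (comm_21 P X \<omega>)" "homogeneous A 0 (comm_12 X P \<omega>)"
proof -
  have h: "homogeneous A 2 \<omega>" using assms by (rule diff_forms_homogeneous)
  then have h': "homogeneous A (Suc (Suc 0)) \<omega>" by (simp add: numeral_2_eq_2)
  show "homogeneous A 0 (comm_21 P X \<omega>)"
    by (intro gcomm_homogeneous comm_P_d_homogeneous iota_homogeneous) (use h' comm_P_d_homogeneous[OF h'] in simp_all)
  show "homogeneous A 0 (comm_12 X P \<omega>)"
    by (rule gcomm_homogeneous; (rule comm_X_d_homogeneous)?; rule iota_homogeneous)
      (use h comm_X_d_homogeneous[OF h] in simp_all)
qed

end

section \<open>Existence and uniqueness of the Schouten bracket\<close>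

context volume_surface
begin

text \<open>Testing on \<open>\<mu>\<close> alone decides: its component has no zeros, so
  \<open>iota 2 R \<mu>\<close> determines the component of \<open>R\<close>.\<close>

lemma contraction_unique:
  assumes R: "R \<in> multivec A 2" and T: "\<And>k \<omega>. \<omega> \<in> diff_forms A k \<Longrightarrow> iota 2 R \<omega> = T \<omega>"
  shows "(THE R. R \<in> multivec A 2 \<and> (\<forall>k. \<forall>\<omega>\<in>diff_forms A k. iota 2 R \<omega> = T \<omega>)) = R"
proof (rule the_equality)
  show "R \<in> multivec A 2 \<and> (\<forall>k. \<forall>\<omega>\<in>diff_forms A k. iota 2 R \<omega> = T \<omega>)" using assms by blast
  fix R' assume R': "R' \<in> multivec A 2 \<and> (\<forall>k. \<forall>\<omega>\<in>diff_forms A k. iota 2 R' \<omega> = T \<omega>)"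
  then have eq: "iota 2 R' \<mu> = iota 2 R \<mu>" using T vol_form by metis
  show "R' = R"
  proof (rule alternating_2_eqI)
    fix c x assume c: "c \<in> A" "x \<in> dom_of c"
    have "R' c x [ia, ib] * m c x = R c x [ia, ib] * m c x"
      using fun_cong[OF fun_cong[OF fun_cong[OF eq, of c], of x], of "[]"] R R'
      by (simp add: iota_2_form[OF multivec_alt diff_forms_alt[OF vol_form]])
    then show "R' c x [ia, ib] = R c x [ia, ib]" using m_nz[OF c] by simp
  qed (use R R' multivec_alt in auto)
qed

text \<open>Both sides kill forms of degree below 2, forms of degree above 2 are zero, and in degree
  2 the component \<open>r c x\<close> is read off.\<close>

lemma contraction_bivec:
  assumes R: "bivec r \<in> multivec A 2" and "\<And>k \<omega>. homogeneous A k \<omega> \<Longrightarrow> k < 2 \<Longrightarrow> T \<omega> = (\<lambda>c x I. 0)"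
    and "\<And>\<omega>. \<omega> \<in> diff_forms A 2 \<Longrightarrow> homogeneous A 0 (T \<omega>)"
    and "\<And>\<omega> c x. \<omega> \<in> diff_forms A 2 \<Longrightarrow> c \<in> A \<Longrightarrow> x \<in> dom_of c \<Longrightarrow> T \<omega> c x [] = r c x * \<omega> c x [ia, ib]"
    and \<omega>: "\<omega> \<in> diff_forms A k"
  shows "iota 2 (bivec r) \<omega> = T \<omega>"
proof -
  consider "k < 2" | "k = 2" | "k \<ge> 3" by linarith
  then show ?thesis
  proof cases
    case 1
    then show ?thesis using assms(2) iota_low_degree diff_forms_homogeneous[OF \<omega>] by metis
  next
    case 2
    then have \<omega>2: "\<omega> \<in> diff_forms A 2" using \<omega> by simp
    show ?thesis
    proof (rule homogeneous_ext[OF _ assms(3)[OF \<omega>2]])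
      show "homogeneous A 0 (iota 2 (bivec r) \<omega>)"
        by (rule iota_homogeneous) (use diff_forms_homogeneous[OF \<omega>2] in simp)
      fix c x and I :: "2 list"
      assume "c \<in> A" "x \<in> dom_of c" "length I = 0"
      then show "iota 2 (bivec r) \<omega> c x I = T \<omega> c x I"
        using assms(4)[OF \<omega>2] by (simp add: iota_2_form[OF multivec_alt[OF R] diff_forms_alt[OF \<omega>2]] bivec_ab)
    qed
  next
    case 3
    then have "\<omega> = (\<lambda>c x I. 0)" using alternating_high_zero diff_forms_alt[OF \<omega>] by blast
    then show ?thesis using assms(2)[OF homogeneous_zero[of 0]] iota_zero by simp
  qed
qed

text \<open>The function \<open>g\<close> of the overview, for an arbitrary bivector field. It is
  the value through which bivector fields are identified with functions.\<close>

definition density_of :: "('a, 2) tensor \<Rightarrow> 'a \<Rightarrow> real" where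
  "density_of P = to_fun A (iota 2 P \<mu>)"

lemma density_of_eq:
  "P \<in> multivec A 2 \<Longrightarrow> c \<in> A \<Longrightarrow> x \<in> dom_of c \<Longrightarrow> density_of P x = P c x [ia, ib] * m c x"
  unfolding density_of_def by (rule to_fun_iota_2[OF _ vol_form])

lemma density_of_smooth:
  assumes P: "P \<in> multivec A 2"
  shows "smooth UNIV (density_of P)"
proof (rule smooth_chartwise)
  fix c assume c: "c \<in> A"
  show "smooth (dom_of c) (density_of P)"
    by (rule smooth_cong[OF smooth_mult[OF multivec_smooth[OF P c] m_smooth[OF c]]])
      (rule density_of_eq[OF P c, symmetric])
qed

text \<open>The derivatives of the component of \<open>\<mu>\<close> that come from the divergence
  cancel against those that come from \<open>density_of P\<close>.\<close>

lemma sch_density: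
  assumes P: "P \<in> multivec A 2" and X: "X \<in> multivec A 1" and c: "c \<in> A" and x: "x \<in> dom_of c"
  shows "sch P X c x * m c x = density_of P x * dv X x - act X (density_of P) x"
proof -
  have G: "cpd c i (density_of P) x = cpd c i (\<lambda>y. P c y [ia, ib] * m c y) x" for i
    by (rule cpd_cong[OF c open_dom[OF c] x x]) (rule density_of_eq[OF P c])
  have "density_of P x * dv X x = P c x [ia, ib] * curl c X x"
    using dv_curl[OF X c x] density_of_eq[OF P c x] by (simp add: mult_ac)
  then show ?thesis
    unfolding act_cpd[OF X density_of_smooth[OF P] c x] G sch_def curl_def
      cpd_mult[OF multivec_smooth[OF P c] m_smooth[OF c] c x x]
      cpd_mult[OF m_smooth[OF c] multivec_smooth[OF X c] c x x]
    by (simp add: algebra_simps)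
qed

text \<open>By \<open>sch_density\<close> the product of \<open>sch\<close> with the component of
  \<open>\<mu>\<close> is the same in all charts, which yields the transformation law without
  differentiating a Jacobian. The factor \<open>s\<close> serves both orders of the bracket, as 1
  and as -1.\<close>

lemma sch_multivec:
  assumes P: "P \<in> multivec A 2" and X: "X \<in> multivec A 1"
  shows "bivec (\<lambda>c x. s * sch P X c x) \<in> multivec A 2"
proof (rule bivec_multivec)
  fix c assume c: "c \<in> A"
  show "smooth (dom_of c) (\<lambda>x. s * sch P X c x)"
    by (intro smooth_mult smooth_const open_dom[OF c] sch_smooth[OF P X c])
  fix d x assume d: "d \<in> A" and x: "x \<in> dom_of c" "x \<in> dom_of d"
  have "sch P X d x * m d x = jd c d x * sch P X c x * m d x"
    using sch_density[OF P X c x(1)] sch_density[OF P X d x(2)] m_trans[OF c d x] by (simp add: mult_ac)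
  then show "s * sch P X d x = jd c d x * (s * sch P X c x)" using m_nz[OF d x(2)] by simp
qed

lemma schouten_bivec_vec:
  assumes P: "P \<in> multivec A 2" and X: "X \<in> multivec A 1"
  shows "schouten A 2 1 P X = bivec (\<lambda>c x. 1 * sch P X c x)"
proof -
  have "iota 2 (bivec (\<lambda>c x. 1 * sch P X c x)) \<omega> = comm_21 P X \<omega>" if "\<omega> \<in> diff_forms A k" for k \<omega>
    by (rule contraction_bivec[OF sch_multivec[OF P X] comm_21_low comm_homogeneous_2(1) _ that])
      (simp_all only: comm_values(1)[OF P X] mult_1_left)
  from contraction_unique[OF sch_multivec[OF P X] this] show ?thesis
    unfolding schouten_def by (simp add: numeral_eq_Suc)
qed

lemma schouten_vec_bivec:
  assumes P: "P \<in> multivec A 2" and X: "X \<in> multivec A 1"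
  shows "schouten A 1 2 X P = bivec (\<lambda>c x. - 1 * sch P X c x)"
proof -
  have "iota 2 (bivec (\<lambda>c x. - 1 * sch P X c x)) \<omega> = comm_12 X P \<omega>" if "\<omega> \<in> diff_forms A k" for k \<omega>
    by (rule contraction_bivec[OF sch_multivec[OF P X] comm_12_low comm_homogeneous_2(2) _ that])
      (simp_all only: comm_values(2)[OF P X] mult_minus1)
  from contraction_unique[OF sch_multivec[OF P X] this] show ?thesis
    unfolding schouten_def by (simp add: numeral_eq_Suc)
qed

section \<open>The pairing and the codifferential\<close>

lemma pairing_2:
  assumes P: "P \<in> multivec A 2" and f: "smooth UNIV f"
  shows "pairing A \<mu> 2 (fscale f \<mu>) P = mint (\<lambda>x. f x * density_of P x)"
proof -
  have "to_fun A (iota 2 P (fscale f \<mu>)) x = f x * density_of P x" for x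
  proof -
    obtain c where c: "c \<in> A" "x \<in> dom_of c" by (rule chart_cover)
    show ?thesis
      using to_fun_iota_2[OF P diff_forms_2_fscale[OF vol_form f] c] density_of_eq[OF P c]
      by (simp add: fscale_def)
  qed
  then have "to_fun A (iota 2 P (fscale f \<mu>)) = (\<lambda>x. f x * density_of P x)" by (rule ext)
  then have "pairing A \<mu> 2 (fscale f \<mu>) P = integral_form A \<mu> (fscale (\<lambda>x. f x * density_of P x) \<mu>)"
    by (simp add: pairing_def)
  also have "\<dots> = mint (\<lambda>x. f x * density_of P x)"
    by (rule integral_form_eq_mint[OF smooth_continuous[OF smooth_mult[OF f density_of_smooth[OF P]]]])
  finally show ?thesis .
qed

lemma to_fun_iota_1_smooth:
  assumes X: "X \<in> multivec A 1" and \<eta>: "\<eta> \<in> diff_forms A 1"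
  shows "smooth UNIV (to_fun A (iota 1 X \<eta>))"
proof (rule smooth_chartwise)
  fix c assume c: "c \<in> A"
  have "smooth (dom_of c) (\<lambda>x. X c x [ia] * \<eta> c x [ia] + X c x [ib] * \<eta> c x [ib])"
    by (intro smooth_add smooth_mult multivec_smooth[OF X c] diff_forms_smooth[OF \<eta> c])
  then show "smooth (dom_of c) (to_fun A (iota 1 X \<eta>))"
    by (rule smooth_cong) (rule to_fun_iota_1[OF X \<eta> c, symmetric])
qed

lemma pairing_1:
  assumes X: "X \<in> multivec A 1" and \<eta>: "\<eta> \<in> diff_forms A 1"
  shows "pairing A \<mu> 1 \<eta> X = mint (to_fun A (iota 1 X \<eta>))"
  unfolding pairing_def
  by (rule integral_form_eq_mint[OF smooth_continuous[OF to_fun_iota_1_smooth[OF X \<eta>]]])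

text \<open>The vector field with components \<open>\<rho> * \<zeta> i\<close> in the chart
  \<open>c\<close>, carried to other charts by the Jacobian and set to 0 outside
  \<open>dom_of c\<close>.\<close>

definition local_field :: "('a, 2) chart \<Rightarrow> ('a \<Rightarrow> real) \<Rightarrow> (2 \<Rightarrow> 'a \<Rightarrow> real) \<Rightarrow> ('a, 2) tensor" where
  "local_field c \<rho> \<zeta> = (\<lambda>d x J. if d \<in> A \<and> x \<in> dom_of d \<and> x \<in> dom_of c \<and> length J = 1
     then \<rho> x * (jac c d x (hd J) ia * \<zeta> ia x + jac c d x (hd J) ib * \<zeta> ib x) else 0)"

text \<open>Smoothness is checked on the overlap with \<open>dom_of c\<close> and on the complement
  of \<open>K\<close>, where the field is 0. The transformation law is the chain rule for
  Jacobians.\<close>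

lemma local_field_multivec:
  assumes c: "c \<in> A" and \<rho>: "smooth UNIV \<rho>" "compact K" "K \<subseteq> dom_of c" "\<And>x. x \<notin> K \<Longrightarrow> \<rho> x = 0"
    and \<zeta>: "\<And>i. smooth (dom_of c) (\<zeta> i)"
  shows "local_field c \<rho> \<zeta> \<in> multivec A 1"
proof (rule multivec_1I)
  show "homogeneous A 1 (local_field c \<rho> \<zeta>)" by (auto simp: homogeneous_def local_field_def)
  fix d assume d: "d \<in> A"
  show "smooth (dom_of d) (\<lambda>x. local_field c \<rho> \<zeta> d x [j])" for j
  proof (rule smooth_localI)
    fix x assume x: "x \<in> dom_of d"
    show "\<exists>V. x \<in> V \<and> V \<subseteq> dom_of d \<and> smooth V (\<lambda>x. local_field c \<rho> \<zeta> d x [j])"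
    proof (cases "x \<in> K")
      case True
      let ?V = "dom_of c \<inter> dom_of d"
      have V: "open ?V" using open_dom[OF c] open_dom[OF d] by blast
      have J: "smooth ?V (\<lambda>x. jac c d x j k)" for k
        unfolding jac_cpd
        by (rule smooth_cpd[OF smooth_subset[OF smooth_coord[OF d] V] c]) simp_all
      have \<zeta>V: "smooth ?V (\<zeta> k)" for k by (rule smooth_subset[OF \<zeta> V]) simp
      have "smooth ?V (\<lambda>x. \<rho> x * (jac c d x j ia * \<zeta> ia x + jac c d x j ib * \<zeta> ib x))"
        by (intro smooth_mult smooth_add J \<zeta>V smooth_subset[OF \<rho>(1) V]) simp
      then have "smooth ?V (\<lambda>x. local_field c \<rho> \<zeta> d x [j])"
        by (rule smooth_cong) (simp add: local_field_def d)
      then show ?thesis using True x \<rho>(3) by (intro exI[of _ ?V]) auto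
    next
      case False
      let ?V = "dom_of d \<inter> - K"
      have V: "open ?V" using open_dom[OF d] compact_imp_closed[OF \<rho>(2)] by auto
      have "smooth ?V (\<lambda>x. local_field c \<rho> \<zeta> d x [j])"
        by (rule smooth_cong[OF smooth_const[OF V, of 0]]) (simp add: local_field_def \<rho>(4))
      then show ?thesis using False x by (intro exI[of _ ?V]) auto
    qed
  qed
  fix e x j assume e: "e \<in> A" and x: "x \<in> dom_of d" "x \<in> dom_of e"
  show "local_field c \<rho> \<zeta> e x [j]
    = jac d e x j ia * local_field c \<rho> \<zeta> d x [ia] + jac d e x j ib * local_field c \<rho> \<zeta> d x [ib]"
  proof (cases "x \<in> dom_of c")
    case True
    show ?thesis
      using d e x True jac_chain[OF c d e True x, of j] by (simp add: local_field_def sum_ab algebra_simps)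
  qed (simp add: local_field_def)
qed

text \<open>The test field is a bump function times the difference of the two forms, its index
  raised by the Euclidean metric of a chart. The difference of the pairings is then the integral of
  the bump times a sum of squares, so the forms agree at the point.\<close>

lemma pairing_1_nondegenerate:
  assumes \<eta>: "\<eta> \<in> diff_forms A 1" and \<theta>: "\<theta> \<in> diff_forms A 1"
    and eq: "\<And>X. X \<in> multivec A 1 \<Longrightarrow> pairing A \<mu> 1 \<eta> X = pairing A \<mu> 1 \<theta> X"
  shows "\<eta> = \<theta>"
proof (rule homogeneous_ext[OF diff_forms_homogeneous[OF \<eta>] diff_forms_homogeneous[OF \<theta>]])
  fix c x0 and I :: "2 list"
  assume c: "c \<in> A" and x0: "x0 \<in> dom_of c" and "length I = 1"
  then obtain i where I: "I = [i]" by (auto simp: length_Suc_conv)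
  obtain \<rho> K where \<rho>: "smooth UNIV \<rho>" "compact K" "K \<subseteq> dom_of c" "\<And>x. x \<notin> K \<Longrightarrow> \<rho> x = 0"
    "\<And>x. 0 \<le> \<rho> x" "\<rho> x0 > 0" using bump[OF c x0] by blast
  define \<zeta> where "\<zeta> i x = \<eta> c x [i] - \<theta> c x [i]" for i x
  define X where "X = local_field c \<rho> \<zeta>"
  have X: "X \<in> multivec A 1"
    unfolding X_def
  proof (rule local_field_multivec[OF c \<rho>(1-4)])
    show "smooth (dom_of c) (\<zeta> i)" for i
      unfolding \<zeta>_def[abs_def] by (intro smooth_diff diff_forms_smooth[OF \<eta> c] diff_forms_smooth[OF \<theta> c])
  qed
  have Xc: "X c x [j] = \<rho> x * \<zeta> j x" if "x \<in> dom_of c" for x j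
    using that c ab_cases[of j] by (auto simp: X_def local_field_def jac_self)
  let ?s = "\<lambda>\<eta>. to_fun A (iota 1 X \<eta>)"
  define h where "h x = ?s \<eta> x - ?s \<theta> x" for x
  have h_smooth: "smooth UNIV h"
    unfolding h_def[abs_def] by (intro smooth_diff to_fun_iota_1_smooth X \<eta> \<theta>)
  have h_c: "h x = \<rho> x * ((\<zeta> ia x)\<^sup>2 + (\<zeta> ib x)\<^sup>2)" if "x \<in> dom_of c" for x
    unfolding h_def to_fun_iota_1[OF X \<eta> c that] to_fun_iota_1[OF X \<theta> c that] Xc[OF that]
    by (simp add: \<zeta>_def power2_eq_square algebra_simps)
  have h_0: "h x = 0" if "x \<notin> K" for x
  proof -
    obtain d where d: "d \<in> A" "x \<in> dom_of d" by (rule chart_cover)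
    have "X d x [j] = 0" for j using \<rho>(4)[OF that] by (simp add: X_def local_field_def)
    then show ?thesis unfolding h_def to_fun_iota_1[OF X \<eta> d] to_fun_iota_1[OF X \<theta> d] by simp
  qed
  have "mint (?s \<eta>) = mint (\<lambda>x. ?s \<theta> x + h x)" by (simp add: h_def)
  also have "\<dots> = mint (?s \<theta>) + mint h"
    by (intro mint_add smooth_continuous to_fun_iota_1_smooth X \<theta> h_smooth)
  finally have "mint h = 0" using eq[OF X] pairing_1[OF X \<eta>] pairing_1[OF X \<theta>] by simp
  moreover have "0 \<le> h x" for x
  proof (cases "x \<in> K")
    case True
    then have "x \<in> dom_of c" using \<rho>(3) by blast
    then show ?thesis using h_c \<rho>(5) by simp
  qed (simp add: h_0)
  ultimately have "h x0 = 0"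
    by (intro mint_eq_0_nonneg[OF c \<rho>(2,3) smooth_continuous[OF h_smooth] h_0])
  then have "(\<zeta> ia x0)\<^sup>2 + (\<zeta> ib x0)\<^sup>2 = 0" using h_c[OF x0] \<rho>(6) by simp
  then have "\<zeta> ia x0 = 0 \<and> \<zeta> ib x0 = 0" by (simp add: sum_power2_eq_zero_iff)
  then show "\<eta> c x0 I = \<theta> c x0 I" using ab_cases[of i] by (auto simp: I \<zeta>_def)
qed

abbreviation codiff_form :: "('a, 2) tensor \<Rightarrow> ('a \<Rightarrow> real) \<Rightarrow> ('a, 2) tensor" where
  "codiff_form P f \<equiv>
     - (fscale f (ext_d A (of_fun A (density_of P))) + ext_d A (of_fun A (f * density_of P)))"

lemma codiff_eq:
  assumes P: "P \<in> multivec A 2" and f: "smooth UNIV f"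
  shows "codiff A \<mu> P 1 (fscale f \<mu>) = codiff_form P f" (is "_ = ?\<gamma>")
    and "codiff_form P f \<in> diff_forms A 1"
proof -
  let ?G = "density_of P"
  note G = density_of_smooth[OF P]
  have fG: "smooth UNIV (f * ?G)"
    using smooth_mult[OF f G] by (simp add: times_fun_def)
  show \<gamma>: "?\<gamma> \<in> diff_forms A 1"
    by (intro diff_forms_1_uminus diff_forms_1_add diff_forms_1_fscale ext_d_of_fun_form f G fG)
  have pair: "pairing A \<mu> 2 (fscale f \<mu>) (schouten A 2 1 P X) = pairing A \<mu> 1 ?\<gamma> X"
    if X: "X \<in> multivec A 1" for X
  proof -
    have R: "schouten A 2 1 P X \<in> multivec A 2"
      unfolding schouten_bivec_vec[OF P X] by (rule sch_multivec[OF P X])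
    have dR: "density_of (schouten A 2 1 P X) x = ?G x * dv X x - act X ?G x" for x
    proof -
      obtain c where c: "c \<in> A" "x \<in> dom_of c" by (rule chart_cover)
      show ?thesis
        using density_of_eq[OF R c] sch_density[OF P X c] unfolding schouten_bivec_vec[OF P X]
        by (simp add: bivec_ab c)
    qed
    have s\<gamma>: "to_fun A (iota 1 X ?\<gamma>) x = - (f x * act X ?G x + act X (f * ?G) x)" for x
    proof -
      obtain c where c: "c \<in> A" "x \<in> dom_of c" by (rule chart_cover)
      show ?thesis
        unfolding to_fun_iota_1[OF X \<gamma> c] act_cpd[OF X G c] act_cpd[OF X fG c]
        by (simp add: fscale_def ext_d_of_fun c algebra_simps)
    qed
    \<comment> \<open>Adding and subtracting \<open>X (f g)\<close> splits
      \<open>f (g div X - X g)\<close> into the contraction of \<open>X\<close> with the claimed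
      form and the divergence of \<open>f g X\<close>, which integrates to 0.\<close>
    have "(\<lambda>x. f x * density_of (schouten A 2 1 P X) x)
        = (\<lambda>x. to_fun A (iota 1 X ?\<gamma>) x + ((f * ?G) x * dv X x + act X (f * ?G) x))"
      unfolding dR s\<gamma> by (simp add: fun_eq_iff algebra_simps)
    then have "pairing A \<mu> 2 (fscale f \<mu>) (schouten A 2 1 P X)
        = mint (\<lambda>x. to_fun A (iota 1 X ?\<gamma>) x + ((f * ?G) x * dv X x + act X (f * ?G) x))"
      unfolding pairing_2[OF R f] by (rule arg_cong)
    also have "\<dots> = mint (to_fun A (iota 1 X ?\<gamma>)) + mint (\<lambda>x. (f * ?G) x * dv X x + act X (f * ?G) x)"
      by (intro mint_add smooth_continuous to_fun_iota_1_smooth[OF X \<gamma>]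
          smooth_add[OF smooth_mult[OF fG dv_smooth[OF X]] act_smooth[OF X fG]])
    also have "\<dots> = pairing A \<mu> 1 ?\<gamma> X"
      unfolding divergence_theorem[OF X fG] pairing_1[OF X \<gamma>] by simp
    finally show ?thesis .
  qed
  show "codiff A \<mu> P 1 (fscale f \<mu>) = ?\<gamma>"
    unfolding codiff_def one_add_one
  proof (rule the_equality)
    show "?\<gamma> \<in> diff_forms A 1 \<and> (\<forall>X\<in>multivec A 1.
        pairing A \<mu> 2 (fscale f \<mu>) (schouten A 2 1 P X) = pairing A \<mu> 1 ?\<gamma> X)"
      using \<gamma> pair by blast
    fix \<gamma>' assume "\<gamma>' \<in> diff_forms A 1 \<and> (\<forall>X\<in>multivec A 1.
        pairing A \<mu> 2 (fscale f \<mu>) (schouten A 2 1 P X) = pairing A \<mu> 1 \<gamma>' X)"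
    then show "\<gamma>' = ?\<gamma>" using pairing_1_nondegenerate[OF _ \<gamma>] pair by metis
  qed
qed

end

section \<open>Weighted area functionals and their gradients\<close>

context volume_surface
begin

definition weighted :: "('a \<Rightarrow> real) \<Rightarrow> ('a, 2) tensor \<Rightarrow> real" where
  "weighted f P = mint (\<lambda>x. f x * density_of P x)"

text \<open>\<open>k\<close> selects those coordinates that describe the point, for instance among
  the infinitely many coordinates of a jet.\<close>

lemma smooth_fun_chart_pullback:
  assumes c: "c \<in> A" and h: "smooth (dom_of c) h"
  shows "C_k n {v. (\<chi> i. v (k i)) \<in> img_of c} (\<lambda>v. h (chart_inv c (\<chi> i. v (k i))))"
    and "open {v :: 'j \<Rightarrow> real. (\<chi> i. v (k i)) \<in> img_of c}"
proof -
  have "continuous_on UNIV (\<lambda>v :: 'j \<Rightarrow> real. \<chi> i. v (k i))"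
    by (intro continuous_on_vec_lambda continuous_on_product_coordinates)
  then have "open ((\<lambda>v :: 'j \<Rightarrow> real. \<chi> i. v (k i)) -` img_of c)"
    using open_img[OF c] by (simp add: open_vimage)
  then show op: "open {v :: 'j \<Rightarrow> real. (\<chi> i. v (k i)) \<in> img_of c}" by (simp add: vimage_def)
  show "C_k n {v. (\<chi> i. v (k i)) \<in> img_of c} (\<lambda>v. h (chart_inv c (\<chi> i. v (k i))))"
    by (rule C_k_compose[OF op open_cvec[OF c open_dom[OF c]] smooth_C_k[OF h c], where G = "\<lambda>v i. v (k i)"])
      (auto intro: C_k_coord)
qed

lemma weighted_local_functional:
  assumes f: "smooth UNIV f"
  shows "weighted f \<in> local_functionals A \<mu>"
proof -
  \<comment> \<open>A jet carries a class of bivector fields. Any representative gives the same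
    value, since the 0-jet already fixes the components at \<open>x\<close>.\<close>
  define j where "j = (\<lambda>(x, S). f x * density_of (SOME \<sigma>. \<sigma> \<in> S) x)"
  have j_jet: "j (jet A 0 P x) = f x * density_of P x" if P: "P \<in> multivec A 2" for P x
  proof -
    define \<sigma> where "\<sigma> = (SOME \<sigma>. \<sigma> \<in> snd (jet A 0 P x))"
    have "P \<in> snd (jet A 0 P x)" using P by (simp add: jet_def)
    then have "\<sigma> \<in> snd (jet A 0 P x)" unfolding \<sigma>_def by (metis someI)
    then have \<sigma>: "\<sigma> \<in> multivec A 2" "\<And>c. c \<in> A \<Longrightarrow> x \<in> dom_of c \<Longrightarrow> jet_coords 0 c \<sigma> x = jet_coords 0 c P x"
      by (auto simp: jet_def)
    obtain c where c: "c \<in> A" "x \<in> dom_of c" by (rule chart_cover)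
    have "jet_coords 0 c \<sigma> x (Inr ([ia, ib], [])) = jet_coords 0 c P x (Inr ([ia, ib], []))"
      using \<sigma>(2)[OF c] by simp
    then have "\<sigma> c x [ia, ib] = P c x [ia, ib]" using c by (simp add: jet_coords_def)
    then have "density_of \<sigma> x = density_of P x" using density_of_eq[OF \<sigma>(1) c] density_of_eq[OF P c] by simp
    then show ?thesis by (simp add: j_def \<sigma>_def jet_def)
  qed
  have "smooth_on_jets A 0 j"
    unfolding smooth_on_jets_def
  proof
    fix c assume c: "c \<in> A"
    let ?p = "\<lambda>v :: 2 + 2 list \<times> 2 list \<Rightarrow> real. chart_inv c (\<chi> i. v (Inl i))"
    \<comment> \<open>\<open>Inr ([ia, ib], [])\<close> is the coordinate that holds the component
      itself, differentiated zero times.\<close>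
    let ?F = "\<lambda>v. (f (?p v) * m c (?p v)) * v (Inr ([ia, ib], []))"
    have fm: "smooth (dom_of c) (\<lambda>x. f x * m c x)"
      by (intro smooth_mult m_smooth[OF c] smooth_subset[OF f open_dom[OF c]]) simp
    have "smooth_fun {v. (\<chi> i. v (Inl i)) \<in> img_of c} ?F"
      unfolding smooth_fun_iff
      using smooth_fun_chart_pullback[OF c fm, where k = Inl] by (auto intro!: C_k_mult[OF _ _ C_k_coord])
    moreover have "j (jet A 0 P x) = ?F (jet_coords 0 c P x)" if "x \<in> dom_of c" "P \<in> multivec A 2" for x P
      using that c by (simp add: j_jet density_of_eq[OF that(2) c that(1)] jet_coords_def vec_nth_inverse)
    ultimately show "\<exists>F. smooth_fun {v. (\<chi> i. v (Inl i)) \<in> img_of c} F \<and>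
        (\<forall>x\<in>dom_of c. \<forall>\<pi>\<in>multivec A 2. j (jet A 0 \<pi> x) = F (jet_coords 0 c \<pi> x))" by blast
  qed
  moreover have "weighted f P = integral_form A \<mu> (fscale (\<lambda>x. j (jet A 0 P x)) \<mu>)" if "P \<in> multivec A 2" for P
    unfolding j_jet[OF that] weighted_def
    by (rule integral_form_eq_mint[symmetric, OF smooth_continuous[OF smooth_mult[OF f density_of_smooth[OF that]]]])
  ultimately show ?thesis unfolding local_functionals_def by blast
qed

text \<open>Smoothness jointly in time, the coordinate \<open>None\<close>, and position is
  converted into the facts that the Leibniz rule consumes.\<close>

lemma smooth_family_chart:
  assumes \<Theta>: "smooth_family A \<Theta>" and c: "c \<in> A"
  shows "x \<in> dom_of c \<Longrightarrow> ((\<lambda>s. \<Theta> s c x I) has_real_derivative deriv (\<lambda>s. \<Theta> s c x I) t) (at t)"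
    and "continuous_on (UNIV \<times> img_of c) (\<lambda>(t, u). \<Theta> t c (chart_inv c u) I)"
    and "continuous_on (UNIV \<times> img_of c) (\<lambda>(t, u). deriv (\<lambda>s. \<Theta> s c (chart_inv c u) I) t)"
proof -
  let ?S = "{v :: 2 option \<Rightarrow> real. (\<chi> i. v (Some i)) \<in> img_of c}"
  define H where "H v = \<Theta> (v None) c (chart_inv c (\<chi> i. v (Some i))) I" for v :: "2 option \<Rightarrow> real"
  define \<iota> where "\<iota> t u = (\<lambda>k. case k of None \<Rightarrow> t | Some i \<Rightarrow> u $ i)" for t and u :: "real^2"
  define \<Theta>' where "\<Theta>' t x = partial None H (\<iota> t (snd c x))" for t x
  have "smooth_fun ?S H" using \<Theta> c unfolding smooth_family_def H_def[abs_def] by blast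
  then have H: "C_k 1 ?S H" unfolding smooth_fun_iff by blast
  have \<iota>: "(\<chi> i. \<iota> t u (Some i)) = u" "\<iota> t u None = t" "(\<iota> t u)(None := s) = \<iota> s u" for t u s
    by (auto simp: \<iota>_def fun_eq_iff vec_eq_iff split: option.splits)
  have \<iota>_cont: "continuous_on X (\<lambda>(t, u). \<iota> t u)" for X
    unfolding split_def \<iota>_def
  proof (rule continuous_on_coordinatewise_then_product)
    fix k
    show "continuous_on X (\<lambda>x. case k of None \<Rightarrow> fst x | Some i \<Rightarrow> snd x $ i)"
      by (cases k) (auto intro!: continuous_intros)
  qed
  have compose: "continuous_on (UNIV \<times> img_of c) (\<lambda>(t, u). g (\<iota> t u))" if "continuous_on ?S g" for g
  proof -
    have "(\<lambda>(t, u). \<iota> t u) ` (UNIV \<times> img_of c) \<subseteq> ?S" by (auto simp: \<iota>)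
    from continuous_on_compose2[OF that \<iota>_cont this] show ?thesis by (simp add: split_def)
  qed
  have D: "((\<lambda>s. \<Theta> s c x I) has_real_derivative \<Theta>' t x) (at t)" if x: "x \<in> dom_of c" for t x
  proof -
    have "\<iota> t (snd c x) \<in> ?S" using x by (simp add: \<iota>)
    from has_partial[OF H[unfolded One_nat_def] this, of None] show ?thesis
      unfolding \<Theta>'_def \<iota> H_def using c x by simp
  qed
  have D_eq: "deriv (\<lambda>s. \<Theta> s c x I) t = \<Theta>' t x" if "x \<in> dom_of c" for t x
    by (rule DERIV_imp_deriv[OF D[OF that]])
  show "((\<lambda>s. \<Theta> s c x I) has_real_derivative deriv (\<lambda>s. \<Theta> s c x I) t) (at t)" if x: "x \<in> dom_of c"
    using D[OF x] D_eq[OF x] by simp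
  show "continuous_on (UNIV \<times> img_of c) (\<lambda>(t, u). \<Theta> t c (chart_inv c u) I)"
    using compose[of H] C_k_continuous[OF H] by (simp add: H_def \<iota>)
  have "continuous_on (UNIV \<times> img_of c) (\<lambda>(t, u). partial None H (\<iota> t u))"
    by (rule compose) (use H in simp)
  then show "continuous_on (UNIV \<times> img_of c) (\<lambda>(t, u). deriv (\<lambda>s. \<Theta> s c (chart_inv c u) I) t)"
    by (rule continuous_on_cong[THEN iffD1, rotated 2]) (use c in \<open>auto simp: D_eq \<Theta>'_def\<close>)
qed

text \<open>The functional is linear in the bivector field, so the substance is the exchange of time
  derivative and integral, done in each chart of a partition of unity. For the velocity of the
  family, antisymmetry and continuity of its component suffice to evaluate the pairing.\<close>

lemma weighted_gradient:
  assumes f: "smooth UNIV f"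
  shows "gradient A \<mu> (weighted f) P (fscale f \<mu>)"
  unfolding gradient_def
proof (intro conjI allI impI)
  show "fscale f \<mu> \<in> diff_forms A 2" by (rule diff_forms_2_fscale[OF vol_form f])
  fix \<Theta>
  assume "smooth_family A \<Theta> \<and> \<Theta> 0 = P"
  then have \<Theta>: "smooth_family A \<Theta>" by simp
  then have \<Theta>_mv: "\<Theta> t \<in> multivec A 2" for t by (simp add: smooth_family_def)
  define D where "D x = deriv (\<lambda>t. density_of (\<Theta> t) x) 0" for x
  let ?V = "\<lambda>c x I. deriv (\<lambda>t. \<Theta> t c x I) 0"
  have V_D: "?V c x [ia, ib] * m c x = D x" if c: "c \<in> A" and x: "x \<in> dom_of c" for c x
  proof -
    have "((\<lambda>t. density_of (\<Theta> t) x) has_real_derivative ?V c x [ia, ib] * m c x) (at 0)"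
      unfolding density_of_eq[OF \<Theta>_mv c x] by (rule DERIV_cmult_right[OF smooth_family_chart(1)[OF \<Theta> c x]])
    then show ?thesis unfolding D_def by (simp only: DERIV_imp_deriv)
  qed
  have D_cont: "continuous_on UNIV (\<lambda>x. f x * D x)"
  proof -
    have "continuous_on (dom_of c) (\<lambda>x. f x * D x)" if c: "c \<in> A" for c
    proof -
      have "continuous_on (dom_of c) (\<lambda>x. (0 :: real, snd c x))"
        by (intro continuous_on_Pair continuous_on_const continuous_chart[OF c])
      from continuous_on_compose2[OF smooth_family_chart(3)[OF \<Theta> c, where I = "[ia, ib]"] this]
      have "continuous_on (dom_of c) (\<lambda>x. ?V c (chart_inv c (snd c x)) [ia, ib])" by (auto simp: split_def)
      then have "continuous_on (dom_of c) (\<lambda>x. f x * (?V c (chart_inv c (snd c x)) [ia, ib] * m c x))"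
        by (intro continuous_on_mult continuous_on_subset[OF smooth_continuous[OF f]]
            smooth_continuous[OF m_smooth[OF c]]) simp_all
      then show ?thesis
        by (rule continuous_on_cong[THEN iffD1, rotated 2]) (simp_all add: c V_D[OF c])
    qed
    then have "continuous_on (\<Union>c\<in>A. dom_of c) (\<lambda>x. f x * D x)"
      by (intro continuous_on_open_UN open_dom) auto
    moreover have "(\<Union>c\<in>A. dom_of c) = UNIV" using chart_cover by blast
    ultimately show ?thesis by simp
  qed
  have "to_fun A (iota 2 ?V (fscale f \<mu>)) x = f x * D x" for x
  proof (rule to_fun_eq)
    fix c assume c: "c \<in> A" "x \<in> dom_of c"
    have alt: "\<Theta> t c x [ib, ia] = - \<Theta> t c x [ia, ib]" for t
      by (rule alternating_ab(1)[OF multivec_alt[OF \<Theta>_mv]])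
    have "?V c x [ib, ia] = - ?V c x [ia, ib]"
      unfolding alt by (rule DERIV_imp_deriv[OF DERIV_minus[OF smooth_family_chart(1)[OF \<Theta> c]]])
    then have "iota 2 ?V (fscale f \<mu>) c x [] = f x * (?V c x [ia, ib] * m c x)"
      using alternating_ab[OF diff_forms_alt[OF vol_form], of c x] by (simp add: iota_def sum_length_2 fscale_def)
    then show "iota 2 ?V (fscale f \<mu>) c x [] = f x * D x" by (simp only: V_D[OF c])
  qed
  then have "to_fun A (iota 2 ?V (fscale f \<mu>)) = (\<lambda>x. f x * D x)" by (rule ext)
  then have pair: "pairing A \<mu> 2 (fscale f \<mu>) ?V = mint (\<lambda>x. f x * D x)"
    unfolding pairing_def by (simp only: integral_form_eq_mint[OF D_cont])
  obtain C \<rho> where C: "partition_of_unity A C \<rho>" by (rule partition_of_unity_exists)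
  have der: "((\<lambda>t. cint c (\<lambda>x. \<rho> c x * (f x * density_of (\<Theta> t) x * \<bar>m c x\<bar>))) has_real_derivative
      cint c (\<lambda>x. \<rho> c x * (f x * D x * \<bar>m c x\<bar>))) (at 0)" if cC: "c \<in> C" for c
  proof -
    note Pc = partition_support[OF C cC]
    let ?K = "supp (\<rho> c)" and ?U = "img_of c"
    have c: "c \<in> A" by (rule Pc(1))
    let ?\<theta> = "\<lambda>t x. \<Theta> t c x [ia, ib]"
    let ?\<theta>' = "\<lambda>t x. deriv (\<lambda>s. \<Theta> s c x [ia, ib]) t"
    note \<Theta>' = smooth_family_chart[OF \<Theta> c, where I = "[ia, ib]"]
    \<comment> \<open>The factor \<open>m c\<close> stems from \<open>density_of\<close>, its
      absolute value from the density of integration.\<close>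
    define B where "B x = \<rho> c x * (f x * m c x * \<bar>m c x\<bar>)" for x
    have B_cont: "continuous_on (dom_of c) B"
      unfolding B_def[abs_def]
      by (intro continuous_on_mult Pc(3) w_cont[OF c] smooth_continuous[OF m_smooth[OF c]]
          continuous_on_subset[OF smooth_continuous[OF f]]) simp
    have B_0: "B x = 0" if "x \<notin> ?K" for x unfolding B_def Pc(6)[OF that] by simp
    note S = chart_support[OF c Pc(4,5) B_cont B_0]
    let ?L = "snd c ` ?K"
    \<comment> \<open>Extension by 0 gives a function continuous in time and in all coordinates,
      which can be integrated over a fixed box around the support of
      \<open>\<rho> c\<close>.\<close>
    let ?q = "\<lambda>\<psi> t u. if u \<in> ?U then B (chart_inv c u) * \<psi> t (chart_inv c u) else 0"
    have q_cont: "continuous_on (UNIV \<times> X) (\<lambda>(t, u). ?q \<psi> t u)"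
      if "continuous_on (UNIV \<times> ?U) (\<lambda>(t, u). \<psi> t (chart_inv c u))" for \<psi> :: "real \<Rightarrow> 'a \<Rightarrow> real" and X
    proof -
      have "continuous_on (UNIV \<times> ?U) (\<lambda>z. B (chart_inv c (snd z)) * (case z of (t, u) \<Rightarrow> \<psi> t (chart_inv c u)))"
        by (intro continuous_on_mult that continuous_on_compose2[OF S(3) continuous_on_snd]) auto
      then have "continuous_on UNIV (\<lambda>z :: real \<times> (real^2). if z \<in> UNIV \<times> ?U
          then B (chart_inv c (snd z)) * (case z of (t, u) \<Rightarrow> \<psi> t (chart_inv c u)) else 0)"
      proof (rule continuous_on_zero_ext[rotated 3])
        show "open (UNIV \<times> ?U)" "closed (UNIV \<times> ?L)" "UNIV \<times> ?L \<subseteq> UNIV \<times> ?U"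
          using open_img[OF c] compact_imp_closed[OF S(1)] S(2) by (blast intro: open_Times closed_Times)+
        fix z :: "real \<times> (real^2)"
        assume "z \<in> UNIV \<times> ?U" "z \<notin> UNIV \<times> ?L"
        then have "snd z \<in> ?U" "snd z \<notin> ?L" by (simp_all only: mem_Times_iff UNIV_I simp_thms not_False_eq_True)
        then have "B (chart_inv c (snd z)) = 0" by (intro S(4))
        then show "B (chart_inv c (snd z)) * (case z of (t, u) \<Rightarrow> \<psi> t (chart_inv c u)) = 0" by simp
      qed
      then have "continuous_on UNIV (\<lambda>(t, u). ?q \<psi> t u)"
        by (rule continuous_on_cong[THEN iffD1, rotated 2]) (auto split: if_splits)
      then show ?thesis using continuous_on_subset by blast
    qed
    obtain a where a: "?L \<subseteq> cbox (- a) a"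
      using bounded_subset_cbox_symmetric compact_imp_bounded[OF S(1)] by metis
    have to_cint: "integral (cbox (- a) a) (?q \<psi> t) = cint c (\<lambda>x. B x * \<psi> t x)" for \<psi> :: "real \<Rightarrow> 'a \<Rightarrow> real" and t
    proof -
      have "integral (cbox (- a) a) (?q \<psi> t) = integral UNIV (?q \<psi> t)"
      proof (rule integral_subset_eq)
        fix u assume "u \<notin> cbox (- a) a"
        then have "u \<notin> ?L" using a by blast
        then show "?q \<psi> t u = 0" using S(4)[of u] by simp
      qed simp
      then show ?thesis by (simp add: cint_def integral_restrict_UNIV)
    qed
    have "((\<lambda>t. integral (cbox (- a) a) (?q ?\<theta> t)) has_real_derivative
        integral (cbox (- a) a) (?q ?\<theta>' 0)) (at 0 within UNIV)"
    proof (rule leibniz_rule_field_derivative[where f = "?q ?\<theta>" and fx = "?q ?\<theta>'"])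
      show "((\<lambda>t. ?q ?\<theta> t u) has_real_derivative ?q ?\<theta>' t u) (at t within UNIV)" for t u
      proof (cases "u \<in> ?U")
        case True
        then have "chart_inv c u \<in> dom_of c" using c by simp
        from DERIV_cmult[OF \<Theta>'(1)[OF this]] True show ?thesis by simp
      qed simp
      show "?q ?\<theta> t integrable_on cbox (- a) a" for t
      proof -
        have "continuous_on (cbox (- a) a) (\<lambda>u. (t, u))" by (intro continuous_intros)
        from continuous_on_compose2[OF q_cont[OF \<Theta>'(2), of UNIV] this]
        have "continuous_on (cbox (- a) a) (?q ?\<theta> t)" by simp
        then show ?thesis by (rule integrable_continuous)
      qed
      show "continuous_on (UNIV \<times> cbox (- a) a) (\<lambda>(t, u). ?q ?\<theta>' t u)" by (rule q_cont[OF \<Theta>'(3)])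
    qed auto
    then have "((\<lambda>t. cint c (\<lambda>x. B x * \<Theta> t c x [ia, ib])) has_real_derivative cint c (\<lambda>x. B x * ?\<theta>' 0 x)) (at 0)"
      by (simp only: to_cint[of ?\<theta>] to_cint[of ?\<theta>'])
    moreover have "cint c (\<lambda>x. B x * \<Theta> t c x [ia, ib]) = cint c (\<lambda>x. \<rho> c x * (f x * density_of (\<Theta> t) x * \<bar>m c x\<bar>))" for t
      by (rule cint_cong[OF _ c]) (simp add: B_def density_of_eq[OF \<Theta>_mv c])
    moreover have "cint c (\<lambda>x. B x * ?\<theta>' 0 x) = cint c (\<lambda>x. \<rho> c x * (f x * D x * \<bar>m c x\<bar>))"
      by (rule cint_cong[OF _ c]) (simp add: B_def V_D[OF c, symmetric])
    ultimately show ?thesis by simp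
  qed
  have "weighted f (\<Theta> t) = (\<Sum>c\<in>C. cint c (\<lambda>x. \<rho> c x * (f x * density_of (\<Theta> t) x * \<bar>m c x\<bar>)))" for t
    unfolding weighted_def
    by (rule mint_eq[OF C smooth_continuous[OF smooth_mult[OF f density_of_smooth[OF \<Theta>_mv]]]])
  then show "((\<lambda>t. weighted f (\<Theta> t)) has_real_derivative pairing A \<mu> 2 (fscale f \<mu>) ?V) (at 0)"
    unfolding pair mint_eq[OF C D_cont] using DERIV_sum[OF der] by simp
qed

end

section \<open>Poisson vector fields\<close>

lemma sharp_uminus: "sharp P (- \<alpha>) = - sharp P \<alpha>"
  by (auto simp: sharp_def fun_eq_iff sum_negf split: list.split)

context volume_surface
begin

lemma sharp_ab:
  assumes "P \<in> multivec A 2"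
  shows "sharp P \<alpha> c x [ia] = - (P c x [ia, ib] * \<alpha> c x [ib])" "sharp P \<alpha> c x [ib] = P c x [ia, ib] * \<alpha> c x [ia]"
  using alternating_ab[OF multivec_alt[OF assms], of c x] by (simp_all add: sharp_def sum_ab)

lemma sharp_multivec:
  assumes P: "P \<in> multivec A 2" and \<alpha>: "\<alpha> \<in> diff_forms A 1"
  shows "sharp P \<alpha> \<in> multivec A 1"
proof (rule multivec_1I)
  show "homogeneous A 1 (sharp P \<alpha>)"
    unfolding homogeneous_def
  proof (intro allI impI)
    fix c x J
    assume nz: "sharp P \<alpha> c x J \<noteq> 0"
    then obtain j where J: "J = [j]" by (auto simp: sharp_def split: list.splits)
    then have "\<alpha> c x [ia] \<noteq> 0 \<or> \<alpha> c x [ib] \<noteq> 0" using nz by (auto simp: sharp_def sum_ab)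
    then show "c \<in> A \<and> x \<in> dom_of c \<and> length J = 1"
      using diff_forms_homogeneous[OF \<alpha>] J unfolding homogeneous_def by fastforce
  qed
  fix c assume c: "c \<in> A"
  have "smooth (dom_of c) (\<lambda>x. sharp P \<alpha> c x [ia])" "smooth (dom_of c) (\<lambda>x. sharp P \<alpha> c x [ib])"
    unfolding sharp_ab[OF P]
    by (intro smooth_minus smooth_mult multivec_smooth[OF P c] diff_forms_smooth[OF \<alpha> c])+
  then show "smooth (dom_of c) (\<lambda>x. sharp P \<alpha> c x [i])" for i using ab_cases[of i] by auto
  fix d x j assume d: "d \<in> A" and x: "x \<in> dom_of c" "x \<in> dom_of d"
  show "sharp P \<alpha> d x [j] = jac c d x j ia * sharp P \<alpha> c x [ia] + jac c d x j ib * sharp P \<alpha> c x [ib]"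
    using ab_cases[of j]
    by (elim disjE)
      (simp_all add: sharp_ab[OF P] multivec_2_trans[OF P c d x] diff_forms_1_trans[OF \<alpha> c d x] jd_def algebra_simps)
qed

text \<open>\<open>poisson_bracket\<close> is evaluated in the chart that \<open>to_fun\<close>
  selects, and this chart is the witness. One chart at each point is enough to compare the bracket
  with functions already known to be independent of the chart.\<close>

lemma poisson_bracket_chart:
  assumes "P \<in> multivec A 2"
  obtains c where "c \<in> A" "x \<in> dom_of c"
    "poisson_bracket A P f h x = P c x [ia, ib] * (cpd c ia f x * cpd c ib h x - cpd c ib f x * cpd c ia h x)"
proof -
  define c where "c = (SOME c. c \<in> A \<and> x \<in> dom_of c)"
  have "\<exists>c. c \<in> A \<and> x \<in> dom_of c" by (meson chart_cover)
  then have c: "c \<in> A \<and> x \<in> dom_of c" unfolding c_def by (rule someI_ex)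
  have "poisson_bracket A P f h x = (\<Sum>i\<in>UNIV. \<Sum>j\<in>UNIV. P c x [i, j] * cpd c i f x * cpd c j h x)"
    using c by (simp add: poisson_bracket_def to_fun_def c_def[symmetric] ext_d_of_fun)
  then show thesis
    using that[of c] c alternating_ab[OF multivec_alt[OF assms], of c x] by (simp add: sum_ab algebra_simps)
qed

context
  fixes P f
  assumes P: "P \<in> multivec A 2" and f: "smooth UNIV f"
begin

abbreviation "GP \<equiv> density_of P"
abbreviation "VP \<equiv> sharp P (codiff_form P f)"

lemma VP_multivec: "VP \<in> multivec A 1"
  by (rule sharp_multivec[OF P codiff_eq(2)[OF P f]])

lemma GP_smooth: "smooth UNIV GP"
  by (rule density_of_smooth[OF P])

lemma fGP_smooth: "smooth UNIV (f * GP)"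
  using smooth_mult[OF f GP_smooth] by (simp add: times_fun_def)

lemma codiff_form_cpd:
  assumes c: "c \<in> A" and x: "x \<in> dom_of c"
  shows "codiff_form P f c x [i] = - (f x * cpd c i GP x + cpd c i (f * GP) x)"
  by (simp add: fscale_def ext_d_of_fun[OF c x])

text \<open>The contraction of \<open>\<mu>\<close> with \<open>VP\<close> is exact: it is the differential of \<open>f * GP\<^sup>2\<close>.\<close>

lemma dv_VP: "dv VP x = 0"
proof -
  obtain c where c: "c \<in> A" and x: "x \<in> dom_of c" by (rule chart_cover)
  define Q where "Q y = (f * GP) y * GP y" for y
  have Q: "smooth UNIV Q" unfolding Q_def[abs_def] by (rule smooth_mult[OF fGP_smooth GP_smooth])
  have Qc: "smooth (dom_of c) Q" using smooth_subset[OF Q open_dom[OF c]] by simp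
  have dQ: "cpd c i Q y = - (GP y * codiff_form P f c y [i])" if "y \<in> dom_of c" for i y
    unfolding Q_def[abs_def] cpd_mult[OF fGP_smooth GP_smooth c UNIV_I that] codiff_form_cpd[OF c that]
    by (simp add: algebra_simps)
  have mV: "m c y * VP c y [ia] = cpd c ib Q y" "m c y * VP c y [ib] = - cpd c ia Q y" if "y \<in> dom_of c" for y
    unfolding sharp_ab[OF P] dQ[OF that] density_of_eq[OF P c that] by simp_all
  have "cpd c ia (\<lambda>y. m c y * VP c y [ia]) x = cpd c ia (cpd c ib Q) x"
    by (rule cpd_cong[OF c open_dom[OF c] x x]) (rule mV(1))
  moreover have "cpd c ib (\<lambda>y. m c y * VP c y [ib]) x = cpd c ib (\<lambda>y. - cpd c ia Q y) x"
    by (rule cpd_cong[OF c open_dom[OF c] x x]) (rule mV(2))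
  moreover have "cpd c ib (\<lambda>y. - cpd c ia Q y) x = - cpd c ib (cpd c ia Q) x"
    by (rule cpd_minus[OF smooth_cpd[OF Qc c order_refl] c x x])
  ultimately have "curl c VP x = 0"
    unfolding curl_def using cpd_commute[OF Qc c x x, of ia ib] by simp
  then show ?thesis using dv_curl[OF VP_multivec c x] m_nz[OF c x] by simp
qed

text \<open>The form \<open>f dg\<close> contributes nothing because \<open>P\<close> vanishes on
  the pair \<open>dg\<close>, \<open>dg\<close>; of \<open>d (f g)\<close> only the term
  \<open>g df\<close> survives.\<close>

lemma act_VP: "act VP GP x = - (GP x * poisson_bracket A P f GP x)"
proof -
  obtain c where c: "c \<in> A" "x \<in> dom_of c"
    and pb: "poisson_bracket A P f GP x = P c x [ia, ib] * (cpd c ia f x * cpd c ib GP x - cpd c ib f x * cpd c ia GP x)"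
    using poisson_bracket_chart[OF P] by blast
  have "cpd c i (f * GP) x = cpd c i f x * GP x + cpd c i GP x * f x" for i
    using cpd_mult[OF f GP_smooth c(1) UNIV_I c(2), of i] by (simp add: times_fun_def)
  then show ?thesis
    unfolding act_cpd[OF VP_multivec GP_smooth c] sharp_ab[OF P] codiff_form_cpd[OF c] pb
    by (simp add: algebra_simps)
qed

lemma schouten_VP_eq_0_iff:
  "schouten A 1 2 VP P = 0 \<longleftrightarrow> (\<forall>x. poisson_bracket A P f GP x = 0)"
proof -
  have sch: "sch P VP c x * m c x = GP x * poisson_bracket A P f GP x" if "c \<in> A" "x \<in> dom_of c" for c x
    unfolding sch_density[OF P VP_multivec that] dv_VP act_VP by simp
  have "schouten A 1 2 VP P = 0 \<longleftrightarrow> (\<forall>c\<in>A. \<forall>x\<in>dom_of c. sch P VP c x = 0)"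
    unfolding schouten_vec_bivec[OF P VP_multivec]
  proof
    assume z: "bivec (\<lambda>c x. - 1 * sch P VP c x) = 0"
    show "\<forall>c\<in>A. \<forall>x\<in>dom_of c. sch P VP c x = 0"
    proof (intro ballI)
      fix c x assume c: "c \<in> A" "x \<in> dom_of c"
      show "sch P VP c x = 0"
        using bivec_ab[OF c, of "\<lambda>c x. - 1 * sch P VP c x"] unfolding z by simp
    qed
  qed (auto simp: bivec_def fun_eq_iff)
  also have "\<dots> \<longleftrightarrow> (\<forall>x. GP x * poisson_bracket A P f GP x = 0)"
    using sch m_nz chart_cover by (metis mult_eq_0_iff)
  also have "\<dots> \<longleftrightarrow> (\<forall>x. poisson_bracket A P f GP x = 0)"
  proof (intro iff_allI iffI)
    fix x
    assume z: "GP x * poisson_bracket A P f GP x = 0"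
    obtain c where c: "c \<in> A" "x \<in> dom_of c"
      and pb: "poisson_bracket A P f GP x = P c x [ia, ib] * (cpd c ia f x * cpd c ib GP x - cpd c ib f x * cpd c ia GP x)"
      using poisson_bracket_chart[OF P] by blast
    show "poisson_bracket A P f GP x = 0"
    \<comment> \<open>The component of \<open>\<mu>\<close> is nonzero, so a zero of
      \<open>GP\<close> is a zero of \<open>P\<close> itself, and there every bracket
      vanishes.\<close>
    proof (cases "GP x = 0")
      case True
      then have "P c x [ia, ib] = 0" using density_of_eq[OF P c] m_nz[OF c] by simp
      then show ?thesis unfolding pb by simp
    qed (use z in simp)
  qed simp
  finally show ?thesis .
qed

end

text \<open>The components of two 2-forms change by the same determinant, so their quotient is a
  function; it is smooth because the denominator has no zeros.\<close>

lemma diff_forms_2_eq_fscale: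
  assumes \<beta>: "\<beta> \<in> diff_forms A 2"
  obtains f where "smooth UNIV f" "\<beta> = fscale f \<mu>"
proof
  define f where "f = to_fun A (\<lambda>c x I. \<beta> c x [ia, ib] / m c x)"
  have f_eq: "f x = \<beta> c x [ia, ib] / m c x" if c: "c \<in> A" and x: "x \<in> dom_of c" for c x
    unfolding f_def
  proof (rule to_fun_eq)
    fix d assume d: "d \<in> A" "x \<in> dom_of d"
    have "jd d c x \<noteq> 0" using m_trans[OF d(1) c d(2) x] m_nz[OF d] by auto
    then show "\<beta> d x [ia, ib] / m d x = \<beta> c x [ia, ib] / m c x"
      unfolding m_trans[OF d(1) c d(2) x] diff_forms_2_trans[OF \<beta> d(1) c d(2) x] by simp
  qed
  show f: "smooth UNIV f"
  proof (rule smooth_chartwise)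
    fix c assume c: "c \<in> A"
    show "smooth (dom_of c) f"
      by (rule smooth_cong[OF smooth_divide[OF diff_forms_smooth[OF \<beta> c] m_smooth[OF c] m_nz[OF c]]])
        (simp_all only: f_eq[OF c])
  qed
  show "\<beta> = fscale f \<mu>"
    by (rule alternating_2_eqI[OF diff_forms_alt[OF \<beta>] diff_forms_alt[OF diff_forms_2_fscale[OF vol_form f]]]) (simp add: fscale_def f_eq m_nz)
qed

end

theorem proposition5:
  fixes A :: "('a::{t2_space, second_countable_topology}, 2) chart set"
    and \<mu> \<pi> :: "('a, 2) tensor"
    and g :: "'a \<Rightarrow> real"
  assumes "closed_manifold A"
    and "orientable A"
    and "volume_form A \<mu>"
    and "\<pi> \<in> poisson_structures A"
    and "g = to_fun A (iota 2 \<pi> \<mu>)"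
  shows "(\<lambda>f. - sharp \<pi> (fscale f (ext_d A (of_fun A g)) + ext_d A (of_fun A (f * g))))
           ` casimir_set A \<pi> \<mu>
         = arising_poisson_fields A \<mu> \<pi>"
proof -
  interpret volume_surface A \<mu>
    using assms(1,3) by unfold_locales (simp_all add: closed_manifold_def)
  have P: "\<pi> \<in> multivec A 2" using assms(4) by (simp add: poisson_structures_def)
  have g: "g = density_of \<pi>" using assms(5) by (simp add: density_of_def)
  let ?V = "\<lambda>f. - sharp \<pi> (fscale f (ext_d A (of_fun A g)) + ext_d A (of_fun A (f * g)))"
  \<comment> \<open>With the Casimir condition restated as the Poisson condition on
    \<open>?V f\<close>, both inclusions amount to exhibiting the function \<open>f\<close>.\<close>
  have cas: "f \<in> casimir_set A \<pi> \<mu> \<longleftrightarrow> smooth UNIV f \<and> schouten A 1 2 (?V f) \<pi> = 0" for f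
  proof -
    have "f \<in> casimir_set A \<pi> \<mu> \<longleftrightarrow> smooth UNIV f \<and> (\<forall>x. poisson_bracket A \<pi> f g x = 0)"
      unfolding casimir_set_def smooth_functions_iff assms(5) by simp
    also have "\<dots> \<longleftrightarrow> smooth UNIV f \<and> schouten A 1 2 (?V f) \<pi> = 0"
      unfolding g sharp_uminus[symmetric] using schouten_VP_eq_0_iff[OF P, of f] by (rule conj_cong[OF refl, symmetric])
    finally show ?thesis .
  qed
  have V: "sharp \<pi> (codiff A \<mu> \<pi> 1 (fscale f \<mu>)) = ?V f" if "smooth UNIV f" for f
    unfolding codiff_eq(1)[OF P that] sharp_uminus g ..
  show ?thesis
  proof (intro set_eqI iffI)
    fix W
    assume "W \<in> ?V ` casimir_set A \<pi> \<mu>"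
    then obtain f where f: "smooth UNIV f" "schouten A 1 2 (?V f) \<pi> = 0" and W: "W = ?V f"
      using cas by blast
    \<comment> \<open>Every smooth \<open>f\<close> is realised: \<open>fscale f \<mu>\<close> is
      the gradient of \<open>weighted f\<close>, which lies in the algebra as a generator.\<close>
    have F: "weighted f \<in> functional_algebra A \<mu>"
      by (rule functional_algebra.base[OF weighted_local_functional[OF f(1)]])
    then have "restrict (weighted f) (poisson_structures A) \<in> admissible A \<mu>"
      unfolding admissible_def by blast
    then show "W \<in> arising_poisson_fields A \<mu> \<pi>"
      unfolding arising_poisson_fields_def W
      using F weighted_gradient[OF f(1)] V[OF f(1), symmetric] f(2) by blast
  next
    fix W
    assume "W \<in> arising_poisson_fields A \<mu> \<pi>"
    then obtain F \<beta> where "gradient A \<mu> F \<pi> \<beta>" and W: "W = sharp \<pi> (codiff A \<mu> \<pi> 1 \<beta>)" "schouten A 1 2 W \<pi> = 0"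
      unfolding arising_poisson_fields_def by blast
    \<comment> \<open>\<open>F\<close> enters only through its gradient, a 2-form and hence a single
      function \<open>f\<close>, whichever representative of the class was taken.\<close>
    then obtain f where f: "smooth UNIV f" "\<beta> = fscale f \<mu>"
      using diff_forms_2_eq_fscale gradient_def by metis
    then have "W = ?V f" using W(1) V by simp
    then show "W \<in> ?V ` casimir_set A \<pi> \<mu>" using cas f(1) W(2) by blast
  qed
qed

end
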